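(* Let $N\geq 2$, $b>0$, $p>1+\frac{2b}{N-1}$, and, if $N\geq 3$, $p<\frac{N+2+2b}{N-2}$. Let $\phi\in H^1_{\mathrm{rad}}(\mathbb R^N)$ be a non-trivial solution of $$-\Delta\phi+\phi-|x|^b|\phi|^{p-1}\phi=0\quad\text{on }\mathbb R^N.$$ Then the following properties hold: (i) $\phi\in C^2(\mathbb R^N)$ and $|D^\beta\phi(x)|\to 0$ as $|x|\to\infty$ for all multi-indices $\beta$ with $|\beta|\leq 2$; (ii) there exists $C>0$ such that $e^{C|x|}\left(|\phi(x)|+|\nabla\phi(x)|\right)\in L^\infty(\mathbb R^N)$.
   Context: $H^1_{\mathrm{rad}}(\mathbb R^N)$ is the space of radial functions (complex-valued) in $H^1(\mathbb R^N)$. *)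

theory Defs
  imports "HOL-Analysis.Analysis" "HOL-Library.Multiset"
begin

text \<open>Functions on \<open>\<real>\<^sup>N\<close> have type \<open>real ^ 'n \<Rightarrow> complex\<close> with \<open>N = CARD('n)\<close>.\<close>

subsection \<open>Classical derivatives\<close>

definition pdiff :: "'n::finite \<Rightarrow> (real ^ 'n \<Rightarrow> complex) \<Rightarrow> real ^ 'n \<Rightarrow> complex" where
  "pdiff i f x = frechet_derivative f (at x) (axis i 1)"

definition grad :: "(real ^ 'n::finite \<Rightarrow> complex) \<Rightarrow> real ^ 'n \<Rightarrow> complex ^ 'n" where
  "grad f x = (\<chi> i. pdiff i f x)"

definition laplacian :: "(real ^ 'n::finite \<Rightarrow> complex) \<Rightarrow> real ^ 'n \<Rightarrow> complex" where
  "laplacian f x = (\<Sum>i\<in>UNIV. pdiff i (pdiff i f) x)"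

text \<open>Differentiability is required explicitly because \<open>frechet_derivative\<close> is an
  arbitrary value where the derivative does not exist.\<close>

primrec Ck :: "nat \<Rightarrow> (real ^ 'n::finite \<Rightarrow> complex) \<Rightarrow> bool" where
  "Ck 0 f \<longleftrightarrow> continuous_on UNIV f"
| "Ck (Suc k) f \<longleftrightarrow> (\<forall>x. f differentiable at x) \<and> (\<forall>i. Ck k (pdiff i f))"

text \<open>A multi-index is a function \<open>\<beta> :: 'n \<Rightarrow> nat\<close>.  As the index type \<open>'n\<close> carries no order,
  \<open>D\<^sup>\<beta>\<close> is represented by the iterated partial derivatives along the lists of directions in
  which each \<open>i\<close> occurs \<open>\<beta> i\<close> times; such lists exist for every \<open>\<beta>\<close>, and for a function of class
  \<open>C\<^sup>k\<close> with \<open>k \<ge> \<bar>\<beta>\<bar>\<close> they all yield the same function (symmetry of mixed partials).\<close>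

definition mi_order :: "('n::finite \<Rightarrow> nat) \<Rightarrow> nat" where
  "mi_order \<beta> = (\<Sum>i\<in>UNIV. \<beta> i)"

definition mi_list :: "('n::finite \<Rightarrow> nat) \<Rightarrow> 'n list \<Rightarrow> bool" where
  "mi_list \<beta> ds \<longleftrightarrow> (\<forall>i. count_list ds i = \<beta> i)"

definition pdiffs :: "'n::finite list \<Rightarrow> (real ^ 'n \<Rightarrow> complex) \<Rightarrow> real ^ 'n \<Rightarrow> complex" where
  "pdiffs ds f = foldr pdiff ds f"

lemma mi_list_exists: "\<exists>ds. mi_list \<beta> ds"
proof -
  obtain ds where "mset ds = Abs_multiset \<beta>"
    using ex_mset by blast
  then have "mi_list \<beta> ds"
    unfolding mi_list_def by (metis count_mset count_Abs_multiset finite)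
  then show ?thesis ..
qed

subsection \<open>Function spaces\<close>

text \<open>Elements of these spaces are classes modulo equality almost everywhere; they are
  represented by functions, and membership in each of them (other than \<open>test_functions\<close>) is
  invariant under almost-everywhere equality.\<close>

definition L1_loc :: "(real ^ 'n::finite \<Rightarrow> complex) set" where
  "L1_loc = {f. \<forall>K. compact K \<longrightarrow> set_integrable lebesgue K f}"

definition L2 :: "(real ^ 'n::finite \<Rightarrow> complex) set" where
  "L2 = {f \<in> borel_measurable lebesgue. integrable lebesgue (\<lambda>x. (cmod (f x))\<^sup>2)}"

definition L_infinity :: "(real ^ 'n::finite \<Rightarrow> real) set" where
  "L_infinity = {f \<in> borel_measurable lebesgue. \<exists>M. AE x in lebesgue. \<bar>f x\<bar> \<le> M}"

definition test_functions :: "(real ^ 'n::finite \<Rightarrow> complex) set" where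
  "test_functions = {\<psi>. (\<forall>k. Ck k \<psi>) \<and> compact (closure {x. \<psi> x \<noteq> 0})}"

definition weak_pdiff :: "'n::finite \<Rightarrow> (real ^ 'n \<Rightarrow> complex) \<Rightarrow> (real ^ 'n \<Rightarrow> complex) \<Rightarrow> bool" where
  "weak_pdiff i f g \<longleftrightarrow> f \<in> L1_loc \<and> g \<in> L1_loc \<and>
     (\<forall>\<psi>\<in>test_functions.
        (LINT x|lebesgue. f x * pdiff i \<psi> x) = - (LINT x|lebesgue. g x * \<psi> x))"

definition H1 :: "(real ^ 'n::finite \<Rightarrow> complex) set" where
  "H1 = {f \<in> L2. \<forall>i. \<exists>g\<in>L2. weak_pdiff i f g}"

definition H1_rad :: "(real ^ 'n::finite \<Rightarrow> complex) set" where
  "H1_rad = {f \<in> H1. \<exists>h. AE x in lebesgue. f x = h (norm x)}"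

subsection \<open>The equation\<close>

text \<open>\<open>\<phi>\<close> solves \<open>- \<Delta>\<phi> + \<phi> - |x|\<^sup>b |\<phi>|\<^bsup>p-1\<^esup> \<phi> = 0\<close> in the sense of distributions.\<close>

definition solves :: "real \<Rightarrow> real \<Rightarrow> (real ^ 'n::finite \<Rightarrow> complex) \<Rightarrow> bool" where
  "solves b p \<phi> \<longleftrightarrow>
     (let F = (\<lambda>x. complex_of_real (norm x powr b * cmod (\<phi> x) powr (p - 1)) * \<phi> x) in
      \<phi> \<in> L1_loc \<and> F \<in> L1_loc \<and>
      (\<forall>\<psi>\<in>test_functions.
         - (LINT x|lebesgue. \<phi> x * laplacian \<psi> x) + (LINT x|lebesgue. \<phi> x * \<psi> x)
           - (LINT x|lebesgue. F x * \<psi> x) = 0))"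

end

theory Submission
  imports Defs
begin

text \<open>
  A radial function has the form \<open>W (x \<bullet> x)\<close>.  In the variable \<open>t = x \<bullet> x\<close>, with \<open>\<nu> = N / 2\<close> and
  \<open>V = t\<^bsup>b/2\<^esup> |W|\<^bsup>p-1\<^esup>\<close>, the equation becomes \<open>(4 t\<^sup>\<nu> W')' = t\<^bsup>\<nu>-1\<^esup> (1 - V) W\<close>, and all assertions can be read off the
  profile \<open>W\<close>.

  The distributional equation, tested with functions of \<open>x \<bullet> x\<close> that need not vanish at the origin, yields the
  integrated form \<open>4 t\<^sup>\<nu> W'(t) = \<integral>\<^sub>0\<^sup>t s\<^bsup>\<nu>-1\<^esup> (1 - V) W ds\<close> for \<open>t > 0\<close>
  (\<open>radial_profile_ODE\<close>).  It makes \<open>W\<close> smooth enough away from \<open>t = 0\<close> and excludes solutions with a source at the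
  origin.  Membership in \<open>H\<^sup>1\<close> bounds the integrals of \<open>t\<^sup>\<nu> |W'|\<^sup>2\<close> and \<open>t\<^bsup>\<nu>-1\<^esup> |W|\<^sup>2\<close>
  (\<open>radial_energy_bounds\<close>); this uses the weak gradient only through its pairing with radial vector fields.
  What follows is one-dimensional and takes place in the locale \<open>radial_ode\<close>.

  Near the origin the energy gives \<open>|W| \<le> C t\<^bsup>-\<alpha>\<^esup>\<close> with \<open>\<alpha> = (\<nu> - 1) / 2\<close>, or with any \<open>\<alpha> > 0\<close> in dimension two.
  Subcriticality of \<open>p\<close> means that then \<open>V \<le> C t\<^bsup>\<delta>-1\<^esup>\<close> for some \<open>\<delta> > 0\<close>, so that each pass through the integrated
  equation improves the exponent by a fixed amount and \<open>W\<close> is bounded after finitely many passes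
  (\<open>bounded_near_0\<close>).  Consequently \<open>W\<close> and \<open>W'\<close> have limits and \<open>t W'' \<longlonglongrightarrow> 0\<close> at the origin
  (\<open>limits_at_0\<close>), which is what \<open>W (x \<bullet> x)\<close> needs to be of class \<open>C\<^sup>2\<close> (\<open>Ck_2_radial\<close>).

  At infinity the radial lemma of Strauss and \<open>p > 1 + 2 b / (N - 1)\<close> give \<open>V \<longlonglongrightarrow> 0\<close>.  The quantity
  \<open>q = - t\<^sup>\<nu> Re (cnj W * W')\<close> then decreases at least at the rate of the energy density, by which it is in turn
  controlled; monotonicity and the finiteness of the energy force \<open>q\<close>, and with it \<open>|W|\<^sup>2 + t |W'|\<^sup>2\<close>, to decay like
  \<open>exp (- (sqrt t / 4))\<close> (\<open>exponential_decay\<close>).  The second derivatives follow from the equation.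
\<close>


section \<open>Smooth functions on the line\<close>

text \<open>The one-variable counterpart of \<open>Ck\<close>, with \<open>deriv\<close> in place of the partial derivatives.  Defining
  the class by recursion on the order turns every closure property below into a short induction.\<close>

primrec CkR :: "nat \<Rightarrow> (real \<Rightarrow> real) \<Rightarrow> bool" where
  "CkR 0 f \<longleftrightarrow> continuous_on UNIV f"
| "CkR (Suc k) f \<longleftrightarrow> (\<forall>x. (f has_real_derivative deriv f x) (at x)) \<and> CkR k (deriv f)"

definition smooth :: "(real \<Rightarrow> real) \<Rightarrow> bool" where
  "smooth f \<longleftrightarrow> (\<forall>k. CkR k f)"

lemma CkR_SucI:
  assumes "\<And>x. (f has_real_derivative f' x) (at x)" "CkR k f'"
  shows "CkR (Suc k) f"
proof -
  have "deriv f = f'"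
    using assms(1) by (auto intro!: DERIV_imp_deriv)
  then show ?thesis using assms by simp
qed

lemma CkR_pred: "CkR (Suc k) f \<Longrightarrow> CkR k f"
proof (induction k arbitrary: f)
  case 0
  then show ?case
    by (auto simp: continuous_on_eq_continuous_at intro: DERIV_isCont)
next
  case (Suc k)
  then show ?case by auto
qed

lemma CkR_const: "CkR k (\<lambda>x. c)"
proof (induction k arbitrary: c)
  case (Suc k)
  show ?case by (rule CkR_SucI[of _ "\<lambda>x. 0"]) (auto intro: Suc)
qed auto

lemma CkR_add: "CkR k f \<Longrightarrow> CkR k g \<Longrightarrow> CkR k (\<lambda>x. f x + g x)"
proof (induction k arbitrary: f g)
  case 0
  then show ?case by (simp add: continuous_on_add)
next
  case (Suc k)
  have "((\<lambda>x. f x + g x) has_real_derivative deriv f x + deriv g x) (at x)" for x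
    using Suc.prems by (intro DERIV_add) simp_all
  moreover have "CkR k (\<lambda>x. deriv f x + deriv g x)" using Suc by simp
  ultimately show ?case by (rule CkR_SucI)
qed

lemma CkR_mult: "CkR k f \<Longrightarrow> CkR k g \<Longrightarrow> CkR k (\<lambda>x. f x * g x)"
proof (induction k arbitrary: f g)
  case 0
  then show ?case by (simp add: continuous_on_mult)
next
  case (Suc k)
  have "((\<lambda>x. f x * g x) has_real_derivative deriv f x * g x + deriv g x * f x) (at x)" for x
    using Suc.prems by (intro DERIV_mult) simp_all
  moreover have "CkR k (\<lambda>x. deriv f x * g x + deriv g x * f x)"
    by (rule CkR_add; rule Suc.IH) (use Suc.prems CkR_pred[of k f] CkR_pred[of k g] in simp_all)
  ultimately show ?case by (rule CkR_SucI)
qed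

lemma CkR_affine: "CkR k f \<Longrightarrow> CkR k (\<lambda>x. f (m * x + d))"
proof (induction k arbitrary: f)
  case 0
  then have "continuous_on UNIV f" by simp
  then have "continuous_on UNIV (\<lambda>x. f (m * x + d))"
    by (rule continuous_on_compose2[where t = UNIV]) (auto intro!: continuous_on_add continuous_on_mult)
  then show ?case by simp
next
  case (Suc k)
  have "((\<lambda>x. f (m * x + d)) has_real_derivative deriv f (m * x + d) * m) (at x)" for x
  proof (rule DERIV_chain2[where f = f and g = "\<lambda>x. m * x + d"])
    show "(f has_real_derivative deriv f (m * x + d)) (at (m * x + d))" using Suc.prems by simp
    show "((\<lambda>x. m * x + d) has_real_derivative m) (at x)"
      by (auto intro!: derivative_eq_intros)
  qed
  moreover have "CkR k (\<lambda>x. deriv f (m * x + d) * m)"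
    by (intro CkR_mult CkR_const Suc.IH) (use Suc.prems in simp)
  ultimately show ?case by (rule CkR_SucI)
qed

lemma smooth_const: "smooth (\<lambda>x. c)"
  and smooth_add: "smooth f \<Longrightarrow> smooth g \<Longrightarrow> smooth (\<lambda>x. f x + g x)"
  and smooth_mult: "smooth f \<Longrightarrow> smooth g \<Longrightarrow> smooth (\<lambda>x. f x * g x)"
  and smooth_affine: "smooth f \<Longrightarrow> smooth (\<lambda>x. f (m * x + d))"
  by (simp_all add: smooth_def CkR_const CkR_add CkR_mult CkR_affine)

lemma smooth_deriv: "smooth f \<Longrightarrow> smooth (deriv f)"
  unfolding smooth_def using CkR.simps(2) by blast

lemma smooth_DERIV: "smooth f \<Longrightarrow> (f has_real_derivative deriv f x) (at x)"
  unfolding smooth_def using CkR.simps(2)[of 0] by blast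

lemma smooth_continuous: "smooth f \<Longrightarrow> continuous_on S f"
  unfolding smooth_def using CkR.simps(1) continuous_on_subset by blast

lemma smooth_antideriv:
  assumes "\<And>x. (f has_real_derivative f' x) (at x)" "smooth f'"
  shows "smooth f"
  unfolding smooth_def
proof
  fix k show "CkR k f"
    using CkR_pred[OF CkR_SucI[OF assms(1)]] assms(2) by (auto simp: smooth_def)
qed

lemma deriv_eq_0_right:
  assumes "smooth \<theta>" "\<And>t. t > T \<Longrightarrow> \<theta> t = 0" "t > T"
  shows "deriv \<theta> t = 0"
proof -
  have "(\<theta> has_real_derivative 0) (at t)"
    by (rule has_field_derivative_transform_within_open[of "\<lambda>_. 0" 0 t "{T<..}"]) (use assms in auto)
  then show ?thesis by (rule DERIV_imp_deriv)
qed

lemma deriv_eq_0_left: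
  assumes "smooth \<theta>" "\<And>t. t < T \<Longrightarrow> \<theta> t = 0" "t < T"
  shows "deriv \<theta> t = 0"
proof -
  have "(\<theta> has_real_derivative 0) (at t)"
    by (rule has_field_derivative_transform_within_open[of "\<lambda>_. 0" 0 t "{..<T}"]) (use assms in auto)
  then show ?thesis by (rule DERIV_imp_deriv)
qed

text \<open>The constant of integration is chosen so that the primitive vanishes to the right of the support of
  \<open>\<kappa>\<close>.  To the left it is constant but in general not \<open>0\<close>; the radial test functions built from such
  primitives therefore see the origin, and this is how the equation at the origin enters the proof.\<close>

lemma smooth_primitive:
  assumes "smooth \<kappa>" "\<And>t. t \<ge> b \<Longrightarrow> \<kappa> t = 0"
  obtains \<theta> where "smooth \<theta>" "deriv \<theta> = \<kappa>" "\<And>t. t \<ge> b \<Longrightarrow> \<theta> t = 0"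
proof -
  have "isCont \<kappa> t" for t
    using smooth_continuous[OF assms(1), of UNIV] by (simp add: continuous_on_eq_continuous_at)
  then have "\<exists>F. \<forall>t::real. - \<infinity> < ereal t \<longrightarrow> ereal t < \<infinity> \<longrightarrow> (F has_vector_derivative \<kappa> t) (at t)"
    by (intro einterval_antiderivative) auto
  then obtain F where F: "\<And>t. (F has_real_derivative \<kappa> t) (at t)"
    by (auto simp: has_real_derivative_iff_has_vector_derivative)
  define \<theta> where "\<theta> t = F t - F b" for t
  have d: "(\<theta> has_real_derivative \<kappa> t) (at t)" for t
    unfolding \<theta>_def using F[of t] by (auto intro!: derivative_eq_intros)
  have "\<theta> t = 0" if "t \<ge> b" for t
  proof (cases "t = b")
    case False
    have "(\<theta> has_real_derivative 0) (at s within {b..t})" if "s \<in> {b..t}" for s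
      using d[of s] assms(2)[of s] that by (auto intro: DERIV_subset)
    then have "\<theta> b = \<theta> t"
      using False that has_field_derivative_zero_constant[of "{b..t}" \<theta>] by fastforce
    then show ?thesis by (simp add: \<theta>_def)
  qed (simp add: \<theta>_def)
  moreover have "smooth \<theta>" by (rule smooth_antideriv[OF d assms(1)])
  moreover have "deriv \<theta> = \<kappa>" using d by (auto intro: DERIV_imp_deriv)
  ultimately show ?thesis using that by blast
qed

lemma smooth_id: "smooth (\<lambda>x. x)"
  by (rule smooth_antideriv[of _ "\<lambda>x. 1"]) (auto intro: smooth_const)

lemma smooth_real_polynomial_function:
  "real_polynomial_function f \<Longrightarrow> smooth f"
proof (induction f rule: real_polynomial_function.induct)
  case (linear f)
  then have "f = (\<lambda>x. x * f 1)"
    by (metis (no_types, lifting) bounded_linear_def linear_cmul mult.right_neutral real_scaleR_def)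
  moreover have "smooth (\<lambda>x. x * f 1)" by (intro smooth_mult smooth_id smooth_const)
  ultimately show ?case by simp
qed (auto intro: smooth_const smooth_add smooth_mult)

text \<open>Differentiating \<open>exp (- (1 / t))\<close> only produces linear combinations of these functions, so the family
  is closed under derivatives and smoothness follows by induction over all \<open>m\<close> at once.\<close>

definition flat :: "nat \<Rightarrow> real \<Rightarrow> real" where
  "flat m t = (if t > 0 then (1 / t) ^ m * exp (- (1 / t)) else 0)"

lemma flat_DERIV: "(flat m has_real_derivative flat (m + 2) t - real m * flat (m + 1) t) (at t)"
proof -
  consider "t > 0" | "t < 0" | "t = 0" by linarith
  then show ?thesis
  proof cases
    case 1
    have "real m * (1 / t) ^ (m - 1) * (- 1 / t\<^sup>2) = - real m * (1 / t) ^ (m + 1)"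
      using 1 by (cases m) (auto simp: power2_eq_square divide_simps)
    then have "((\<lambda>t. (1 / t) ^ m * exp (- (1 / t))) has_real_derivative
        flat (m + 2) t - real m * flat (m + 1) t) (at t)"
      using 1 unfolding flat_def
      by (auto intro!: derivative_eq_intros simp: algebra_simps power2_eq_square)
    moreover have "eventually (\<lambda>s. (1 / s) ^ m * exp (- (1 / s)) = flat m s) (nhds t)"
      using eventually_nhds_in_open[of "{0<..}" t] 1
      by (auto elim!: eventually_mono simp: flat_def)
    ultimately show ?thesis by (rule DERIV_cong_ev[OF refl _ refl, THEN iffD1, rotated])
  next
    case 2
    have "((\<lambda>t. 0) has_real_derivative flat (m + 2) t - real m * flat (m + 1) t) (at t)"
      using 2 by (simp add: flat_def)
    moreover have "eventually (\<lambda>s. 0 = flat m s) (nhds t)"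
      using eventually_nhds_in_open[of "{..<0}" t] 2
      by (auto elim!: eventually_mono simp: flat_def)
    ultimately show ?thesis by (rule DERIV_cong_ev[OF refl _ refl, THEN iffD1, rotated])
  next
    case 3
    have "((\<lambda>y::real. y ^ Suc m / exp y) \<longlongrightarrow> 0) at_top"
      by (rule tendsto_power_div_exp_0)
    then have "((\<lambda>h. (inverse h) ^ Suc m / exp (inverse h)) \<longlongrightarrow> (0::real)) (at_right 0)"
      by (rule filterlim_compose) (rule filterlim_inverse_at_top_right)
    then have "((\<lambda>h. flat m h / h) \<longlongrightarrow> 0) (at_right 0)"
    proof (rule Lim_transform_eventually)
      show "\<forall>\<^sub>F h in at_right 0. inverse h ^ Suc m / exp (inverse h) = flat m h / h"
        by (auto simp: flat_def eventually_at_filter exp_minus field_simps)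
    qed
    moreover have "((\<lambda>h. flat m h / h) \<longlongrightarrow> 0) (at_left 0)"
      by (rule Lim_transform_eventually[of "\<lambda>_. 0"])
        (auto simp: flat_def eventually_at_filter)
    ultimately have "((\<lambda>h. flat m h / h) \<longlongrightarrow> 0) (at 0)"
      by (simp add: filterlim_split_at)
    then show ?thesis unfolding 3 DERIV_def by (simp add: flat_def)
  qed
qed

lemma smooth_flat: "smooth (flat m)"
proof -
  have "CkR k (flat m)" for k
  proof (induction k arbitrary: m)
    case 0
    show ?case using flat_DERIV DERIV_isCont by (fastforce simp: continuous_on_eq_continuous_at)
  next
    case (Suc k)
    have "CkR k (\<lambda>t. flat (m + 2) t + (- real m) * flat (m + 1) t)"
      by (intro CkR_add CkR_mult CkR_const Suc)
    then show ?case by (intro CkR_SucI[OF flat_DERIV]) auto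
  qed
  then show ?thesis by (simp add: smooth_def)
qed

text \<open>A bump supported in \<open>[a, b]\<close>; the larger \<open>n\<close>, the steeper its two flanks.\<close>

definition bump :: "real \<Rightarrow> real \<Rightarrow> real \<Rightarrow> real \<Rightarrow> real" where
  "bump a b n t = flat 0 (n * t + - (n * a)) * flat 0 ((- n) * t + n * b)"

lemma smooth_bump: "smooth (bump a b n)"
  unfolding bump_def by (intro smooth_mult smooth_affine smooth_flat)

lemma bump_nonneg: "0 \<le> bump a b n t"
  by (simp add: bump_def flat_def)

lemma bump_le_1: "bump a b n t \<le> 1"
  by (auto simp: bump_def flat_def mult_le_one)

lemma bump_eq_0: "n \<ge> 0 \<Longrightarrow> t \<le> a \<or> t \<ge> b \<Longrightarrow> bump a b n t = 0"
  by (auto simp: bump_def flat_def  mult_left_mono) (smt (verit) mult_left_mono)+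

lemma bump_pos: "n > 0 \<Longrightarrow> a < t \<Longrightarrow> t < b \<Longrightarrow> bump a b n t > 0"
  by (auto simp: bump_def flat_def)

text \<open>Because the convergence is pointwise and all bumps are at most \<open>1\<close>, identities tested against smooth
  functions pass to intervals by dominated convergence.\<close>

lemma bump_tendsto:
  "(\<lambda>n. bump a b (real (Suc n)) t) \<longlonglongrightarrow> indicat_real {a<..<b} t"
proof (cases "a < t \<and> t < b")
  case True
  have *: "(\<lambda>n. flat 0 (real (Suc n) * d)) \<longlonglongrightarrow> 1" if "d > 0" for d
  proof -
    have "(\<lambda>n. exp (- (inverse (real (Suc n)) * inverse d))) \<longlonglongrightarrow> exp (- (0 * inverse d))"
      by (intro tendsto_intros LIMSEQ_inverse_real_of_nat)
    then show ?thesis using that by (simp add: flat_def inverse_eq_divide mult.commute)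
  qed
  have "(\<lambda>n. flat 0 (real (Suc n) * (t - a)) * flat 0 (real (Suc n) * (b - t))) \<longlonglongrightarrow> 1 * 1"
    using True by (intro tendsto_mult *) auto
  then show ?thesis using True by (simp add: bump_def algebra_simps)
next
  case False
  then have "bump a b (real (Suc n)) t = 0" for n by (intro bump_eq_0) auto
  then show ?thesis using False by simp
qed

section \<open>Radial test functions\<close>

lemma pdiff_has_derivative: "(f has_derivative f') (at x) \<Longrightarrow> pdiff i f x = f' (axis i 1)"
  unfolding pdiff_def using frechet_derivative_at by metis

lemma pdiff_add:
  assumes "f differentiable at x" "g differentiable at x"
  shows "pdiff i (\<lambda>x. f x + g x) x = pdiff i f x + pdiff i g x"
  using assms unfolding frechet_derivative_works
  by (subst pdiff_has_derivative[OF has_derivative_add]) (auto simp: pdiff_def)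

lemma pdiff_mult:
  assumes "f differentiable at x" "g differentiable at x"
  shows "pdiff i (\<lambda>x. f x * g x) x = f x * pdiff i g x + pdiff i f x * g x"
  using assms unfolding frechet_derivative_works
  by (subst pdiff_has_derivative[OF has_derivative_mult]) (auto simp: pdiff_def)

lemma Ck_pred: "Ck (Suc k) f \<Longrightarrow> Ck k f"
proof (induction k arbitrary: f)
  case 0
  then show ?case
    by (auto simp: continuous_on_eq_continuous_at intro: differentiable_imp_continuous_within)
next
  case (Suc k)
  then show ?case by auto
qed

lemma Ck_const: "Ck k (\<lambda>x::real^'n::finite. c)"
proof (induction k arbitrary: c)
  case (Suc k)
  have "pdiff i (\<lambda>x. c) = (\<lambda>x. 0)" for i :: 'n
    by (rule ext, subst pdiff_has_derivative[OF has_derivative_const]) auto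
  then show ?case using Suc by simp
qed auto

lemma Ck_add: "Ck k f \<Longrightarrow> Ck k g \<Longrightarrow> Ck k (\<lambda>x. f x + g x)"
proof (induction k arbitrary: f g)
  case (Suc k)
  have "pdiff i (\<lambda>x. f x + g x) = (\<lambda>x. pdiff i f x + pdiff i g x)" for i
    using Suc.prems by (intro ext pdiff_add) auto
  then show ?case using Suc by auto
qed (auto intro: continuous_on_add)

lemma Ck_mult: "Ck k f \<Longrightarrow> Ck k g \<Longrightarrow> Ck k (\<lambda>x. f x * g x)"
proof (induction k arbitrary: f g)
  case (Suc k)
  have "pdiff i (\<lambda>x. f x * g x) = (\<lambda>x. f x * pdiff i g x + pdiff i f x * g x)" for i
    using Suc.prems by (intro ext pdiff_mult) auto
  moreover have "Ck k (\<lambda>x. f x * pdiff i g x + pdiff i f x * g x)" for i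
    using Suc.prems Ck_pred[of k f] Ck_pred[of k g] by (auto intro!: Ck_add Suc.IH)
  ultimately show ?case using Suc.prems by auto
qed (auto intro: continuous_on_mult)

lemma has_derivative_coord:
  "((\<lambda>x::real^'n. complex_of_real (x $ i)) has_derivative (\<lambda>h. complex_of_real (h $ i))) (at x)"
  by (intro bounded_linear_imp_has_derivative bounded_linear_compose[OF bounded_linear_of_real]
      bounded_linear_vec_nth)

lemma Ck_coord: "Ck k (\<lambda>x::real^'n::finite. complex_of_real (x $ i))"
proof (cases k)
  case 0
  then show ?thesis by (auto intro!: continuous_intros)
next
  case (Suc k)
  have "pdiff j (\<lambda>x::real^'n. complex_of_real (x $ i)) = (\<lambda>x. if i = j then 1 else 0)" for j
    by (rule ext, subst pdiff_has_derivative[OF has_derivative_coord]) (auto simp: axis_def)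
  then show ?thesis unfolding Suc using has_derivative_coord differentiable_def
    by (auto intro!: Ck_const simp del: of_real_eq_0_iff) blast+
qed

lemma has_derivative_sqnorm:
  fixes f :: "real \<Rightarrow> 'a::real_normed_vector"
  assumes "(f has_vector_derivative D) (at (x \<bullet> x))"
  shows "((\<lambda>x::real^'n. f (x \<bullet> x)) has_derivative (\<lambda>h. (2 * (x \<bullet> h)) *\<^sub>R D)) (at x)"
proof -
  have "((\<lambda>x::real^'n. x \<bullet> x) has_derivative (\<lambda>h. 2 * (x \<bullet> h))) (at x)"
    by (auto intro!: derivative_eq_intros simp: inner_commute)
  from has_derivative_compose[OF this assms[unfolded has_vector_derivative_def]]
  show ?thesis .
qed

lemma smooth_has_vector_derivative:
  "smooth \<theta> \<Longrightarrow> ((\<lambda>t. complex_of_real (\<theta> t)) has_vector_derivative complex_of_real (deriv \<theta> t)) (at t)"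
  by (rule has_vector_derivative_of_real) (use smooth_DERIV in \<open>simp add: has_real_derivative_iff_has_vector_derivative\<close>)

lemma pdiff_sqnorm:
  assumes "(f has_vector_derivative D) (at (x \<bullet> x))"
  shows "pdiff i (\<lambda>x::real^'n::finite. f (x \<bullet> x)) x = of_real (2 * x $ i) * D"
  by (subst pdiff_has_derivative[OF has_derivative_sqnorm[OF assms]])
    (simp add: inner_axis scaleR_conv_of_real)

lemma pdiff_smooth_sqnorm:
  assumes "smooth \<theta>"
  shows "pdiff i (\<lambda>x::real^'n::finite. complex_of_real (\<theta> (x \<bullet> x))) =
    (\<lambda>x. (of_real 2 * of_real (x $ i)) * of_real (deriv \<theta> (x \<bullet> x)))"
  by (rule ext, subst pdiff_sqnorm[OF smooth_has_vector_derivative[OF assms]]) simp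

lemma smooth_sqnorm_differentiable:
  "smooth \<theta> \<Longrightarrow> (\<lambda>x::real^'n::finite. complex_of_real (\<theta> (x \<bullet> x))) differentiable at x"
  using has_derivative_sqnorm[OF smooth_has_vector_derivative] differentiable_def by blast

lemma Ck_smooth_sqnorm: "smooth \<theta> \<Longrightarrow> Ck k (\<lambda>x::real^'n::finite. complex_of_real (\<theta> (x \<bullet> x)))"
proof (induction k arbitrary: \<theta>)
  case 0
  have "(\<lambda>x::real^'n::finite. complex_of_real (\<theta> (x \<bullet> x))) differentiable_on UNIV"
    unfolding differentiable_on_def by (intro ballI smooth_sqnorm_differentiable 0)
  then show ?case unfolding Ck.simps by (rule differentiable_imp_continuous_on)
next
  case (Suc k)
  have "\<forall>x. (\<lambda>x::real^'n::finite. complex_of_real (\<theta> (x \<bullet> x))) differentiable at x"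
    by (intro allI smooth_sqnorm_differentiable Suc.prems)
  then show ?case
    by (auto simp: pdiff_smooth_sqnorm[OF Suc.prems] simp del: of_real_numeral
        intro!: Ck_mult Ck_const Ck_coord Suc smooth_deriv)
qed

lemma test_functionsI:
  fixes \<psi> :: "real^'n::finite \<Rightarrow> complex"
  assumes "\<And>k. Ck k \<psi>" "\<And>x. x \<bullet> x \<ge> T \<Longrightarrow> \<psi> x = 0"
  shows "\<psi> \<in> test_functions"
proof -
  have "norm x \<le> max 1 T" if "\<psi> x \<noteq> 0" for x
  proof (rule ccontr)
    assume "\<not> norm x \<le> max 1 T"
    then have "norm x > 1" "norm x > T" by auto
    then have "norm x * norm x > T" by (smt (verit) mult_le_cancel_left1)
    then show False using assms(2)[of x] that by (simp add: dot_square_norm power2_eq_square)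
  qed
  then have "bounded {x. \<psi> x \<noteq> 0}" unfolding bounded_iff by auto
  then show ?thesis using assms(1) by (auto simp: test_functions_def)
qed

lemma test_sqnorm:
  assumes "smooth \<theta>" "\<And>t. t \<ge> T \<Longrightarrow> \<theta> t = 0"
  shows "(\<lambda>x::real^'n::finite. complex_of_real (\<theta> (x \<bullet> x))) \<in> test_functions"
  using assms by (intro test_functionsI[where T = T] Ck_smooth_sqnorm) auto

lemma test_coord_sqnorm:
  assumes "smooth \<theta>" "\<And>t. t \<ge> T \<Longrightarrow> \<theta> t = 0"
  shows "(\<lambda>x::real^'n::finite. complex_of_real (x $ i) * complex_of_real (\<theta> (x \<bullet> x))) \<in> test_functions"
  using assms by (intro test_functionsI[where T = T] Ck_smooth_sqnorm Ck_mult Ck_coord) auto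

lemma pdiff_coord_sqnorm:
  assumes "smooth \<theta>"
  shows "pdiff j (\<lambda>x::real^'n::finite. complex_of_real (x $ i) * complex_of_real (\<theta> (x \<bullet> x))) x =
    of_real (2 * (x $ i) * (x $ j) * deriv \<theta> (x \<bullet> x)) + of_real (if i = j then \<theta> (x \<bullet> x) else 0)"
proof -
  have "pdiff j (\<lambda>x::real^'n. complex_of_real (x $ i)) x = (if i = j then 1 else 0)"
    by (subst pdiff_has_derivative[OF has_derivative_coord]) (auto simp: axis_def)
  then show ?thesis
    using has_derivative_coord smooth_sqnorm_differentiable[OF assms]
    by (subst pdiff_mult) (auto simp: pdiff_smooth_sqnorm[OF assms] intro: differentiableI)
qed

text \<open>With \<open>\<nu> = N / 2\<close> the value is \<open>4 t\<^bsup>1-\<nu>\<^esup> (t\<^sup>\<nu> \<theta>')'\<close> at \<open>t = x \<bullet> x\<close>.  Since \<open>t\<^bsup>\<nu>-1\<^esup>\<close> is, up to a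
  constant, the density of the measure in the variable \<open>t\<close>, the Laplacian of a radial function is a
  derivative after integration over \<open>\<real>\<^sup>N\<close>.\<close>

lemma laplacian_sqnorm:
  assumes "smooth \<theta>"
  shows "laplacian (\<lambda>x::real^'n::finite. complex_of_real (\<theta> (x \<bullet> x))) x =
    of_real (4 * (x \<bullet> x) * deriv (deriv \<theta>) (x \<bullet> x) + 2 * real CARD('n) * deriv \<theta> (x \<bullet> x))"
proof -
  have s: "smooth (\<lambda>t. 2 * deriv \<theta> t)" by (intro smooth_mult smooth_const smooth_deriv assms)
  have d: "deriv (\<lambda>t. 2 * deriv \<theta> t) t = 2 * deriv (deriv \<theta>) t" for t
    by (intro DERIV_imp_deriv DERIV_cmult smooth_DERIV smooth_deriv assms)
  have 1: "pdiff i (\<lambda>x::real^'n. complex_of_real (\<theta> (x \<bullet> x))) =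
    (\<lambda>x. complex_of_real (x $ i) * complex_of_real ((\<lambda>t. 2 * deriv \<theta> t) (x \<bullet> x)))" for i
    by (simp add: pdiff_smooth_sqnorm[OF assms] mult.assoc mult.left_commute)
  have 2: "x \<bullet> x = (\<Sum>i\<in>UNIV. x $ i * x $ i)" by (simp add: inner_vec_def)
  show ?thesis
    unfolding laplacian_def 1 pdiff_coord_sqnorm[OF s] d
    unfolding 2
    by (simp add: sum.distrib sum_distrib_left sum_distrib_right flip: of_real_sum of_real_mult)
      (simp add: algebra_simps sum_distrib_left)
qed

section \<open>The squared norm as a change of variables\<close>

text \<open>The derivative of the volume of the ball of radius \<open>sqrt t\<close> in dimension \<open>n\<close>, as a function of \<open>t\<close>.\<close>

definition rad_weight :: "nat \<Rightarrow> real \<Rightarrow> real" where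
  "rad_weight n t = indicator {0<..} t * (unit_ball_vol (real n) * (real n / 2) * t powr (real n / 2 - 1))"

lemma rad_weight_measurable [measurable]: "rad_weight n \<in> borel_measurable borel"
  unfolding rad_weight_def[abs_def] by measurable

lemma rad_weight_nonneg: "0 \<le> rad_weight n t"
  by (simp add: rad_weight_def)

lemma rad_weight_pos: "n > 0 \<Longrightarrow> t > 0 \<Longrightarrow> 0 < rad_weight n t"
  by (simp add: rad_weight_def)

lemma nn_integral_rad_weight:
  assumes "n > 0" "s \<ge> 0"
  shows "(\<integral>\<^sup>+t. ennreal (rad_weight n t) * indicator {..s} t \<partial>lborel) =
    ennreal (unit_ball_vol (real n) * s powr (real n / 2))"
proof -
  have "((\<lambda>t. t powr (real n / 2 - 1)) has_integral s powr (real n / 2 - 1 + 1) / (real n / 2 - 1 + 1)) {0..s}"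
    using assms by (intro has_integral_powr_from_0) auto
  then have "((\<lambda>t. (unit_ball_vol (real n) * (real n / 2)) * t powr (real n / 2 - 1)) has_integral
      (unit_ball_vol (real n) * (real n / 2)) * (s powr (real n / 2) / (real n / 2))) {0..s}"
    by (intro has_integral_mult_right) simp
  moreover have "(unit_ball_vol (real n) * (real n / 2)) * (s powr (real n / 2) / (real n / 2))
     = unit_ball_vol (real n) * s powr (real n / 2)"
    using assms by simp
  ultimately have "((\<lambda>t. if t \<in> {0..s} then (unit_ball_vol (real n) * (real n / 2)) * t powr (real n / 2 - 1) else 0)
      has_integral unit_ball_vol (real n) * s powr (real n / 2)) UNIV"
    by (subst has_integral_restrict_UNIV) simp
  moreover have "(\<lambda>t. if t \<in> {0..s} then (unit_ball_vol (real n) * (real n / 2)) * t powr (real n / 2 - 1) else 0) =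
      (\<lambda>t. rad_weight n t * indicator {..s} t)"
    by (auto simp: rad_weight_def indicator_def fun_eq_iff)
  ultimately have "((\<lambda>t. rad_weight n t * indicator {..s} t) has_integral unit_ball_vol (real n) * s powr (real n / 2)) UNIV"
    by simp
  then have "(\<integral>\<^sup>+t. ennreal (rad_weight n t * indicator {..s} t) \<partial>lborel) = ennreal (unit_ball_vol (real n) * s powr (real n / 2))"
    by (intro nn_integral_has_integral_lborel) (auto simp: rad_weight_nonneg)
  then show ?thesis
    by (simp add: ennreal_mult rad_weight_nonneg ennreal_indicator)
qed

text \<open>Polar coordinates without the sphere: it suffices to compare both measures on the half-lines
  \<open>{..s}\<close>, where the left one is the volume of a ball and the right one the integral of a power.\<close>

lemma distr_sqnorm:
  "distr lborel borel (\<lambda>x::real^'n::finite. x \<bullet> x) = density lborel (\<lambda>t. ennreal (rad_weight CARD('n) t))"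
proof (rule measure_eqI_generator_eq)
  let ?M = "distr lborel borel (\<lambda>x::real^'n::finite. x \<bullet> x)"
  let ?E = "range (\<lambda>s::real. {..s})"
  show "Int_stable ?E" by (auto simp: Int_stable_def)
  show "?E \<subseteq> Pow UNIV" by auto
  show "sets ?M = sigma_sets UNIV ?E"
    by (simp add: borel_eq_atMost)
  show "sets (density lborel (\<lambda>t. ennreal (rad_weight CARD('n) t))) = sigma_sets UNIV ?E"
    by (simp add: borel_eq_atMost)
  have L: "emeasure ?M {..s} = (if s \<ge> 0 then ennreal (unit_ball_vol (real CARD('n)) * s powr (real CARD('n) / 2)) else 0)" for s
  proof (cases "s \<ge> 0")
    case True
    have "emeasure ?M {..s} = emeasure lborel {x::real^'n. x \<bullet> x \<le> s}"
      by (subst emeasure_distr) (auto simp: vimage_def)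
    also have "{x::real^'n. x \<bullet> x \<le> s} = cball 0 (sqrt s)"
      using True by (auto simp: norm_eq_sqrt_inner)
    also have "emeasure lborel \<dots> = ennreal (unit_ball_vol (real CARD('n)) * sqrt s ^ CARD('n))"
      using True by (subst emeasure_cball) auto
    also have "sqrt s ^ CARD('n) = s powr (real CARD('n) / 2)"
      using True by (cases "s = 0") (auto simp: powr_half_sqrt[symmetric] powr_powr powr_realpow[symmetric])
    finally show ?thesis using True by simp
  next
    case False
    have "{x::real^'n. x \<bullet> x \<le> s} = {}" using False by (auto simp: not_le intro: less_le_trans)
    then have "emeasure ?M {..s} = 0"
      by (subst emeasure_distr) (auto simp: vimage_def)
    then show ?thesis using False by simp
  qed
  have R: "emeasure (density lborel (\<lambda>t. ennreal (rad_weight CARD('n) t))) {..s} =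
     (if s \<ge> 0 then ennreal (unit_ball_vol (real CARD('n)) * s powr (real CARD('n) / 2)) else 0)" for s
  proof (cases "s \<ge> 0")
    case True
    then show ?thesis by (subst emeasure_density) (auto simp: nn_integral_rad_weight)
  next
    case False
    have *: "ennreal (rad_weight CARD('n) t) * indicator {..s} t = 0" for t
      using False by (auto simp: rad_weight_def indicator_def)
    show ?thesis using False by (subst emeasure_density) (auto simp: *)
  qed
  show "emeasure ?M X = emeasure (density lborel (\<lambda>t. ennreal (rad_weight CARD('n) t))) X"
    if "X \<in> ?E" for X
    using that L R by auto
  show "range (\<lambda>i::nat. {..real i}) \<subseteq> ?E" by auto
  show "(\<Union>i::nat. {..real i}) = UNIV" by (auto simp: real_arch_simple)
  show "emeasure ?M {..real i} \<noteq> \<infinity>" for i :: nat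
    by (subst L) auto
qed

lemma AE_sqnorm:
  assumes "AE t in lborel. t > 0 \<longrightarrow> P t"
  shows "AE x::real^'n::finite in lebesgue. P (x \<bullet> x)"
proof -
  have "AE t in density lborel (\<lambda>t. ennreal (rad_weight CARD('n) t)). P t"
    using assms by (subst AE_density) (auto simp: rad_weight_def indicator_def elim!: eventually_mono split: if_splits)
  then have "AE t in distr lborel borel (\<lambda>x::real^'n::finite. x \<bullet> x). P t"
    by (subst distr_sqnorm)
  then have "AE x::real^'n in lborel. P (x \<bullet> x)"
    by (rule AE_distrD[rotated]) simp
  then show ?thesis by (rule AE_completion)
qed

lemma integrable_sqnorm:
  fixes f :: "real \<Rightarrow> 'b::{banach, second_countable_topology}"
  assumes [measurable]: "f \<in> borel_measurable borel"
  shows "integrable lebesgue (\<lambda>x::real^'n::finite. f (x \<bullet> x)) \<longleftrightarrow>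
    integrable lborel (\<lambda>t. rad_weight CARD('n) t *\<^sub>R f t)"
proof -
  have "integrable lebesgue (\<lambda>x::real^'n. f (x \<bullet> x)) \<longleftrightarrow> integrable lborel (\<lambda>x::real^'n. f (x \<bullet> x))"
    by (rule integrable_completion) simp
  also have "\<dots> \<longleftrightarrow> integrable (distr lborel borel (\<lambda>x::real^'n. x \<bullet> x)) f"
    by (subst integrable_distr_eq) auto
  also have "\<dots> \<longleftrightarrow> integrable lborel (\<lambda>t. rad_weight CARD('n) t *\<^sub>R f t)"
    unfolding distr_sqnorm by (subst integrable_density) (auto simp: rad_weight_nonneg)
  finally show ?thesis .
qed

lemma integral_sqnorm:
  fixes f :: "real \<Rightarrow> 'b::{banach, second_countable_topology}"
  assumes [measurable]: "f \<in> borel_measurable borel"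
  shows "(LINT x|lebesgue. f ((x::real^'n::finite) \<bullet> x)) = (LINT t|lborel. rad_weight CARD('n) t *\<^sub>R f t)"
proof -
  have "(LINT x|lebesgue. f ((x::real^'n) \<bullet> x)) = (LINT x|lborel. f ((x::real^'n) \<bullet> x))"
    by (rule integral_completion) simp
  also have "\<dots> = integral\<^sup>L (distr lborel borel (\<lambda>x::real^'n. x \<bullet> x)) f"
    by (subst integral_distr) auto
  also have "\<dots> = (LINT t|lborel. rad_weight CARD('n) t *\<^sub>R f t)"
    unfolding distr_sqnorm by (subst integral_density) (auto simp: rad_weight_nonneg)
  finally show ?thesis .
qed

text \<open>A measurable set is \<open>\<sigma>\<close>-compact up to a null set, and continuous images of \<open>\<sigma>\<close>-compact sets are Borel.
  Applied to the preimage of \<open>E\<close> and to its complement this encloses \<open>E\<close> between Borel sets whose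
  difference has a null preimage, hence is null itself because the density of the image measure is positive.\<close>

lemma lebesgue_measurable_sqnorm:
  assumes E: "E \<subseteq> {0..}" and m: "{x::real^'n::finite. x \<bullet> x \<in> E} \<in> sets lebesgue"
  shows "E \<in> sets lebesgue"
proof -
  let ?s = "\<lambda>x::real^'n. x \<bullet> x"
  let ?S = "{x::real^'n. x \<bullet> x \<in> E}"
  have img: "?s ` C \<in> sets borel" if "fsigma C" for C
  proof -
    from that obtain F :: "nat \<Rightarrow> (real^'n) set" where F: "range F \<subseteq> Collect compact" "C = \<Union>(F ` UNIV)"
      by (auto simp: fsigma_Union_compact)
    have "compact (?s ` F i)" for i
      using F(1) by (intro compact_continuous_image continuous_intros) auto
    then have "?s ` F i \<in> sets borel" for i by (intro borel_closed compact_imp_closed)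
    moreover have "?s ` C = (\<Union>i. ?s ` F i)" using F(2) by auto
    ultimately show ?thesis by auto
  qed
  obtain C1 T1 where 1: "fsigma C1" "T1 \<in> null_sets lebesgue" "C1 \<union> T1 = ?S"
    by (rule lebesgue_set_almost_fsigma[OF m])
  have m': "- ?S \<in> sets lebesgue" using m by (simp only: Compl_in_sets_lebesgue)
  obtain C2 T2 where 2: "fsigma C2" "T2 \<in> null_sets lebesgue" "C2 \<union> T2 = - ?S"
    by (rule lebesgue_set_almost_fsigma[OF m'])
  define R where "R = {0<..} - (?s ` C1 \<union> ?s ` C2)"
  have Rb: "R \<in> sets borel" using img 1 2 by (auto simp: R_def)
  have "?s -` R \<subseteq> T1 \<union> T2" using 1 2 by (auto simp: R_def)
  moreover have "T1 \<union> T2 \<in> null_sets lebesgue" using 1 2 by auto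
  ultimately have "?s -` R \<in> null_sets lebesgue"
    using completion.complete2 by blast
  moreover have "?s -` R \<in> sets borel" using Rb measurable_sets[of ?s borel borel R] by simp
  ultimately have "emeasure lborel (?s -` R) = 0" by (simp add: null_sets_def)
  then have "emeasure (density lborel (\<lambda>t. ennreal (rad_weight CARD('n) t))) R = 0"
    using Rb by (subst distr_sqnorm[symmetric], subst emeasure_distr) auto
  then have "R \<in> null_sets (density lborel (\<lambda>t. ennreal (rad_weight CARD('n) t)))"
    using Rb by (simp add: null_sets_def)
  then have "AE t in density lborel (\<lambda>t. ennreal (rad_weight CARD('n) t)). t \<notin> R"
    by (rule AE_not_in)
  then have "AE t in lborel. 0 < ennreal (rad_weight CARD('n) t) \<longrightarrow> t \<notin> R"
    by (subst (asm) AE_density) simp_all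
  then have "AE t in lborel. t \<notin> R"
    by eventually_elim (auto simp: R_def rad_weight_pos)
  then have "R \<in> null_sets lborel"
    using Rb by (simp add: AE_iff_null_sets)
  then have N: "R \<union> {0} \<in> null_sets lebesgue"
    by (intro null_sets_completionI null_sets.Un) (auto intro: finite_imp_null_set_lborel)
  have "E \<inter> (R \<union> {0}) \<in> null_sets lebesgue"
    by (rule completion.complete2[OF _ N]) auto
  then have Z: "E \<inter> (R \<union> {0}) \<in> sets lebesgue" by (rule null_setsD2)
  have "E = ?s ` C1 \<union> (E \<inter> (R \<union> {0}))"
  proof -
    have "t \<in> ?s ` C1" if t: "t \<in> E" "t \<notin> R" "t \<noteq> 0" for t
    proof -
      have "t > 0" using t E by force
      then have "t \<in> ?s ` C1 \<or> t \<in> ?s ` C2" using t by (auto simp: R_def)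
      moreover have "t \<notin> ?s ` C2" using 2 t by auto
      ultimately show ?thesis by blast
    qed
    moreover have "?s ` C1 \<subseteq> E" using 1 by auto
    ultimately show ?thesis by blast
  qed
  moreover have "?s ` C1 \<in> sets lebesgue" using img 1 by auto
  ultimately show ?thesis using Z by (metis sets.Un)
qed

text \<open>The profile of a radial function is a priori an arbitrary function.  It is Lebesgue measurable by the
  preceding lemma and so agrees almost everywhere with a Borel function; the squared norm is used as
  variable because it is smooth, which keeps test functions of it smooth at the origin.\<close>

lemma radial_borel_profile:
  fixes \<phi> :: "real^'n::finite \<Rightarrow> complex"
  assumes m: "\<phi> \<in> borel_measurable lebesgue" and h: "AE x in lebesgue. \<phi> x = h (norm x)"
  shows "\<exists>W\<in>borel_measurable borel. AE x in lebesgue. \<phi> x = W (x \<bullet> x)"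
proof -
  define H where "H t = (if t \<ge> 0 then h (sqrt t) else 0)" for t
  have Hs: "H (x \<bullet> x) = h (norm x)" for x :: "real^'n"
    by (simp add: H_def norm_eq_sqrt_inner)
  have mH: "(\<lambda>x::real^'n. H (x \<bullet> x)) \<in> borel_measurable lebesgue"
    using borel_measurable_AE[OF m h] by (simp add: Hs)
  have "H \<in> borel_measurable lebesgue"
  proof (rule borel_measurableI)
    fix B :: "complex set" assume B: "open B"
    have "{x::real^'n. x \<bullet> x \<in> {t. t \<ge> 0 \<and> H t \<in> B}} = (\<lambda>x. H (x \<bullet> x)) -` B \<inter> space lebesgue"
      by auto
    also have "\<dots> \<in> sets lebesgue" using mH B by (intro measurable_sets[OF mH]) auto
    finally have "{t. t \<ge> 0 \<and> H t \<in> B} \<in> sets lebesgue"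
      by (intro lebesgue_measurable_sqnorm) auto
    moreover have "{t::real. t < 0 \<and> 0 \<in> B} \<in> sets lebesgue" by auto
    ultimately have "{t. t \<ge> 0 \<and> H t \<in> B} \<union> {t::real. t < 0 \<and> 0 \<in> B} \<in> sets lebesgue" by blast
    also have "{t. t \<ge> 0 \<and> H t \<in> B} \<union> {t::real. t < 0 \<and> 0 \<in> B} = H -` B \<inter> space lebesgue"
      by (auto simp: H_def split: if_splits)
    finally show "H -` B \<inter> space lebesgue \<in> sets lebesgue" .
  qed
  then have "(\<lambda>t. Re (H t)) \<in> borel_measurable lebesgue" "(\<lambda>t. Im (H t)) \<in> borel_measurable lebesgue"
    by measurable
  from this[THEN completion_ex_borel_measurable_real]
  obtain R I where RI: "R \<in> borel_measurable lborel" "I \<in> borel_measurable lborel"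
     "AE t in lborel. Re (H t) = R t" "AE t in lborel. Im (H t) = I t" by auto
  define W where "W t = Complex (R t) (I t)" for t
  have "W \<in> borel_measurable borel"
    using RI by (auto simp: W_def[abs_def] borel_measurable_complex_iff)
  moreover have "AE t in lborel. t > 0 \<longrightarrow> H t = W t"
    using RI(3,4) by eventually_elim (auto simp: W_def complex_eq_iff)
  then have "AE x::real^'n in lebesgue. H (x \<bullet> x) = W (x \<bullet> x)" by (rule AE_sqnorm)
  with h have "AE x in lebesgue. \<phi> x = W (x \<bullet> x)"
    by eventually_elim (simp add: Hs)
  ultimately show ?thesis by blast
qed

section \<open>Weak derivatives on the half-line\<close>

lemma set_integrable_subinterval:
  fixes f :: "real \<Rightarrow> 'a::{banach, second_countable_topology}"
  assumes "set_integrable lborel {a..b} f" "a \<le> c" "d \<le> b"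
  shows "set_integrable lborel {c..d} f"
  by (rule set_integrable_subset[OF assms(1)]) (use assms in auto)

lemma set_integral_split:
  fixes f :: "real \<Rightarrow> 'a::{banach, second_countable_topology}"
  assumes "set_integrable lborel {a..b} f" "a \<le> c" "c \<le> b"
  shows "(LINT t:{a..b}|lborel. f t) = (LINT t:{a..c}|lborel. f t) + (LINT t:{c..b}|lborel. f t)"
proof -
  have i: "set_integrable lborel {a..c} f" "set_integrable lborel {c..b} f"
    using assms by (auto intro: set_integrable_subinterval)
  have "(LINT t:{a..b}|lborel. f t) = (LINT t|lborel. indicator {a..c} t *\<^sub>R f t + indicator {c..b} t *\<^sub>R f t)"
    unfolding set_lebesgue_integral_def
  proof (rule integral_cong_AE)
    show "(\<lambda>t. indicat_real {a..b} t *\<^sub>R f t) \<in> borel_measurable lborel"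
      using assms(1) unfolding set_integrable_def by (rule borel_measurable_integrable)
    show "(\<lambda>t. indicator {a..c} t *\<^sub>R f t + indicator {c..b} t *\<^sub>R f t) \<in> borel_measurable lborel"
      using i unfolding set_integrable_def by (intro borel_measurable_integrable Bochner_Integration.integrable_add)
    have "AE t in lborel. t \<noteq> c" by (rule AE_lborel_singleton)
    then show "AE t in lborel. indicat_real {a..b} t *\<^sub>R f t = indicator {a..c} t *\<^sub>R f t + indicator {c..b} t *\<^sub>R f t"
      by eventually_elim (use assms in \<open>auto simp: indicator_def\<close>)
  qed
  also have "\<dots> = (LINT t:{a..c}|lborel. f t) + (LINT t:{c..b}|lborel. f t)"
    using i unfolding set_integrable_def set_lebesgue_integral_def by (intro Bochner_Integration.integral_add)
  finally show ?thesis .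
qed

lemma set_integrable_continuous_scaleR:
  fixes f :: "real \<Rightarrow> 'a::{banach, second_countable_topology}"
  assumes "set_integrable lborel {a..b} f" "continuous_on {a..b} h"
  shows "set_integrable lborel {a..b} (\<lambda>t. h t *\<^sub>R f t)"
proof -
  have "compact (h ` {a..b})" using assms(2) by (intro compact_continuous_image) auto
  then obtain B where B: "\<And>t. t \<in> {a..b} \<Longrightarrow> \<bar>h t\<bar> \<le> B"
    using compact_imp_bounded bounded_iff by (metis imageI real_norm_def)
  have "(\<lambda>t. indicator {a..b} t *\<^sub>R h t) \<in> borel_measurable borel"
    using assms(2) by (intro borel_measurable_continuous_on_indicator) auto
  then have "(\<lambda>t. indicator {a..b} t *\<^sub>R h t) \<in> borel_measurable lborel"
    by simp
  moreover have "(\<lambda>t. indicator {a..b} t *\<^sub>R f t) \<in> borel_measurable lborel"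
    using assms(1) unfolding set_integrable_def by (rule borel_measurable_integrable)
  ultimately have m: "(\<lambda>t. (indicator {a..b} t *\<^sub>R h t) *\<^sub>R (indicator {a..b} t *\<^sub>R f t)) \<in> borel_measurable lborel"
    by (rule borel_measurable_scaleR)
  have "integrable lborel (\<lambda>t. (indicator {a..b} t *\<^sub>R h t) *\<^sub>R (indicator {a..b} t *\<^sub>R f t))"
  proof (rule Bochner_Integration.integrable_bound[OF _ m])
    show "integrable lborel (\<lambda>t. B *\<^sub>R (indicator {a..b} t *\<^sub>R f t))"
      using assms(1) unfolding set_integrable_def by (rule integrable_scaleR_right)
    show "AE t in lborel. norm ((indicator {a..b} t *\<^sub>R h t) *\<^sub>R (indicator {a..b} t *\<^sub>R f t))
        \<le> norm (B *\<^sub>R (indicator {a..b} t *\<^sub>R f t))"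
      using B by (intro AE_I2) (fastforce simp: indicator_def intro!: mult_right_mono)
  qed
  moreover have "(\<lambda>t. (indicator {a..b} t *\<^sub>R h t) *\<^sub>R (indicator {a..b} t *\<^sub>R f t)) = (\<lambda>t. indicator {a..b} t *\<^sub>R h t *\<^sub>R f t)"
    by (auto simp: indicator_def)
  ultimately show ?thesis unfolding set_integrable_def by simp
qed

lemma set_integrable_continuous:
  fixes h :: "real \<Rightarrow> 'a::{banach, second_countable_topology}"
  shows "continuous_on {a..b} h \<Longrightarrow> set_integrable lborel {a..b} h"
  by (rule borel_integrable_atLeastAtMost')

text \<open>The primitive of an integrable function is differentiable only almost everywhere; the formula is
  Fubini's theorem for the integral of \<open>\<kappa>' t *\<^sub>R Y s\<close> over the triangle \<open>a \<le> s \<le> t \<le> b\<close>.\<close>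

lemma integral_by_parts_primitive:
  fixes Y :: "real \<Rightarrow> complex" and \<kappa> :: "real \<Rightarrow> real"
  assumes Y: "set_integrable lborel {a..b} Y"
    and \<kappa>: "\<And>t. (\<kappa> has_real_derivative \<kappa>' t) (at t)" "continuous_on UNIV \<kappa>'" "\<kappa> b = 0"
  shows "(LINT t:{a..b}|lborel. \<kappa>' t *\<^sub>R (LINT s:{a..t}|lborel. Y s)) = - (LINT t:{a..b}|lborel. \<kappa> t *\<^sub>R Y t)"
proof -
  define g where "g s = indicator {a..b} s *\<^sub>R Y s" for s
  define h where "h t = indicator {a..b} t *\<^sub>R \<kappa>' t" for t
  have gi: "integrable lborel g" using Y unfolding g_def set_integrable_def .
  have hi: "integrable lborel h"
    using set_integrable_continuous[of a b \<kappa>'] continuous_on_subset[OF \<kappa>(2), of "{a..b}"]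
    unfolding h_def set_integrable_def by simp
  have gm[measurable]: "g \<in> borel_measurable borel" using borel_measurable_integrable[OF gi] by simp
  have hm[measurable]: "h \<in> borel_measurable borel" using borel_measurable_integrable[OF hi] by simp
  define f where "f s t = indicator {p. fst p \<le> snd p} (s, t) *\<^sub>R (h t *\<^sub>R g s)" for s t :: real
  have S: "{p::real \<times> real. fst p \<le> snd p} \<in> sets (borel \<Otimes>\<^sub>M borel)"
    unfolding borel_prod by (intro borel_closed closed_Collect_le continuous_intros)
  have i1: "integrable (lborel \<Otimes>\<^sub>M lborel) (\<lambda>(s, t). h t *\<^sub>R g s)"
  proof (rule lborel_pair.Fubini_integrable)
    show "integrable lborel (\<lambda>s. LINT t|lborel. norm (case (s, t) of (s, t) \<Rightarrow> h t *\<^sub>R g s))"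
      using gi hi by simp
    show "AE s in lborel. integrable lborel (\<lambda>t. case (s, t) of (s, t) \<Rightarrow> h t *\<^sub>R g s)"
      using hi by simp
  qed simp
  have fi: "integrable (lborel \<Otimes>\<^sub>M lborel) (\<lambda>(s, t). f s t)"
  proof (rule Bochner_Integration.integrable_bound[OF i1])
    have "(\<lambda>p. indicator {p::real \<times> real. fst p \<le> snd p} p *\<^sub>R (case p of (s, t) \<Rightarrow> h t *\<^sub>R g s))
       \<in> borel_measurable (lborel \<Otimes>\<^sub>M lborel)"
      using S by (intro borel_measurable_scaleR borel_measurable_indicator) simp_all
    then show "(\<lambda>(s, t). f s t) \<in> borel_measurable (lborel \<Otimes>\<^sub>M lborel)"
      by (simp add: f_def case_prod_beta')
    show "AE p in lborel \<Otimes>\<^sub>M lborel. norm (case p of (s, t) \<Rightarrow> f s t) \<le> norm (case p of (s, t) \<Rightarrow> h t *\<^sub>R g s)"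
      by (intro AE_I2) (auto simp: f_def indicator_def)
  qed
  have L: "(LINT s|lborel. f s t) = indicator {a..b} t *\<^sub>R (\<kappa>' t *\<^sub>R (LINT s:{a..t}|lborel. Y s))" for t
  proof (cases "t \<in> {a..b}")
    case True
    then have *: "f s t = \<kappa>' t *\<^sub>R (indicator {a..t} s *\<^sub>R Y s)" for s
      by (auto simp: f_def g_def h_def indicator_def)
    have "(LINT s|lborel. f s t) = \<kappa>' t *\<^sub>R (LINT s:{a..t}|lborel. Y s)"
      unfolding * set_lebesgue_integral_def by (rule integral_scaleR_right)
    then show ?thesis using True by simp
  next
    case False
    then show ?thesis by (simp add: f_def h_def)
  qed
  have R: "(LINT t|lborel. f s t) = - (indicator {a..b} s *\<^sub>R (\<kappa> s *\<^sub>R Y s))" for s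
  proof (cases "s \<in> {a..b}")
    case True
    then have *: "f s t = (indicator {s..b} t *\<^sub>R \<kappa>' t) *\<^sub>R Y s" for t
      by (auto simp: f_def g_def h_def indicator_def)
    have "(LINT t|lborel. indicator {s..b} t *\<^sub>R \<kappa>' t) = \<kappa> b - \<kappa> s"
      using True \<kappa> by (intro integral_FTC_Icc)
        (auto simp: has_real_derivative_iff_has_vector_derivative intro: has_vector_derivative_at_within continuous_on_subset)
    moreover have "integrable lborel (\<lambda>t. indicator {s..b} t *\<^sub>R \<kappa>' t)"
      using set_integrable_continuous[of s b \<kappa>'] continuous_on_subset[OF \<kappa>(2), of "{s..b}"]
      unfolding set_integrable_def by simp
    ultimately show ?thesis using True \<kappa>(3) unfolding * by (subst integral_scaleR_left) auto
  next
    case False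
    then show ?thesis by (simp add: f_def g_def)
  qed
  show ?thesis
    using lborel_pair.Fubini_integral[OF fi] unfolding L R by (simp add: set_lebesgue_integral_def)
qed

text \<open>The sets over which \<open>g\<close> integrates to zero form a Dynkin system, and the half-lines are a generating
  \<open>\<pi>\<close>-system.\<close>

lemma AE_eq_0_of_interval_integrals:
  fixes g :: "real \<Rightarrow> complex"
  assumes g: "integrable lborel g" and 0: "\<And>t. (LINT s:{..t}|lborel. g s) = 0" "(LINT s|lborel. g s) = 0"
  shows "AE t in lborel. g t = 0"
proof (rule sigma_finite_measure.density_zero[OF sigma_finite_lborel g])
  fix A :: "real set" assume "A \<in> sets lborel"
  moreover have S: "sigma_sets UNIV (range (\<lambda>t::real. {..t})) = sets lborel"
    by (simp add: borel_eq_atMost)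
  ultimately have A: "A \<in> sigma_sets UNIV (range (\<lambda>t::real. {..t}))" by simp
  have "Int_stable (range (\<lambda>t::real. {..t}))" by (auto simp: Int_stable_def)
  moreover have "range (\<lambda>t::real. {..t}) \<subseteq> Pow UNIV" by auto
  ultimately show "(LINT s:A|lborel. g s) = 0" using A
  proof (induction rule: sigma_sets_induct_disjoint)
    case (basic A)
    then show ?case using 0 by auto
  next
    case empty
    then show ?case by (simp add: set_lebesgue_integral_def)
  next
    case (compl A)
    then have A: "A \<in> sets lborel" using S by simp
    have "integrable lborel (\<lambda>s. indicator A s *\<^sub>R g s)"
      using A g by (rule integrable_mult_indicator)
    then have "(LINT s|lborel. g s - indicator A s *\<^sub>R g s) = 0"
      using compl 0(2) g by (simp add: set_lebesgue_integral_def)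
    moreover have "(\<lambda>s. g s - indicator A s *\<^sub>R g s) = (\<lambda>s. indicator (UNIV - A) s *\<^sub>R g s)"
      by (auto simp: indicator_def)
    ultimately show ?case by (simp add: set_lebesgue_integral_def)
  next
    case (union A)
    then have A: "A i \<in> sets lborel" for i using S by (auto simp: subset_eq)
    have "(LINT s:(\<Union>i. A i)|lborel. g s) = (\<Sum>i. (LINT s:(A i)|lborel. g s))"
    proof (rule lebesgue_integral_countable_add)
      show "A i \<inter> A j = {}" if "i \<noteq> j" for i j
        using union(1) that by (auto simp: disjoint_family_on_def)
      have "(\<Union>i. A i) \<in> sets lborel" using A by blast
      then show "set_integrable lborel (\<Union>i. A i) g"
        unfolding set_integrable_def using g by (rule integrable_mult_indicator)
    qed (use A in auto)
    then show ?case using union by simp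
  qed
qed

lemma AE_eq_0_pos:
  fixes Z :: "real \<Rightarrow> complex"
  assumes Z: "\<And>a b. 0 < a \<Longrightarrow> set_integrable lborel {a..b} Z"
    and 0: "\<And>a b. 0 < a \<Longrightarrow> a < b \<Longrightarrow> (LINT s:{a..b}|lborel. Z s) = 0"
  shows "AE t in lborel. t > 0 \<longrightarrow> Z t = 0"
proof -
  have 00: "(LINT s:{a..b}|lborel. Z s) = 0" if "0 < a" for a b
  proof -
    consider "a < b" | "b < a" | "a = b" by linarith
    then show ?thesis
    proof cases
      case 3
      have "AE s in lborel. indicator {a..a} s *\<^sub>R Z s = 0"
        using AE_lborel_singleton[of a] by eventually_elim auto
      then have "(LINT s:{a..a}|lborel. Z s) = 0"
        unfolding set_lebesgue_integral_def by (rule integral_eq_zero_AE)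
      then show ?thesis using 3 by simp
    qed (use 0 that in \<open>auto simp: set_lebesgue_integral_def\<close>)
  qed
  have "AE t in lborel. indicator {inverse (real (Suc n))..real (Suc n)} t *\<^sub>R Z t = 0" for n
  proof (rule AE_eq_0_of_interval_integrals)
    let ?a = "inverse (real (Suc n))" and ?b = "real (Suc n)"
    show "integrable lborel (\<lambda>t. indicator {?a..?b} t *\<^sub>R Z t)"
      using Z[of ?a ?b] by (simp add: set_integrable_def)
    show "(LINT s|lborel. indicator {?a..?b} s *\<^sub>R Z s) = 0"
      using 00[of ?a ?b] by (simp add: set_lebesgue_integral_def)
    fix t
    have "(LINT s:{..t}|lborel. indicator {?a..?b} s *\<^sub>R Z s) = (LINT s:{?a..min t ?b}|lborel. Z s)"
      unfolding set_lebesgue_integral_def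
      by (intro Bochner_Integration.integral_cong) (auto simp: indicator_def)
    then show "(LINT s:{..t}|lborel. indicator {?a..?b} s *\<^sub>R Z s) = 0"
      using 00[of ?a] by simp
  qed
  then have "AE t in lborel. \<forall>n. indicator {inverse (real (Suc n))..real (Suc n)} t *\<^sub>R Z t = 0"
    unfolding AE_all_countable by blast
  then show ?thesis
  proof eventually_elim
    case (elim t)
    show ?case
    proof
      assume t: "t > 0"
      obtain n where n: "max t (inverse t) \<le> real n" using real_arch_simple by blast
      have "inverse t \<le> real (Suc n)" using n by simp
      then have "inverse (real (Suc n)) \<le> inverse (inverse t)"
        using t by (intro le_imp_inverse_le) auto
      then have "inverse (real (Suc n)) \<le> t" by simp
      moreover have "t \<le> real (Suc n)" using n by simp
      ultimately show "Z t = 0" using elim[rule_format, of n] by (simp add: indicator_def)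
    qed
  qed
qed

lemma continuous_on_set_integral:
  fixes Y :: "real \<Rightarrow> 'a::euclidean_space"
  assumes "set_integrable lborel {a..b} Y"
  shows "continuous_on {a..b} (\<lambda>t. LINT s:{a..t}|lborel. Y s)"
proof -
  have "Y integrable_on {a..b}" using assms by (rule set_borel_integral_eq_integral)
  then have "continuous_on {a..b} (\<lambda>t. integral {a..t} Y)" by (rule indefinite_integral_continuous_1)
  then show ?thesis
  proof (rule continuous_on_eq)
    show "integral {a..t} Y = (LINT s:{a..t}|lborel. Y s)" if "t \<in> {a..b}" for t
      using set_integrable_subinterval[OF assms, of a t] that by (simp add: set_borel_integral_eq_integral(2))
  qed
qed

lemma set_integral_restrict_left:
  fixes f :: "real \<Rightarrow> 'a::{banach, second_countable_topology}"
  assumes "c \<le> a" "\<And>t. t < a \<Longrightarrow> f t = 0"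
  shows "(LINT t:{c..b}|lborel. f t) = (LINT t:{a..b}|lborel. f t)"
  unfolding set_lebesgue_integral_def
  using assms by (intro Bochner_Integration.integral_cong) (auto simp: indicator_def)

lemma primitive_exists:
  fixes Y :: "real \<Rightarrow> complex"
  assumes Y: "\<And>a b. 0 < a \<Longrightarrow> set_integrable lborel {a..b} Y"
  obtains P where "\<And>a b. 0 < a \<Longrightarrow> a \<le> b \<Longrightarrow> P b - P a = (LINT s:{a..b}|lborel. Y s)"
proof -
  define P where "P t = (LINT s:{1..t}|lborel. Y s) - (LINT s:{t..1}|lborel. Y s)" for t
  have e: "(LINT s:{a..b}|lborel. Y s) = 0" if "b \<le> a" "0 < a" for a b
  proof (cases "a = b")
    case True
    then show ?thesis using set_integral_split[OF Y[of a a], of a] that by simp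
  next
    case False
    then show ?thesis using that by (simp add: set_lebesgue_integral_def)
  qed
  have "P b - P a = (LINT s:{a..b}|lborel. Y s)" if "0 < a" "a \<le> b" for a b
  proof -
    consider "1 \<le> a" | "a \<le> 1" "1 \<le> b" | "b \<le> 1" using that by linarith
    then show ?thesis
    proof cases
      case 1
      then show ?thesis using that e set_integral_split[OF Y, of 1 a b] by (simp add: P_def)
    next
      case 2
      then show ?thesis using that e set_integral_split[OF Y, of a 1 b] by (simp add: P_def)
    next
      case 3
      then show ?thesis using that e set_integral_split[OF Y, of a b 1] by (simp add: P_def)
    qed
  qed
  then show ?thesis using that by blast
qed

lemma primitive_continuous:
  fixes Y :: "real \<Rightarrow> complex"
  assumes Y: "\<And>a b. 0 < a \<Longrightarrow> set_integrable lborel {a..b} Y"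
   and P: "\<And>a b. 0 < a \<Longrightarrow> a \<le> b \<Longrightarrow> P b - P a = (LINT s:{a..b}|lborel. Y s)"
  shows "continuous_on {0<..} P"
proof -
  have "continuous_on {a..b} P" if "0 < a" for a b
  proof -
    have "continuous_on {a..b} (\<lambda>t. P a + (LINT s:{a..t}|lborel. Y s))"
      by (intro continuous_intros continuous_on_set_integral Y that)
    then show ?thesis
    proof (rule continuous_on_eq)
      show "P a + (LINT s:{a..t}|lborel. Y s) = P t" if "t \<in> {a..b}" for t
        using P[of a t] that \<open>0 < a\<close> by (simp add: algebra_simps)
    qed
  qed
  then have "isCont P t" if "t > 0" for t
    using continuous_on_interior[of "{t / 2..t + 1}" P t] that by (simp add: interior_atLeastAtMost_real)
  then show ?thesis by (simp add: continuous_on_eq_continuous_at)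
qed

lemma integral_by_parts_test:
  fixes Y P :: "real \<Rightarrow> complex"
  assumes Y: "set_integrable lborel {a..b} Y"
    and P: "\<And>t. a \<le> t \<Longrightarrow> P t - P a = (LINT s:{a..t}|lborel. Y s)"
    and \<kappa>: "smooth \<kappa>" "a \<le> b" "\<kappa> a = 0" "\<kappa> b = 0"
  shows "(LINT t:{a..b}|lborel. deriv \<kappa> t *\<^sub>R P t) = - (LINT t:{a..b}|lborel. \<kappa> t *\<^sub>R Y t)"
proof -
  have c: "continuous_on S (deriv \<kappa>)" for S by (intro smooth_continuous smooth_deriv \<kappa>)
  have "(LINT t:{a..b}|lborel. deriv \<kappa> t *\<^sub>R P t) =
    (LINT t:{a..b}|lborel. deriv \<kappa> t *\<^sub>R P a + deriv \<kappa> t *\<^sub>R (LINT s:{a..t}|lborel. Y s))"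
  proof (rule set_lebesgue_integral_cong)
    show "\<forall>t. t \<in> {a..b} \<longrightarrow> deriv \<kappa> t *\<^sub>R P t = deriv \<kappa> t *\<^sub>R P a + deriv \<kappa> t *\<^sub>R (LINT s:{a..t}|lborel. Y s)"
      using P by (simp flip: P scaleR_add_right)
  qed simp
  also have "\<dots> = (LINT t:{a..b}|lborel. deriv \<kappa> t *\<^sub>R P a) + (LINT t:{a..b}|lborel. deriv \<kappa> t *\<^sub>R (LINT s:{a..t}|lborel. Y s))"
    by (rule set_integral_add(2)[OF set_integrable_continuous[OF continuous_on_scaleR[OF c continuous_on_const]]
          set_integrable_continuous[OF continuous_on_scaleR[OF c continuous_on_set_integral[OF Y]]]])
  also have "(LINT t:{a..b}|lborel. deriv \<kappa> t *\<^sub>R P a) = \<kappa> b *\<^sub>R P a - \<kappa> a *\<^sub>R P a"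
    unfolding set_lebesgue_integral_def
  proof (rule integral_FTC_Icc[where F = "\<lambda>t. \<kappa> t *\<^sub>R P a"])
    show "((\<lambda>t. \<kappa> t *\<^sub>R P a) has_vector_derivative deriv \<kappa> t *\<^sub>R P a) (at t within {a..b})" for t
    proof -
      have "((\<lambda>t. \<kappa> t *\<^sub>R P a) has_vector_derivative \<kappa> t *\<^sub>R 0 + deriv \<kappa> t *\<^sub>R P a) (at t within {a..b})"
        by (rule has_vector_derivative_scaleR[OF has_field_derivative_at_within[OF smooth_DERIV[OF \<kappa>(1)]] has_vector_derivative_const])
      then show ?thesis by simp
    qed
    show "continuous_on {a..b} (\<lambda>t. deriv \<kappa> t *\<^sub>R P a)"
      by (intro continuous_on_scaleR c continuous_on_const)
  qed (use \<kappa> in auto)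
  also have "(LINT t:{a..b}|lborel. deriv \<kappa> t *\<^sub>R (LINT s:{a..t}|lborel. Y s)) = - (LINT t:{a..b}|lborel. \<kappa> t *\<^sub>R Y t)"
    by (rule integral_by_parts_primitive[OF Y smooth_DERIV[OF \<kappa>(1)] c \<kappa>(4)])
  finally show ?thesis using \<kappa> by simp
qed

lemma set_integral_bump_tendsto:
  fixes f :: "real \<Rightarrow> 'a::{banach, second_countable_topology}"
  assumes "set_integrable lborel {a..b} f"
  shows "(\<lambda>n. LINT t:{a..b}|lborel. bump a b (real (Suc n)) t *\<^sub>R f t) \<longlonglongrightarrow> (LINT t:{a..b}|lborel. f t)"
  unfolding set_lebesgue_integral_def
proof (rule integral_dominated_convergence)
  have i: "integrable lborel (\<lambda>t. indicator {a..b} t *\<^sub>R f t)" using assms unfolding set_integrable_def .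
  then show "(\<lambda>t. indicator {a..b} t *\<^sub>R f t) \<in> borel_measurable lborel" by (rule borel_measurable_integrable)
  show "integrable lborel (\<lambda>t. norm (indicator {a..b} t *\<^sub>R f t))" using i by (rule integrable_norm)
  show "(\<lambda>t. indicator {a..b} t *\<^sub>R (bump a b (real (Suc n)) t *\<^sub>R f t)) \<in> borel_measurable lborel" for n
    using set_integrable_continuous_scaleR[OF assms smooth_continuous[OF smooth_bump]]
    unfolding set_integrable_def by (rule borel_measurable_integrable)
  show "AE t in lborel. norm (indicator {a..b} t *\<^sub>R (bump a b (real (Suc n)) t *\<^sub>R f t)) \<le> norm (indicator {a..b} t *\<^sub>R f t)" for n
    using bump_nonneg bump_le_1 by (intro AE_I2) (auto simp: indicator_def mult_left_le_one_le)
  show "AE t in lborel. (\<lambda>n. indicator {a..b} t *\<^sub>R (bump a b (real (Suc n)) t *\<^sub>R f t)) \<longlonglongrightarrow> indicator {a..b} t *\<^sub>R f t"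
    using AE_lborel_singleton[of a] AE_lborel_singleton[of b]
  proof eventually_elim
    case (elim t)
    have "(\<lambda>n. indicator {a..b} t *\<^sub>R (bump a b (real (Suc n)) t *\<^sub>R f t)) \<longlonglongrightarrow> indicator {a..b} t *\<^sub>R (indicator {a<..<b} t *\<^sub>R f t)"
      by (rule tendsto_scaleR[OF tendsto_const tendsto_scaleR[OF bump_tendsto tendsto_const]])
    moreover have "indicator {a..b} t *\<^sub>R (indicator {a<..<b} t *\<^sub>R f t) = indicator {a..b} t *\<^sub>R f t"
      using elim by (auto simp: indicator_def)
    ultimately show ?case by (simp only:)
  qed
qed

lemma set_integral_bump_pos: "0 < (LINT t:{1..2}|lborel. bump 1 2 1 t)"
proof -
  have si: "set_integrable lborel {1..2} (bump 1 2 1)" by (intro set_integrable_continuous smooth_continuous smooth_bump)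
  have "0 \<le> (LINT t:{1..2}|lborel. bump 1 2 1 t)" unfolding set_lebesgue_integral_def
    by (intro integral_nonneg_AE) (auto simp: bump_nonneg)
  moreover have "(LINT t:{1..2}|lborel. bump 1 2 1 t) \<noteq> 0"
  proof
    assume "(LINT t:{1..2}|lborel. bump 1 2 1 t) = 0"
    then have "AE t in lborel. indicator {1..2} t *\<^sub>R bump 1 2 1 t = 0"
      using si unfolding set_lebesgue_integral_def set_integrable_def
      by (subst (asm) integral_nonneg_eq_0_iff_AE) (auto simp: bump_nonneg)
    then have "AE t in lborel. t \<notin> {1<..<2::real}"
    proof eventually_elim
      case (elim t)
      then show ?case using bump_pos[of 1 1 t 2] by (auto simp: indicator_def)
    qed
    then have "{1<..<2::real} \<in> null_sets lborel" by (subst AE_iff_null_sets) auto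
    then show False by (simp add: null_sets_def)
  qed
  ultimately show ?thesis by simp
qed

text \<open>The lemma of du Bois-Reymond on the half-line.  A smooth function with support in the half-line is the
  derivative of another one as soon as its integral is zero; subtracting a multiple of one fixed bump
  \<open>\<rho>\<close> achieves this, so \<open>Z\<close> and a constant have the same integral against every test function, and then
  over every interval.\<close>

lemma weak_constant:
  fixes Z :: "real \<Rightarrow> complex"
  assumes Z: "\<And>a b. 0 < a \<Longrightarrow> set_integrable lborel {a..b} Z"
    and weak: "\<And>\<kappa> a b. smooth \<kappa> \<Longrightarrow> 0 < a \<Longrightarrow> a < b \<Longrightarrow> (\<And>t. t \<le> a \<or> t \<ge> b \<Longrightarrow> \<kappa> t = 0) \<Longrightarrow>
      (LINT t:{a..b}|lborel. deriv \<kappa> t *\<^sub>R Z t) = 0"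
  shows "\<exists>c. AE t in lborel. t > 0 \<longrightarrow> Z t = c"
proof -
  define \<rho> where "\<rho> = bump 1 2 1"
  have \<rho>s: "smooth \<rho>" and \<rho>0: "\<And>t. t \<le> 1 \<or> t \<ge> 2 \<Longrightarrow> \<rho> t = 0"
    by (auto simp: \<rho>_def smooth_bump bump_eq_0)
  define I where "I = (LINT t:{1..2}|lborel. \<rho> t)"
  have I: "I > 0" unfolding I_def \<rho>_def by (rule set_integral_bump_pos)
  define c where "c = (LINT t:{1..2}|lborel. \<rho> t *\<^sub>R Z t) /\<^sub>R I"
  have key: "(LINT t:{a..b}|lborel. \<zeta> t *\<^sub>R Z t) = (LINT t:{a..b}|lborel. \<zeta> t *\<^sub>R c)"
    if \<zeta>: "smooth \<zeta>" "0 < a" "a < b" "\<And>t. t \<le> a \<or> t \<ge> b \<Longrightarrow> \<zeta> t = 0" for \<zeta> a b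
  proof -
    define a' b' where "a' = min a 1" and "b' = max b 2"
    have ab: "0 < a'" "a' < b'" "a' \<le> a" "b \<le> b'" "a' \<le> 1" "2 \<le> b'" using \<zeta> by (auto simp: a'_def b'_def)
    have ext: "(LINT t:{a'..b'}|lborel. f t) = (LINT t:{x..y}|lborel. f t)"
      if "a' \<le> x" "y \<le> b'" "\<And>t. t \<le> x \<or> t \<ge> y \<Longrightarrow> f t = 0" for x y and f :: "real \<Rightarrow> 'z::{banach, second_countable_topology}"
      unfolding set_lebesgue_integral_def
      using that by (intro Bochner_Integration.integral_cong) (auto simp: indicator_def)
    define J where "J = (LINT t:{a'..b'}|lborel. \<zeta> t)"
    \<comment> \<open>The multiple of \<open>\<rho>\<close> is chosen so that \<open>\<kappa>'\<close> has integral zero and its primitive compact support.\<close>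
    define \<kappa>' where "\<kappa>' t = \<zeta> t + (- (J / I)) * \<rho> t" for t
    have s': "smooth \<kappa>'" unfolding \<kappa>'_def by (intro smooth_add smooth_mult smooth_const \<zeta> \<rho>s)
    have z': "\<kappa>' t = 0" if "t \<le> a' \<or> t \<ge> b'" for t
      using that ab \<zeta>(4)[of t] \<rho>0[of t] by (auto simp: \<kappa>'_def)
    have "(LINT t:{a'..b'}|lborel. \<rho> t) = I" unfolding I_def using ab \<rho>0 by (intro ext) auto
    moreover have "(LINT t:{a'..b'}|lborel. \<kappa>' t) = (LINT t:{a'..b'}|lborel. \<zeta> t) + (LINT t:{a'..b'}|lborel. (- (J / I)) * \<rho> t)"
      unfolding \<kappa>'_def
      by (rule set_integral_add(2); intro set_integrable_continuous smooth_continuous smooth_mult smooth_const \<zeta>(1) \<rho>s)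
    ultimately have int0: "(LINT t:{a'..b'}|lborel. \<kappa>' t) = 0"
      using I unfolding set_integral_mult_right J_def[symmetric] by simp
    obtain \<kappa> where \<kappa>: "smooth \<kappa>" "deriv \<kappa> = \<kappa>'" "\<And>t. t \<ge> b' \<Longrightarrow> \<kappa> t = 0"
      using smooth_primitive[OF s', of b'] z' by blast
    have kz: "\<kappa> t = 0" if t: "t \<le> a' \<or> t \<ge> b'" for t
    proof (cases "t \<ge> b'")
      case False
      then have t: "t \<le> a'" "t \<le> b'" using t by auto
      have "(LINT s|lborel. indicator {t..b'} s *\<^sub>R \<kappa>' s) = \<kappa> b' - \<kappa> t"
      proof (rule integral_FTC_Icc[where F = \<kappa>])
        show "(\<kappa> has_vector_derivative \<kappa>' s) (at s within {t..b'})" for s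
          using has_field_derivative_at_within[OF smooth_DERIV[OF \<kappa>(1)]]
          by (simp add: \<kappa>(2) has_real_derivative_iff_has_vector_derivative)
      qed (use t smooth_continuous[OF s'] in auto)
      moreover have "(LINT s:{t..b'}|lborel. \<kappa>' s) = (LINT s:{a'..b'}|lborel. \<kappa>' s)"
        by (rule set_integral_restrict_left) (use t z' in auto)
      ultimately show ?thesis using int0 \<kappa>(3)[of b'] by (simp add: set_lebesgue_integral_def)
    qed (rule \<kappa>(3))
    have "0 = (LINT t:{a'..b'}|lborel. \<kappa>' t *\<^sub>R Z t)"
      using weak[OF \<kappa>(1) ab(1,2) kz] \<kappa>(2) by simp
    also have "\<dots> = (LINT t:{a'..b'}|lborel. \<zeta> t *\<^sub>R Z t + (- (J / I)) *\<^sub>R (\<rho> t *\<^sub>R Z t))"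
      by (simp add: \<kappa>'_def algebra_simps)
    also have "\<dots> = (LINT t:{a'..b'}|lborel. \<zeta> t *\<^sub>R Z t) + (LINT t:{a'..b'}|lborel. (- (J / I)) *\<^sub>R (\<rho> t *\<^sub>R Z t))"
      by (rule set_integral_add(2); (rule set_integrable_scaleR_right)?;
          intro set_integrable_continuous_scaleR smooth_continuous \<zeta>(1) \<rho>s Z ab)
    also have "\<dots> = (LINT t:{a'..b'}|lborel. \<zeta> t *\<^sub>R Z t) + (- (J / I)) *\<^sub>R (LINT t:{a'..b'}|lborel. \<rho> t *\<^sub>R Z t)"
      by (simp only: set_integral_scaleR_right)
    also have "(LINT t:{a'..b'}|lborel. \<rho> t *\<^sub>R Z t) = (LINT t:{1..2}|lborel. \<rho> t *\<^sub>R Z t)"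
      using ab \<rho>0 by (intro ext) auto
    also have "\<dots> = I *\<^sub>R c" using I by (simp add: c_def)
    finally have "(LINT t:{a'..b'}|lborel. \<zeta> t *\<^sub>R Z t) = J *\<^sub>R c" using I by simp
    also have "\<dots> = (LINT t:{a'..b'}|lborel. \<zeta> t *\<^sub>R c)"
      using set_integrable_continuous[OF smooth_continuous[OF \<zeta>(1)], of a' b']
      unfolding J_def set_lebesgue_integral_def set_integrable_def by (subst integral_scaleR_left[symmetric]) auto
    finally have "(LINT t:{a'..b'}|lborel. \<zeta> t *\<^sub>R Z t) = (LINT t:{a'..b'}|lborel. \<zeta> t *\<^sub>R c)" .
    moreover have "(LINT t:{a'..b'}|lborel. \<zeta> t *\<^sub>R Z t) = (LINT t:{a..b}|lborel. \<zeta> t *\<^sub>R Z t)"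
      "(LINT t:{a'..b'}|lborel. \<zeta> t *\<^sub>R c) = (LINT t:{a..b}|lborel. \<zeta> t *\<^sub>R c)"
      by (rule ext; use ab \<zeta>(4) in auto)+
    ultimately show ?thesis by simp
  qed
  have "(LINT t:{a..b}|lborel. Z t - c) = 0" if "0 < a" "a < b" for a b
  proof -
    have ci: "set_integrable lborel {a..b} (\<lambda>_. c)" by (rule set_integrable_continuous[OF continuous_on_const])
    have "(LINT t:{a..b}|lborel. bump a b (real (Suc n)) t *\<^sub>R Z t) = (LINT t:{a..b}|lborel. bump a b (real (Suc n)) t *\<^sub>R c)" for n
      by (rule key[OF smooth_bump that]) (use bump_eq_0[of "real (Suc n)" _ a b] in auto)
    then have "(LINT t:{a..b}|lborel. Z t) = (LINT t:{a..b}|lborel. c)"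
      using LIMSEQ_unique[OF set_integral_bump_tendsto[OF Z[OF that(1)]]] set_integral_bump_tendsto[OF ci] by simp
    then show ?thesis using set_integral_diff(2)[OF Z[OF that(1)] ci] by simp
  qed
  then have "AE t in lborel. t > 0 \<longrightarrow> Z t - c = 0"
    using set_integral_diff(1)[OF Z set_integrable_continuous[OF continuous_on_const]]
    by (intro AE_eq_0_pos) auto
  then have "AE t in lborel. t > 0 \<longrightarrow> Z t = c"
    by eventually_elim simp
  then show ?thesis by blast
qed

text \<open>A weak derivative \<open>Y\<close> determines \<open>U\<close> up to a constant: the primitive \<open>P\<close> has the same weak derivative,
  and the difference is constant by the preceding lemma.\<close>

lemma weak_primitive:
  fixes U Y P :: "real \<Rightarrow> complex"
  assumes Y: "\<And>a b. 0 < a \<Longrightarrow> set_integrable lborel {a..b} Y"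
    and U: "\<And>a b. 0 < a \<Longrightarrow> set_integrable lborel {a..b} U"
    and P: "\<And>a b. 0 < a \<Longrightarrow> a \<le> b \<Longrightarrow> P b - P a = (LINT s:{a..b}|lborel. Y s)"
    and weak: "\<And>\<kappa> a b. smooth \<kappa> \<Longrightarrow> 0 < a \<Longrightarrow> a < b \<Longrightarrow> (\<And>t. t \<le> a \<or> t \<ge> b \<Longrightarrow> \<kappa> t = 0) \<Longrightarrow>
      (LINT t:{a..b}|lborel. deriv \<kappa> t *\<^sub>R U t) = - (LINT t:{a..b}|lborel. \<kappa> t *\<^sub>R Y t)"
  shows "\<exists>c. AE t in lborel. t > 0 \<longrightarrow> U t = c + P t"
proof -
  have Pi: "set_integrable lborel {a..b} P" if "0 < a" for a b
    by (intro set_integrable_continuous continuous_on_subset[OF primitive_continuous[OF Y P]]) (use that in auto)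
  have "\<exists>c. AE t in lborel. t > 0 \<longrightarrow> U t - P t = c"
  proof (rule weak_constant)
    show "set_integrable lborel {a..b} (\<lambda>t. U t - P t)" if "0 < a" for a b
      by (rule set_integral_diff(1)[OF U[OF that] Pi[OF that]])
    fix \<kappa> :: "real \<Rightarrow> real" and a b :: real
    assume \<kappa>: "smooth \<kappa>" "0 < a" "a < b" "\<And>t. t \<le> a \<or> t \<ge> b \<Longrightarrow> \<kappa> t = 0"
    have c: "continuous_on {a..b} (deriv \<kappa>)" by (intro smooth_continuous smooth_deriv \<kappa>)
    have "(LINT t:{a..b}|lborel. deriv \<kappa> t *\<^sub>R (U t - P t)) = (LINT t:{a..b}|lborel. deriv \<kappa> t *\<^sub>R U t - deriv \<kappa> t *\<^sub>R P t)"
      by (simp only: scaleR_diff_right)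
    also have "\<dots> = (LINT t:{a..b}|lborel. deriv \<kappa> t *\<^sub>R U t) - (LINT t:{a..b}|lborel. deriv \<kappa> t *\<^sub>R P t)"
      by (rule set_integral_diff(2)[OF set_integrable_continuous_scaleR[OF U[OF \<kappa>(2)] c] set_integrable_continuous_scaleR[OF Pi[OF \<kappa>(2)] c]])
    also have "(LINT t:{a..b}|lborel. deriv \<kappa> t *\<^sub>R P t) = - (LINT t:{a..b}|lborel. \<kappa> t *\<^sub>R Y t)"
      by (rule integral_by_parts_test[OF Y[OF \<kappa>(2)] P[OF \<kappa>(2)] \<kappa>(1)]) (use \<kappa> in auto)
    finally show "(LINT t:{a..b}|lborel. deriv \<kappa> t *\<^sub>R (U t - P t)) = 0" using weak[OF \<kappa>] by simp
  qed
  then obtain c where "AE t in lborel. t > 0 \<longrightarrow> U t - P t = c" by blast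
  then have "AE t in lborel. t > 0 \<longrightarrow> U t = c + P t"
    by eventually_elim (simp add: diff_eq_eq)
  then show ?thesis by blast
qed

section \<open>The equation for the radial profile\<close>

definition rad_const :: "nat \<Rightarrow> real" where
  "rad_const n = unit_ball_vol (real n) * (real n / 2)"

lemma rad_const_pos: "n > 0 \<Longrightarrow> 0 < rad_const n"
  by (simp add: rad_const_def)

lemma rad_weight_eq: "rad_weight n t = rad_const n * (indicator {0..} t * t powr (real n / 2 - 1))"
  by (auto simp: rad_weight_def rad_const_def indicator_def)

lemma radial_measurable:
  fixes \<phi> :: "real^'n::finite \<Rightarrow> 'a::euclidean_space"
  assumes f: "f \<in> borel_measurable borel" and eq: "AE x in lebesgue. \<phi> x = f (x \<bullet> x)"
  shows "\<phi> \<in> borel_measurable lebesgue"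
proof (rule borel_measurable_AE)
  have "(\<lambda>x::real^'n. f (x \<bullet> x)) \<in> borel_measurable lborel"
    using f by (intro measurable_compose[OF _ f]) simp
  then show "(\<lambda>x::real^'n. f (x \<bullet> x)) \<in> borel_measurable lebesgue"
    by (rule measurable_completion)
  show "AE x in lebesgue. f (x \<bullet> x) = \<phi> x" using eq by eventually_elim simp
qed

lemma radial_L1_loc:
  fixes \<phi> :: "real^'n::finite \<Rightarrow> complex"
  assumes \<phi>: "\<phi> \<in> L1_loc" and f: "f \<in> borel_measurable borel" and eq: "AE x in lebesgue. \<phi> x = f (x \<bullet> x)"
  shows "set_integrable lborel {0..T} (\<lambda>t. t powr (real CARD('n) / 2 - 1) *\<^sub>R f t)"
proof -
  note [measurable] = f
  define T' where "T' = max 0 T"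
  let ?c = "rad_const CARD('n)"
  have c: "?c \<noteq> 0" using rad_const_pos[of "CARD('n)"] by simp
  have "compact (cball (0::real^'n) (sqrt T'))" by simp
  then have i: "integrable lebesgue (\<lambda>x. indicator (cball 0 (sqrt T')) x *\<^sub>R \<phi> x)"
    using \<phi> unfolding L1_loc_def set_integrable_def by blast
  have e: "AE x::real^'n in lebesgue. indicator (cball 0 (sqrt T')) x *\<^sub>R \<phi> x = indicator {..T'} (x \<bullet> x) *\<^sub>R f (x \<bullet> x)"
    using eq
  proof eventually_elim
    case (elim x)
    have "x \<in> cball 0 (sqrt T') \<longleftrightarrow> x \<bullet> x \<le> T'"
      by (auto simp: T'_def norm_eq_sqrt_inner)
    then show ?case using elim by (simp add: indicator_def)
  qed
  have m: "(\<lambda>t. indicat_real {..T'} t *\<^sub>R f t) \<in> borel_measurable borel" by measurable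
  have m2: "(\<lambda>x::real^'n. indicator {..T'} (x \<bullet> x) *\<^sub>R f (x \<bullet> x)) \<in> borel_measurable lebesgue"
    by (rule radial_measurable[OF m]) simp
  have "integrable lebesgue (\<lambda>x::real^'n. indicator {..T'} (x \<bullet> x) *\<^sub>R f (x \<bullet> x))"
    using i integrable_cong_AE[OF borel_measurable_integrable[OF i] m2 e] by simp
  then have "integrable lborel (\<lambda>t. rad_weight CARD('n) t *\<^sub>R (indicator {..T'} t *\<^sub>R f t))"
    by (subst (asm) integrable_sqnorm[OF m])
  then have "integrable lborel (\<lambda>t. ?c *\<^sub>R (indicator {0..T'} t *\<^sub>R (t powr (real CARD('n) / 2 - 1) *\<^sub>R f t)))"
    by (rule Bochner_Integration.integrable_cong[THEN iffD1, rotated 2]) (auto simp: rad_weight_eq indicator_def)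
  then have "integrable lborel (\<lambda>t. (1 / ?c) *\<^sub>R (?c *\<^sub>R (indicator {0..T'} t *\<^sub>R (t powr (real CARD('n) / 2 - 1) *\<^sub>R f t))))"
    by (rule integrable_scaleR_right)
  then have "set_integrable lborel {0..T'} (\<lambda>t. t powr (real CARD('n) / 2 - 1) *\<^sub>R f t)"
    using c unfolding set_integrable_def by simp
  then show ?thesis by (rule set_integrable_subinterval) (auto simp: T'_def)
qed

lemma radial_integral:
  fixes \<phi> :: "real^'n::finite \<Rightarrow> complex"
  assumes f: "f \<in> borel_measurable borel" and eq: "AE x in lebesgue. \<phi> x = f (x \<bullet> x)"
    and g: "g \<in> borel_measurable borel" "\<And>t. t > T \<Longrightarrow> g t = 0"
  shows "(LINT x|lebesgue. \<phi> x * complex_of_real (g (x \<bullet> x))) =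
    rad_const CARD('n) *\<^sub>R (LINT t:{0..T}|lborel. g t *\<^sub>R (t powr (real CARD('n) / 2 - 1) *\<^sub>R f t))"
proof -
  note [measurable] = f g(1)
  have m: "(\<lambda>t. g t *\<^sub>R f t) \<in> borel_measurable borel" by measurable
  have e: "AE x in lebesgue. \<phi> x * complex_of_real (g (x \<bullet> x)) = g (x \<bullet> x) *\<^sub>R f (x \<bullet> x)"
    using eq by eventually_elim (simp add: scaleR_conv_of_real)
  have "(LINT x|lebesgue. \<phi> x * complex_of_real (g (x \<bullet> x))) = (LINT x|lebesgue. g ((x::real^'n) \<bullet> x) *\<^sub>R f (x \<bullet> x))"
    using radial_measurable[OF m e] radial_measurable[OF m, of "\<lambda>x. g (x \<bullet> x) *\<^sub>R f (x \<bullet> x)"] e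
    by (intro integral_cong_AE) auto
  also have "\<dots> = (LINT t|lborel. rad_weight CARD('n) t *\<^sub>R (g t *\<^sub>R f t))"
    by (rule integral_sqnorm[OF m])
  also have "\<dots> = (LINT t|lborel. rad_const CARD('n) *\<^sub>R (indicator {0..T} t *\<^sub>R (g t *\<^sub>R (t powr (real CARD('n) / 2 - 1) *\<^sub>R f t))))"
    by (intro Bochner_Integration.integral_cong) (auto simp: rad_weight_eq indicator_def g)
  also have "\<dots> = rad_const CARD('n) *\<^sub>R (LINT t:{0..T}|lborel. g t *\<^sub>R (t powr (real CARD('n) / 2 - 1) *\<^sub>R f t))"
    unfolding set_lebesgue_integral_def by (rule integral_scaleR_right)
  finally show ?thesis .
qed

text \<open>The term \<open>|x|\<^sup>b |\<phi>|\<^bsup>p-1\<^esup> \<phi>\<close> in the variable \<open>t = x \<bullet> x\<close>, which turns \<open>|x|\<^sup>b\<close> into \<open>t\<^bsup>b/2\<^esup>\<close>.\<close>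

definition nonlin :: "real \<Rightarrow> real \<Rightarrow> (real \<Rightarrow> complex) \<Rightarrow> real \<Rightarrow> complex" where
  "nonlin b p W t = (t powr (b / 2) * cmod (W t) powr (p - 1)) *\<^sub>R W t"

lemma nonlin_measurable: "W \<in> borel_measurable borel \<Longrightarrow> nonlin b p W \<in> borel_measurable borel"
  unfolding nonlin_def[abs_def] by measurable

lemma nonlin_sqnorm:
  "nonlin b p W (x \<bullet> x) = complex_of_real (norm x powr b * cmod (W (x \<bullet> x)) powr (p - 1)) * W (x \<bullet> x)"
proof -
  have "(x \<bullet> x) powr (b / 2) = norm x powr b"
    by (simp add: norm_eq_sqrt_inner powr_half_sqrt[symmetric] powr_powr)
  then show ?thesis by (simp add: nonlin_def scaleR_conv_of_real)
qed

lemma smooth_measurable: "smooth \<theta> \<Longrightarrow> \<theta> \<in> borel_measurable borel"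
  by (intro borel_measurable_continuous_onI smooth_continuous)

text \<open>The distributional equation tested with \<open>\<theta> (x \<bullet> x)\<close> and rewritten in the variable \<open>t = x \<bullet> x\<close>.  The test
  function need not vanish near \<open>t = 0\<close>.\<close>

lemma weak_radial_equation:
  fixes \<phi> :: "real^'n::finite \<Rightarrow> complex"
  assumes sol: "solves b p \<phi>"
    and W: "W \<in> borel_measurable borel" and eq: "AE x in lebesgue. \<phi> x = W (x \<bullet> x)"
    and \<theta>: "smooth \<theta>" "\<And>t. t \<ge> T \<Longrightarrow> \<theta> t = 0"
  defines "A \<equiv> \<lambda>t. t powr (real CARD('n) / 2 - 1) *\<^sub>R W t"
    and "B \<equiv> \<lambda>t. t powr (real CARD('n) / 2 - 1) *\<^sub>R nonlin b p W t"
  shows "set_integrable lborel {0..T} A" "set_integrable lborel {0..T} B"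
    "(LINT t:{0..T}|lborel. (4 * t * deriv (deriv \<theta>) t + 2 * real CARD('n) * deriv \<theta> t) *\<^sub>R A t) =
     (LINT t:{0..T}|lborel. \<theta> t *\<^sub>R (A t - B t))"
proof -
  define F where "F = (\<lambda>x. complex_of_real (norm x powr b * cmod (\<phi> x) powr (p - 1)) * \<phi> x)"
  have s: "\<phi> \<in> L1_loc" "F \<in> L1_loc"
    "\<And>\<psi>. \<psi> \<in> test_functions \<Longrightarrow> - (LINT x|lebesgue. \<phi> x * laplacian \<psi> x) + (LINT x|lebesgue. \<phi> x * \<psi> x)
           - (LINT x|lebesgue. F x * \<psi> x) = 0"
    using sol unfolding solves_def F_def by (simp_all add: Let_def)
  have eqF: "AE x in lebesgue. F x = nonlin b p W (x \<bullet> x)"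
    using eq by eventually_elim (simp add: F_def nonlin_sqnorm)
  note N = nonlin_measurable[OF W, of b p]
  show Ai: "set_integrable lborel {0..T} A" unfolding A_def by (rule radial_L1_loc[OF s(1) W eq])
  show Bi: "set_integrable lborel {0..T} B" unfolding B_def by (rule radial_L1_loc[OF s(2) N eqF])
  have \<theta>m: "\<theta> \<in> borel_measurable borel" by (rule smooth_measurable[OF \<theta>(1)])
  have \<theta>0: "\<And>t. t > T \<Longrightarrow> \<theta> t = 0" using \<theta>(2) by simp
  have d1: "\<And>t. t > T \<Longrightarrow> deriv \<theta> t = 0" using deriv_eq_0_right[OF \<theta>(1) \<theta>0] .
  have d2: "\<And>t. t > T \<Longrightarrow> deriv (deriv \<theta>) t = 0" using deriv_eq_0_right[OF smooth_deriv[OF \<theta>(1)] d1] .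
  define g where "g t = 4 * t * deriv (deriv \<theta>) t + 2 * real CARD('n) * deriv \<theta> t" for t
  have g: "g \<in> borel_measurable borel"
    unfolding g_def[abs_def]
    by (intro smooth_measurable smooth_add smooth_mult smooth_const smooth_id smooth_deriv \<theta>(1))
  have g0: "g t = 0" if "t > T" for t using d1 d2 that by (simp add: g_def)
  let ?\<psi> = "\<lambda>x::real^'n. complex_of_real (\<theta> (x \<bullet> x))"
  let ?c = "rad_const CARD('n)"
  have "- (LINT x|lebesgue. \<phi> x * laplacian ?\<psi> x) + (LINT x|lebesgue. \<phi> x * ?\<psi> x)
           - (LINT x|lebesgue. F x * ?\<psi> x) = 0"
    by (rule s(3)) (rule test_sqnorm[OF \<theta>(1), of T], simp add: \<theta>(2))
  moreover have "(LINT x|lebesgue. \<phi> x * laplacian ?\<psi> x) = ?c *\<^sub>R (LINT t:{0..T}|lborel. g t *\<^sub>R A t)"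
    unfolding laplacian_sqnorm[OF \<theta>(1)] A_def g_def[symmetric] by (rule radial_integral[OF W eq g g0])
  moreover have "(LINT x|lebesgue. \<phi> x * ?\<psi> x) = ?c *\<^sub>R (LINT t:{0..T}|lborel. \<theta> t *\<^sub>R A t)"
    unfolding A_def by (rule radial_integral[OF W eq \<theta>m \<theta>0])
  moreover have "(LINT x|lebesgue. F x * ?\<psi> x) = ?c *\<^sub>R (LINT t:{0..T}|lborel. \<theta> t *\<^sub>R B t)"
    unfolding B_def by (rule radial_integral[OF N eqF \<theta>m \<theta>0])
  ultimately have "?c *\<^sub>R (- (LINT t:{0..T}|lborel. g t *\<^sub>R A t) + (LINT t:{0..T}|lborel. \<theta> t *\<^sub>R A t) -
      (LINT t:{0..T}|lborel. \<theta> t *\<^sub>R B t)) = 0"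
    by (simp add: scaleR_diff_right scaleR_add_right)
  then have "- (LINT t:{0..T}|lborel. g t *\<^sub>R A t) + (LINT t:{0..T}|lborel. \<theta> t *\<^sub>R A t) -
      (LINT t:{0..T}|lborel. \<theta> t *\<^sub>R B t) = 0"
    using rad_const_pos[of "CARD('n)"] by (simp only: scaleR_eq_0_iff) simp
  then have "(LINT t:{0..T}|lborel. g t *\<^sub>R A t) = (LINT t:{0..T}|lborel. \<theta> t *\<^sub>R A t) - (LINT t:{0..T}|lborel. \<theta> t *\<^sub>R B t)"
    by (simp add: algebra_simps)
  also have "\<dots> = (LINT t:{0..T}|lborel. \<theta> t *\<^sub>R A t - \<theta> t *\<^sub>R B t)"
    by (rule set_integral_diff(2)[symmetric]; rule set_integrable_continuous_scaleR)
      (use Ai Bi smooth_continuous[OF \<theta>(1)] in auto)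
  finally show "(LINT t:{0..T}|lborel. (4 * t * deriv (deriv \<theta>) t + 2 * real CARD('n) * deriv \<theta> t) *\<^sub>R A t) =
     (LINT t:{0..T}|lborel. \<theta> t *\<^sub>R (A t - B t))"
    by (simp add: g_def scaleR_diff_right)
qed

lemma primitive_has_derivative:
  fixes Y :: "real \<Rightarrow> complex"
  assumes Y: "continuous_on {0<..} Y"
   and P: "\<And>a b. 0 < a \<Longrightarrow> a \<le> b \<Longrightarrow> P b - P a = (LINT s:{a..b}|lborel. Y s)" and t: "t > 0"
  shows "(P has_vector_derivative Y t) (at t)"
proof -
  let ?a = "t / 2" and ?b = "t + 1"
  have c: "continuous_on {?a..?b} Y" by (rule continuous_on_subset[OF Y]) (use t in auto)
  have "((\<lambda>u. integral {?a..u} Y) has_vector_derivative Y t) (at t within {?a..?b})"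
    using c t by (intro integral_has_vector_derivative) auto
  then have "((\<lambda>u. integral {?a..u} Y) has_vector_derivative Y t) (at t)"
    using t by (simp add: at_within_Icc_at)
  then have "((\<lambda>u. P ?a + integral {?a..u} Y) has_vector_derivative 0 + Y t) (at t)"
    by (intro has_vector_derivative_add has_vector_derivative_const)
  then have *: "((\<lambda>u. P ?a + integral {?a..u} Y) has_vector_derivative Y t) (at t)" by simp
  show ?thesis
  proof (rule has_vector_derivative_transform_within_open[OF *])
    show "open {?a<..<?b}" "t \<in> {?a<..<?b}" using t by auto
    fix u assume u: "u \<in> {?a<..<?b}"
    have "set_integrable lborel {?a..u} Y"
      by (intro set_integrable_continuous continuous_on_subset[OF Y]) (use t in auto)
    then show "P ?a + integral {?a..u} Y = P u"
      using P[of ?a u] t u by (simp add: set_borel_integral_eq_integral(2)[symmetric] algebra_simps)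
  qed
qed

text \<open>Let \<open>G\<close> be the integrand on the right-hand side and \<open>\<Gamma>\<close> its integral from \<open>0\<close>.  Taking \<open>\<theta>\<close> with
  derivative \<open>\<kappa>\<close> supported in the open half-line and integrating \<open>\<theta> G\<close> by parts, the weak equation says that
  \<open>4 t\<^sup>\<nu> W\<close> has the weak derivative \<open>\<Gamma> + 4 \<nu> t\<^bsup>\<nu>-1\<^esup> W\<close>.  Hence \<open>W\<close> is continuous, this derivative is
  continuous, and \<open>4 t\<^sup>\<nu> W' = \<Gamma>\<close>.  No multiple of the singular solution \<open>W' = t\<^bsup>-\<nu>\<^esup>\<close> can be present, since \<open>\<theta>\<close>
  was allowed to be nonzero at the origin.\<close>

lemma radial_profile_ODE:
  fixes \<phi> :: "real^'n::finite \<Rightarrow> complex"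
  assumes sol: "solves b p \<phi>"
    and W0: "W0 \<in> borel_measurable borel" "AE x in lebesgue. \<phi> x = W0 (x \<bullet> x)"
  defines "\<nu> \<equiv> real CARD('n) / 2"
  shows "\<exists>W W'. W \<in> borel_measurable borel \<and> (AE x in lebesgue. \<phi> x = W (x \<bullet> x)) \<and>
    (\<forall>t>0. (W has_vector_derivative W' t) (at t)) \<and>
    (\<forall>T. set_integrable lborel {0..T} (\<lambda>t. t powr (\<nu> - 1) *\<^sub>R (W t - nonlin b p W t))) \<and>
    (\<forall>t>0. (4 * t powr \<nu>) *\<^sub>R W' t = (LINT s:{0..t}|lborel. s powr (\<nu> - 1) *\<^sub>R (W s - nonlin b p W s)))"
proof -
  define n where "n = real CARD('n)"
  have n: "n = 2 * \<nu>" by (simp add: n_def \<nu>_def)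
  define A0 where "A0 t = t powr (\<nu> - 1) *\<^sub>R W0 t" for t
  define B0 where "B0 t = t powr (\<nu> - 1) *\<^sub>R nonlin b p W0 t" for t
  define G0 where "G0 t = A0 t - B0 t" for t
  define \<Gamma> where "\<Gamma> t = (LINT s:{0..t}|lborel. G0 s)" for t
  \<comment> \<open>\<open>Y\<close> will be the weak derivative of \<open>U = 4 t\<^sup>\<nu> W0\<close>.\<close>
  define Y where "Y t = \<Gamma> t + (2 * n) *\<^sub>R A0 t" for t
  define U where "U t = (4 * t) *\<^sub>R A0 t" for t
  note wre = weak_radial_equation[OF sol W0, folded \<nu>_def, folded A0_def B0_def n_def]
  have A0: "set_integrable lborel {0..T} A0" for T
    using wre(1)[OF smooth_const[of 0]] by (simp add: A0_def[abs_def])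
  have B0: "set_integrable lborel {0..T} B0" for T
    using wre(2)[OF smooth_const[of 0]] by (simp add: B0_def[abs_def])
  have G0: "set_integrable lborel {0..T} G0" for T
    unfolding G0_def using A0 B0 by (rule set_integral_diff(1))
  have \<Gamma>c: "continuous_on {0..T} \<Gamma>" for T
    unfolding \<Gamma>_def by (rule continuous_on_set_integral[OF G0])
  have A0': "set_integrable lborel {a..c} A0" if "0 < a" for a c
    by (rule set_integrable_subinterval[OF A0[of c]]) (use that in auto)
  have Yi: "set_integrable lborel {a..c} Y" if "0 < a" for a c
    unfolding Y_def
    by (rule set_integral_add(1)[OF set_integrable_continuous[OF continuous_on_subset[OF \<Gamma>c[of c]]]
        set_integrable_scaleR_right[OF A0'[OF that]]]) (use that in auto)
  have Ui: "set_integrable lborel {a..c} U" if "0 < a" for a c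
    unfolding U_def by (intro set_integrable_continuous_scaleR A0' that continuous_intros)
  have weak: "(LINT t:{a..c}|lborel. deriv \<kappa> t *\<^sub>R U t) = - (LINT t:{a..c}|lborel. \<kappa> t *\<^sub>R Y t)"
    if \<kappa>: "smooth \<kappa>" "0 < a" "a < c" "\<And>t. t \<le> a \<or> t \<ge> c \<Longrightarrow> \<kappa> t = 0" for \<kappa> a c
  proof -
    obtain \<theta> where \<theta>: "smooth \<theta>" "deriv \<theta> = \<kappa>" "\<And>t. t \<ge> c \<Longrightarrow> \<theta> t = 0"
      using smooth_primitive[OF \<kappa>(1)] \<kappa>(4) by blast
    have \<kappa>c: "continuous_on S \<kappa>" "continuous_on S (deriv \<kappa>)" for S
      by (intro smooth_continuous smooth_deriv \<kappa>(1))+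
    have d0: "deriv \<kappa> t = 0" if "t < a" for t
      by (rule deriv_eq_0_left[OF \<kappa>(1) _ that]) (use \<kappa>(4) in auto)
    have "(LINT t:{0..c}|lborel. (4 * t * deriv \<kappa> t + 2 * n * \<kappa> t) *\<^sub>R A0 t) = (LINT t:{0..c}|lborel. \<theta> t *\<^sub>R G0 t)"
      using wre(3)[OF \<theta>(1,3)] unfolding \<theta>(2) A0_def[symmetric] B0_def[symmetric] n_def[symmetric] G0_def .
    also have "\<dots> = - (LINT t:{0..c}|lborel. \<kappa> t *\<^sub>R \<Gamma> t)"
      using integral_by_parts_primitive[OF G0 smooth_DERIV[OF \<theta>(1)], of c] \<theta>(2,3) \<kappa>c(1)[of UNIV]
      unfolding \<Gamma>_def by simp
    also have "\<dots> = - (LINT t:{a..c}|lborel. \<kappa> t *\<^sub>R \<Gamma> t)"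
      using \<kappa> by (subst set_integral_restrict_left[of 0 a]) auto
    also have "(LINT t:{0..c}|lborel. (4 * t * deriv \<kappa> t + 2 * n * \<kappa> t) *\<^sub>R A0 t) =
        (LINT t:{a..c}|lborel. (4 * t * deriv \<kappa> t + 2 * n * \<kappa> t) *\<^sub>R A0 t)"
      using \<kappa> d0 by (subst set_integral_restrict_left[of 0 a]) auto
    also have "\<dots> = (LINT t:{a..c}|lborel. deriv \<kappa> t *\<^sub>R U t + \<kappa> t *\<^sub>R ((2 * n) *\<^sub>R A0 t))"
      by (intro set_lebesgue_integral_cong) (auto simp: U_def scaleR_add_left mult_ac)
    also have "\<dots> = (LINT t:{a..c}|lborel. deriv \<kappa> t *\<^sub>R U t) + (LINT t:{a..c}|lborel. \<kappa> t *\<^sub>R ((2 * n) *\<^sub>R A0 t))"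
      by (rule set_integral_add(2)[OF set_integrable_continuous_scaleR[OF Ui[OF \<kappa>(2)] \<kappa>c(2)]
           set_integrable_continuous_scaleR[OF set_integrable_scaleR_right[OF A0'[OF \<kappa>(2)]] \<kappa>c(1)]])
    finally have 1: "(LINT t:{a..c}|lborel. deriv \<kappa> t *\<^sub>R U t) =
       - ((LINT t:{a..c}|lborel. \<kappa> t *\<^sub>R \<Gamma> t) + (LINT t:{a..c}|lborel. \<kappa> t *\<^sub>R ((2 * n) *\<^sub>R A0 t)))"
      by (simp add: algebra_simps)
    have "set_integrable lborel {a..c} \<Gamma>"
      by (intro set_integrable_continuous continuous_on_subset[OF \<Gamma>c[of c]]) (use \<kappa> in auto)
    then have "(LINT t:{a..c}|lborel. \<kappa> t *\<^sub>R \<Gamma> t + \<kappa> t *\<^sub>R ((2 * n) *\<^sub>R A0 t)) =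
       (LINT t:{a..c}|lborel. \<kappa> t *\<^sub>R \<Gamma> t) + (LINT t:{a..c}|lborel. \<kappa> t *\<^sub>R ((2 * n) *\<^sub>R A0 t))"
      by (intro set_integral_add(2)[OF set_integrable_continuous_scaleR[OF _ \<kappa>c(1)]
           set_integrable_continuous_scaleR[OF set_integrable_scaleR_right[OF A0'[OF \<kappa>(2)]] \<kappa>c(1)]])
    then show ?thesis unfolding 1 Y_def by (simp only: scaleR_add_right)
  qed
  obtain P0 where P0: "\<And>a c. 0 < a \<Longrightarrow> a \<le> c \<Longrightarrow> P0 c - P0 a = (LINT s:{a..c}|lborel. Y s)"
    using primitive_exists[OF Yi] by blast
  obtain C where C: "AE t in lborel. t > 0 \<longrightarrow> U t = C + P0 t"
    using weak_primitive[OF Yi Ui P0 weak] by blast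
  define P where "P t = C + P0 t" for t
  have P: "P c - P a = (LINT s:{a..c}|lborel. Y s)" if "0 < a" "a \<le> c" for a c
    using P0[OF that] by (simp add: P_def)
  have Pc: "continuous_on {0<..} P" by (rule primitive_continuous[OF Yi P])
  define W where "W t = indicator {0<..} t *\<^sub>R ((1 / (4 * t powr \<nu>)) *\<^sub>R P t)" for t
  have PW: "P t = (4 * t powr \<nu>) *\<^sub>R W t" if "t > 0" for t
    using that by (simp add: W_def)
  have Wc: "continuous_on {0<..} W"
  proof (rule continuous_on_eq)
    show "continuous_on {0<..} (\<lambda>t. (1 / (4 * t powr \<nu>)) *\<^sub>R P t)"
      by (intro continuous_intros Pc) auto
  qed (simp add: W_def)
  have Wm: "W \<in> borel_measurable borel"
    unfolding W_def
    by (intro borel_measurable_continuous_on_indicator continuous_intros Pc) auto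
  have WW0: "AE t in lborel. t > 0 \<longrightarrow> W0 t = W t"
    using C
  proof eventually_elim
    case (elim t)
    show ?case
    proof
      assume t: "t > 0"
      have "t * t powr (\<nu> - 1) = t powr \<nu>"
        using t by (simp add: powr_diff)
      then have "U t = (4 * t powr \<nu>) *\<^sub>R W0 t" by (simp add: U_def A0_def mult.assoc)
      then have "(4 * t powr \<nu>) *\<^sub>R W0 t = (4 * t powr \<nu>) *\<^sub>R W t"
        using elim t PW[OF t] by (simp add: P_def)
      then show "W0 t = W t" using t by simp
    qed
  qed
  have "AE x in lebesgue. W0 ((x::real^'n) \<bullet> x) = W (x \<bullet> x)" by (rule AE_sqnorm[OF WW0])
  with W0(2) have eqW: "AE x in lebesgue. \<phi> x = W (x \<bullet> x)" by eventually_elim simp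
  note wre' = weak_radial_equation[OF sol Wm eqW, folded \<nu>_def]
  have i: "set_integrable lborel {0..T} (\<lambda>t. t powr (\<nu> - 1) *\<^sub>R (W t - nonlin b p W t))" for T
    using set_integral_diff(1)[OF wre'(1,2)[OF smooth_const[of 0]], of T] by (simp add: scaleR_diff_right)
  have \<Gamma>W: "\<Gamma> t = (LINT s:{0..t}|lborel. s powr (\<nu> - 1) *\<^sub>R (W s - nonlin b p W s))" for t
    unfolding \<Gamma>_def set_lebesgue_integral_def
  proof (rule integral_cong_AE)
    show "(\<lambda>s. indicat_real {0..t} s *\<^sub>R G0 s) \<in> borel_measurable lborel"
      using G0 unfolding set_integrable_def by (rule borel_measurable_integrable)
    show "(\<lambda>s. indicat_real {0..t} s *\<^sub>R (s powr (\<nu> - 1) *\<^sub>R (W s - nonlin b p W s))) \<in> borel_measurable lborel"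
      using i unfolding set_integrable_def by (rule borel_measurable_integrable)
    show "AE s in lborel. indicat_real {0..t} s *\<^sub>R G0 s = indicat_real {0..t} s *\<^sub>R (s powr (\<nu> - 1) *\<^sub>R (W s - nonlin b p W s))"
      using WW0 AE_lborel_singleton[of 0]
      by eventually_elim (auto simp: indicator_def G0_def A0_def B0_def nonlin_def scaleR_diff_right)
  qed
  have \<Gamma>c': "continuous_on {0<..} \<Gamma>"
  proof -
    have "isCont \<Gamma> t" if "t > 0" for t
      using continuous_on_interior[OF \<Gamma>c[of "t + 1"], of t] that by (simp add: interior_atLeastAtMost_real)
    then show ?thesis by (simp add: continuous_on_eq_continuous_at)
  qed
  define Yc where "Yc t = \<Gamma> t + (2 * n * t powr (\<nu> - 1)) *\<^sub>R W t" for t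
  have Ycc: "continuous_on {0<..} Yc"
    unfolding Yc_def by (intro continuous_intros \<Gamma>c' Wc) auto
  have PYc: "P c - P a = (LINT s:{a..c}|lborel. Yc s)" if "0 < a" "a \<le> c" for a c
    unfolding P[OF that] set_lebesgue_integral_def
  proof (rule integral_cong_AE)
    show "(\<lambda>s. indicat_real {a..c} s *\<^sub>R Y s) \<in> borel_measurable lborel"
      using Yi[OF that(1)] unfolding set_integrable_def by (rule borel_measurable_integrable)
    have "set_integrable lborel {a..c} Yc"
      by (intro set_integrable_continuous continuous_on_subset[OF Ycc]) (use that in auto)
    then show "(\<lambda>s. indicat_real {a..c} s *\<^sub>R Yc s) \<in> borel_measurable lborel"
      unfolding set_integrable_def by (rule borel_measurable_integrable)
    show "AE s in lborel. indicat_real {a..c} s *\<^sub>R Y s = indicat_real {a..c} s *\<^sub>R Yc s"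
      using WW0 by eventually_elim (use that in \<open>auto simp: indicator_def Y_def Yc_def A0_def\<close>)
  qed
  define W' where "W' t = (t powr (- \<nu>) / 4) *\<^sub>R \<Gamma> t" for t
  have W': "(W has_vector_derivative W' t) (at t)" if t: "t > 0" for t
  proof -
    have dP: "(P has_vector_derivative Yc t) (at t)" by (rule primitive_has_derivative[OF Ycc PYc t])
    have ds: "((\<lambda>t. t powr (- \<nu>) / 4) has_real_derivative (- \<nu> * t powr (- \<nu> - 1) / 4)) (at t)"
      using t by (auto intro!: derivative_eq_intros)
    have "((\<lambda>t. (t powr (- \<nu>) / 4) *\<^sub>R P t) has_vector_derivative
        (t powr (- \<nu>) / 4) *\<^sub>R Yc t + (- \<nu> * t powr (- \<nu> - 1) / 4) *\<^sub>R P t) (at t)"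
      by (rule has_vector_derivative_scaleR[OF ds dP])
    moreover have "(t powr (- \<nu>) / 4) *\<^sub>R Yc t + (- \<nu> * t powr (- \<nu> - 1) / 4) *\<^sub>R P t = W' t"
    proof -
      have e1: "t powr (- \<nu>) * t powr (\<nu> - 1) = 1 / t" "t powr (- \<nu> - 1) * t powr \<nu> = 1 / t"
      proof -
        have "t powr (- \<nu> + (\<nu> - 1)) = 1 / t" "t powr (- \<nu> - 1 + \<nu>) = 1 / t"
          using t by (simp_all add: powr_minus_divide)
        then show "t powr (- \<nu>) * t powr (\<nu> - 1) = 1 / t" "t powr (- \<nu> - 1) * t powr \<nu> = 1 / t"
          by (simp_all only: powr_add)
      qed
      have "(t powr (- \<nu>) / 4) *\<^sub>R Yc t + (- \<nu> * t powr (- \<nu> - 1) / 4) *\<^sub>R P t =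
         W' t + ((n / 2) * (t powr (- \<nu>) * t powr (\<nu> - 1)) - \<nu> * (t powr (- \<nu> - 1) * t powr \<nu>)) *\<^sub>R W t"
        unfolding Yc_def PW[OF t] W'_def by (simp add: algebra_simps)
      also have "\<dots> = W' t" unfolding e1 n by simp
      finally show ?thesis .
    qed
    ultimately have *: "((\<lambda>t. (t powr (- \<nu>) / 4) *\<^sub>R P t) has_vector_derivative W' t) (at t)" by simp
    show ?thesis
    proof (rule has_vector_derivative_transform_within_open[OF *])
      show "open {0::real<..}" "t \<in> {0<..}" using t by auto
      show "(u powr (- \<nu>) / 4) *\<^sub>R P u = W u" if "u \<in> {0<..}" for u
        using that by (simp add: W_def powr_minus_divide)
    qed
  qed
  have "(4 * t powr \<nu>) *\<^sub>R W' t = (LINT s:{0..t}|lborel. s powr (\<nu> - 1) *\<^sub>R (W s - nonlin b p W s))"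
    if "t > 0" for t
    using that by (simp add: W'_def \<Gamma>W[symmetric] powr_minus)
  then show ?thesis
    by (intro exI[of _ W] exI[of _ W'] conjI allI impI Wm eqW i W') auto
qed

section \<open>Energy bounds for the profile\<close>

lemma integrable_L1_loc_mult:
  fixes \<phi> k :: "real^'n::finite \<Rightarrow> complex"
  assumes \<phi>: "\<phi> \<in> L1_loc" and k: "continuous_on UNIV k" "\<And>x. x \<bullet> x > T \<Longrightarrow> k x = 0"
  shows "integrable lebesgue (\<lambda>x. \<phi> x * k x)"
proof -
  define S where "S = cball (0::real^'n) (sqrt (max 0 T))"
  have S: "compact S" by (simp add: S_def)
  have out: "k x = 0" if "x \<notin> S" for x
  proof (rule k(2))
    have "sqrt (max 0 T) < sqrt (x \<bullet> x)" using that by (simp only: S_def mem_cball_0 not_le norm_eq_sqrt_inner)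
    then have "max 0 T < x \<bullet> x" by (simp only: real_sqrt_less_iff)
    then show "x \<bullet> x > T" by (simp only: max_less_iff_conj)
  qed
  have i: "integrable lebesgue (\<lambda>x. indicator S x *\<^sub>R \<phi> x)"
    using \<phi> S unfolding L1_loc_def set_integrable_def by blast
  have "compact (k ` S)" by (intro compact_continuous_image continuous_on_subset[OF k(1)] S) simp
  then obtain B where B: "\<And>x. x \<in> S \<Longrightarrow> norm (k x) \<le> B"
    using compact_imp_bounded bounded_iff by (metis imageI)
  have km: "k \<in> borel_measurable lebesgue"
    using borel_measurable_continuous_onI[OF k(1)] by (intro measurable_completion) simp
  have m: "(\<lambda>x. (indicator S x *\<^sub>R \<phi> x) * k x) \<in> borel_measurable lebesgue"
    by (intro borel_measurable_times borel_measurable_integrable[OF i] km)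
  have "integrable lebesgue (\<lambda>x. (indicator S x *\<^sub>R \<phi> x) * k x)"
  proof (rule Bochner_Integration.integrable_bound[OF _ m])
    show "integrable lebesgue (\<lambda>x. B *\<^sub>R (indicator S x *\<^sub>R \<phi> x))"
      using i by (rule integrable_scaleR_right)
    show "AE x in lebesgue. norm ((indicator S x *\<^sub>R \<phi> x) * k x) \<le> norm (B *\<^sub>R (indicator S x *\<^sub>R \<phi> x))"
    proof (rule AE_I2)
      fix x
      show "norm ((indicator S x *\<^sub>R \<phi> x) * k x) \<le> norm (B *\<^sub>R (indicator S x *\<^sub>R \<phi> x))"
        using mult_right_mono[OF order_trans[OF B abs_ge_self], of x "norm (\<phi> x)"]
        by (auto simp: indicator_def norm_mult mult.commute)
    qed
  qed
  moreover have "(\<lambda>x. (indicator S x *\<^sub>R \<phi> x) * k x) = (\<lambda>x. \<phi> x * k x)"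
    using out by (auto simp: indicator_def)
  ultimately show ?thesis by simp
qed

text \<open>The weak gradient is paired with the radial vector field \<open>\<zeta> (x \<bullet> x) x\<close>, whose divergence is
  \<open>2 t\<^bsup>1-\<nu>\<^esup> (t\<^sup>\<nu> \<zeta>)'\<close>; an integration by parts in \<open>t\<close> moves the derivative to \<open>W\<close>.  On the other side
  \<open>|g x \<zeta>| \<le> (|g|\<^sup>2 + |x|\<^sup>2 \<zeta>\<^sup>2) / 2\<close>.\<close>

lemma radial_gradient_pairing:
  fixes \<phi> :: "real^'n::finite \<Rightarrow> complex"
  assumes g: "\<And>i. g i \<in> L2" "\<And>i. weak_pdiff i \<phi> (g i)"
    and W: "W \<in> borel_measurable borel" and eq: "AE x in lebesgue. \<phi> x = W (x \<bullet> x)"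
    and W': "\<And>t. t > 0 \<Longrightarrow> (W has_vector_derivative W' t) (at t)" "continuous_on {0<..} W'"
    and \<zeta>: "smooth \<zeta>" "0 < a" "a < b" "\<And>t. t \<le> a \<or> t \<ge> b \<Longrightarrow> \<zeta> t = 0"
  defines "\<nu> \<equiv> real CARD('n) / 2" and "c \<equiv> rad_const CARD('n)"
  shows "2 * c * cmod (LINT t:{a..b}|lborel. (t powr \<nu> * \<zeta> t) *\<^sub>R W' t)
    \<le> (\<Sum>i\<in>UNIV. LINT x|lebesgue. (cmod (g i x))\<^sup>2) / 2 + c / 2 * (LINT t:{a..b}|lborel. t powr \<nu> * (\<zeta> t)\<^sup>2)"
proof -
  have c: "c > 0" unfolding c_def by (rule rad_const_pos) simp
  define n where "n = real CARD('n)"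
  have n: "n = 2 * \<nu>" by (simp add: n_def \<nu>_def)
  have \<zeta>c: "continuous_on S \<zeta>" "continuous_on S (deriv \<zeta>)" for S
    by (intro smooth_continuous smooth_deriv \<zeta>(1))+
  define \<psi> where "\<psi> i = (\<lambda>x::real^'n. complex_of_real (x $ i) * complex_of_real (\<zeta> (x \<bullet> x)))" for i
  have \<phi>L: "\<phi> \<in> L1_loc" and gL: "\<And>i. g i \<in> L1_loc"
    and wk: "\<And>i \<psi>. \<psi> \<in> test_functions \<Longrightarrow> (LINT x|lebesgue. \<phi> x * pdiff i \<psi> x) = - (LINT x|lebesgue. g i x * \<psi> x)"
    using g(2) by (auto simp: weak_pdiff_def)
  have pd: "pdiff i (\<psi> i) x = complex_of_real (2 * (x $ i) * (x $ i) * deriv \<zeta> (x \<bullet> x) + \<zeta> (x \<bullet> x))" for i x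
    unfolding \<psi>_def pdiff_coord_sqnorm[OF \<zeta>(1)] by simp
  have z: "\<zeta> t = 0" "deriv \<zeta> t = 0" if "t > b" for t
    using \<zeta>(4) that deriv_eq_0_right[OF \<zeta>(1), of b t] by auto
  have zl: "\<zeta> t = 0" "deriv \<zeta> t = 0" if "t < a" for t
    using \<zeta>(4) that deriv_eq_0_left[OF \<zeta>(1), of a t] by auto
  have comp: "continuous_on UNIV (\<lambda>x::real^'n. f (x \<bullet> x))" if "continuous_on UNIV f" for f :: "real \<Rightarrow> real"
    by (rule continuous_on_compose2[OF that]) (auto intro!: continuous_intros)
  have i1: "integrable lebesgue (\<lambda>x. \<phi> x * pdiff i (\<psi> i) x)" for i
    by (rule integrable_L1_loc_mult[OF \<phi>L, of _ b])
      (auto simp: pd z simp del: of_real_add of_real_mult intro!: continuous_intros comp \<zeta>c)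
  have i2: "integrable lebesgue (\<lambda>x. g i x * \<psi> i x)" for i
    by (rule integrable_L1_loc_mult[OF gL, of _ b])
      (auto simp: \<psi>_def z intro!: continuous_intros comp \<zeta>c)
  define h where "h t = n * \<zeta> t + 2 * t * deriv \<zeta> t" for t
  have hm: "h \<in> borel_measurable borel" unfolding h_def
    by (intro smooth_measurable smooth_add smooth_mult smooth_const smooth_id smooth_deriv \<zeta>(1))
  have sumpd: "(\<Sum>i\<in>UNIV. pdiff i (\<psi> i) x) = complex_of_real (h (x \<bullet> x))" for x
  proof -
    have "(\<Sum>i\<in>UNIV. 2 * (x $ i) * (x $ i) * deriv \<zeta> (x \<bullet> x) + \<zeta> (x \<bullet> x)) = h (x \<bullet> x)"
      unfolding h_def n_def sum.distrib sum_distrib_right[symmetric]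
      by (simp add: inner_vec_def sum_distrib_left mult.assoc)
    then show ?thesis unfolding pd by (simp only: of_real_sum[symmetric])
  qed
  have "(\<Sum>i\<in>UNIV. LINT x|lebesgue. \<phi> x * pdiff i (\<psi> i) x) = (LINT x|lebesgue. (\<Sum>i\<in>UNIV. \<phi> x * pdiff i (\<psi> i) x))"
    by (rule Bochner_Integration.integral_sum[symmetric]) (rule i1)
  also have "\<dots> = (LINT x|lebesgue. \<phi> x * complex_of_real (h (x \<bullet> x)))"
    by (simp only: sum_distrib_left[symmetric] sumpd)
  also have "\<dots> = c *\<^sub>R (LINT t:{0..b}|lborel. h t *\<^sub>R (t powr (\<nu> - 1) *\<^sub>R W t))"
    unfolding c_def \<nu>_def by (rule radial_integral[OF W eq hm]) (simp add: h_def z)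
  also have "(LINT t:{0..b}|lborel. h t *\<^sub>R (t powr (\<nu> - 1) *\<^sub>R W t)) = (LINT t:{a..b}|lborel. h t *\<^sub>R (t powr (\<nu> - 1) *\<^sub>R W t))"
    by (rule set_integral_restrict_left) (use \<zeta> zl in \<open>auto simp: h_def\<close>)
  also have "\<dots> = - 2 *\<^sub>R (LINT t:{a..b}|lborel. (t powr \<nu> * \<zeta> t) *\<^sub>R W' t)"
  proof -
    have Wc: "continuous_on {a..b} W"
      using \<zeta>(2) by (intro continuous_at_imp_continuous_on ballI has_vector_derivative_continuous[OF W'(1)]) auto
    have W'c: "continuous_on {a..b} W'" by (rule continuous_on_subset[OF W'(2)]) (use \<zeta> in auto)
    define D where "D t = (t powr \<nu> * \<zeta> t) *\<^sub>R W' t + (\<nu> * t powr (\<nu> - 1) * \<zeta> t + t powr \<nu> * deriv \<zeta> t) *\<^sub>R W t" for t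
    have "(LINT t|lborel. indicator {a..b} t *\<^sub>R D t) = (b powr \<nu> * \<zeta> b) *\<^sub>R W b - (a powr \<nu> * \<zeta> a) *\<^sub>R W a"
    proof (rule integral_FTC_Icc[where F = "\<lambda>t. (t powr \<nu> * \<zeta> t) *\<^sub>R W t"])
      show "((\<lambda>t. (t powr \<nu> * \<zeta> t) *\<^sub>R W t) has_vector_derivative D t) (at t within {a..b})" if "a \<le> t" for t
      proof -
        have "t > 0" using that \<zeta> by simp
        then have 1: "((\<lambda>t. t powr \<nu> * \<zeta> t) has_real_derivative (\<nu> * t powr (\<nu> - 1) * \<zeta> t + t powr \<nu> * deriv \<zeta> t)) (at t)"
          using smooth_DERIV[OF \<zeta>(1), of t] by (auto intro!: derivative_eq_intros)
        show ?thesis unfolding D_def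
          by (rule has_vector_derivative_at_within[OF has_vector_derivative_scaleR[OF 1 W'(1)[OF \<open>t > 0\<close>]]])
      qed
      show "continuous_on {a..b} D" unfolding D_def
        using \<zeta>(2) by (intro continuous_intros Wc W'c \<zeta>c) auto
    qed (use \<zeta> in auto)
    then have 0: "(LINT t:{a..b}|lborel. D t) = 0" using \<zeta>(4) by (simp add: set_lebesgue_integral_def)
    have i3: "set_integrable lborel {a..b} (\<lambda>t. (t powr \<nu> * \<zeta> t) *\<^sub>R W' t)"
        "set_integrable lborel {a..b} (\<lambda>t. (\<nu> * t powr (\<nu> - 1) * \<zeta> t + t powr \<nu> * deriv \<zeta> t) *\<^sub>R W t)"
      using \<zeta>(2) by (intro set_integrable_continuous continuous_intros Wc W'c \<zeta>c; auto)+
    have "(LINT t:{a..b}|lborel. h t *\<^sub>R (t powr (\<nu> - 1) *\<^sub>R W t)) =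
       (LINT t:{a..b}|lborel. 2 *\<^sub>R ((\<nu> * t powr (\<nu> - 1) * \<zeta> t + t powr \<nu> * deriv \<zeta> t) *\<^sub>R W t))"
    proof (rule set_lebesgue_integral_cong)
      show "\<forall>t. t \<in> {a..b} \<longrightarrow> h t *\<^sub>R (t powr (\<nu> - 1) *\<^sub>R W t) =
          2 *\<^sub>R ((\<nu> * t powr (\<nu> - 1) * \<zeta> t + t powr \<nu> * deriv \<zeta> t) *\<^sub>R W t)"
      proof (intro allI impI)
        fix t assume "t \<in> {a..b}"
        then have "t * t powr (\<nu> - 1) = t powr \<nu>" using \<zeta>(2) by (simp add: powr_diff)
        then have "h t * t powr (\<nu> - 1) = 2 * (\<nu> * t powr (\<nu> - 1) * \<zeta> t + t powr \<nu> * deriv \<zeta> t)"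
          unfolding h_def n by (simp add: algebra_simps)
        then show "h t *\<^sub>R (t powr (\<nu> - 1) *\<^sub>R W t) = 2 *\<^sub>R ((\<nu> * t powr (\<nu> - 1) * \<zeta> t + t powr \<nu> * deriv \<zeta> t) *\<^sub>R W t)"
          by simp
      qed
    qed simp
    also have "\<dots> = 2 *\<^sub>R (LINT t:{a..b}|lborel. (\<nu> * t powr (\<nu> - 1) * \<zeta> t + t powr \<nu> * deriv \<zeta> t) *\<^sub>R W t)"
      by (rule set_integral_scaleR_right)
    also have "(LINT t:{a..b}|lborel. (\<nu> * t powr (\<nu> - 1) * \<zeta> t + t powr \<nu> * deriv \<zeta> t) *\<^sub>R W t) =
       - (LINT t:{a..b}|lborel. (t powr \<nu> * \<zeta> t) *\<^sub>R W' t)"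
      using 0 set_integral_add(2)[OF i3] unfolding D_def by (simp add: eq_neg_iff_add_eq_0 add.commute)
    finally show ?thesis by simp
  qed
  finally have L: "2 * c * cmod (LINT t:{a..b}|lborel. (t powr \<nu> * \<zeta> t) *\<^sub>R W' t) =
     cmod (\<Sum>i\<in>UNIV. LINT x|lebesgue. \<phi> x * pdiff i (\<psi> i) x)"
    using c by (simp add: norm_minus_commute)
  have "\<psi> i \<in> test_functions" for i
    unfolding \<psi>_def by (rule test_coord_sqnorm[OF \<zeta>(1), of b]) (use \<zeta>(4) in auto)
  then have "(\<Sum>i\<in>UNIV. LINT x|lebesgue. \<phi> x * pdiff i (\<psi> i) x) = - (\<Sum>i\<in>UNIV. LINT x|lebesgue. g i x * \<psi> i x)"
    using wk by (simp add: sum_negf)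
  also have "(\<Sum>i\<in>UNIV. LINT x|lebesgue. g i x * \<psi> i x) = (LINT x|lebesgue. (\<Sum>i\<in>UNIV. g i x * \<psi> i x))"
    by (rule Bochner_Integration.integral_sum[symmetric]) (rule i2)
  finally have R: "cmod (\<Sum>i\<in>UNIV. LINT x|lebesgue. \<phi> x * pdiff i (\<psi> i) x) = cmod (LINT x|lebesgue. (\<Sum>i\<in>UNIV. g i x * \<psi> i x))"
    by simp
  define q where "q t = t * (\<zeta> t)\<^sup>2" for t
  have qm: "q \<in> borel_measurable borel" unfolding q_def power2_eq_square
    by (intro smooth_measurable smooth_mult smooth_id \<zeta>(1))
  have qe: "rad_weight CARD('n) t *\<^sub>R q t = c *\<^sub>R (indicator {a..b} t *\<^sub>R (t powr \<nu> * (\<zeta> t)\<^sup>2))" for t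
  proof (cases "t \<in> {a..b}")
    case True
    then have "t > 0" using \<zeta> by auto
    then show ?thesis using True \<zeta>(2) by (simp add: rad_weight_eq q_def c_def \<nu>_def powr_diff)
  next
    case False
    then have "\<zeta> t = 0" using \<zeta>(4)[of t] by auto
    then show ?thesis using False by (simp add: q_def)
  qed
  have "set_integrable lborel {a..b} (\<lambda>t. t powr \<nu> * (\<zeta> t)\<^sup>2)"
    using \<zeta>(2) by (intro set_integrable_continuous continuous_intros \<zeta>c) auto
  then have "integrable lborel (\<lambda>t. c *\<^sub>R (indicator {a..b} t *\<^sub>R (t powr \<nu> * (\<zeta> t)\<^sup>2)))"
    unfolding set_integrable_def by (rule integrable_scaleR_right)
  then have qi: "integrable lebesgue (\<lambda>x::real^'n. q (x \<bullet> x))"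
    unfolding integrable_sqnorm[OF qm] qe .
  have qint: "(LINT x|lebesgue. q ((x::real^'n) \<bullet> x)) = c * (LINT t:{a..b}|lborel. t powr \<nu> * (\<zeta> t)\<^sup>2)"
    unfolding integral_sqnorm[OF qm] qe integral_scaleR_right set_lebesgue_integral_def by simp
  have gi: "integrable lebesgue (\<lambda>x. (cmod (g i x))\<^sup>2)" for i using g(1) by (auto simp: L2_def)
  have "cmod (LINT x|lebesgue. (\<Sum>i\<in>UNIV. g i x * \<psi> i x)) \<le>
     (LINT x|lebesgue. (\<Sum>i\<in>UNIV. (cmod (g i x))\<^sup>2) / 2 + q (x \<bullet> x) / 2)"
  proof (rule Bochner_Integration.integral_norm_bound_integral)
    show "integrable lebesgue (\<lambda>x. \<Sum>i\<in>UNIV. g i x * \<psi> i x)" by (intro Bochner_Integration.integrable_sum i2)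
    show "integrable lebesgue (\<lambda>x. (\<Sum>i\<in>UNIV. (cmod (g i x))\<^sup>2) / 2 + q (x \<bullet> x) / 2)"
      by (intro Bochner_Integration.integrable_add Bochner_Integration.integrable_divide Bochner_Integration.integrable_sum gi qi)
    fix x
    have "cmod (\<Sum>i\<in>UNIV. g i x * \<psi> i x) \<le> (\<Sum>i\<in>UNIV. cmod (g i x * \<psi> i x))" by (rule norm_sum)
    also have "\<dots> \<le> (\<Sum>i\<in>UNIV. (cmod (g i x))\<^sup>2 / 2 + (x $ i)\<^sup>2 * (\<zeta> (x \<bullet> x))\<^sup>2 / 2)"
    proof (rule sum_mono)
      fix i
      have "0 \<le> (cmod (g i x) - \<bar>x $ i\<bar> * \<bar>\<zeta> (x \<bullet> x)\<bar>)\<^sup>2" by simp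
      then show "cmod (g i x * \<psi> i x) \<le> (cmod (g i x))\<^sup>2 / 2 + (x $ i)\<^sup>2 * (\<zeta> (x \<bullet> x))\<^sup>2 / 2"
        by (simp add: \<psi>_def norm_mult power2_diff power_mult_distrib algebra_simps)
    qed
    also have "\<dots> = (\<Sum>i\<in>UNIV. (cmod (g i x))\<^sup>2) / 2 + q (x \<bullet> x) / 2"
      by (simp add: sum.distrib sum_divide_distrib q_def inner_vec_def sum_distrib_right power2_eq_square)
    finally show "cmod (\<Sum>i\<in>UNIV. g i x * \<psi> i x) \<le> (\<Sum>i\<in>UNIV. (cmod (g i x))\<^sup>2) / 2 + q (x \<bullet> x) / 2" .
  qed
  also have "\<dots> = (\<Sum>i\<in>UNIV. LINT x|lebesgue. (cmod (g i x))\<^sup>2) / 2 + c / 2 * (LINT t:{a..b}|lborel. t powr \<nu> * (\<zeta> t)\<^sup>2)"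
    using gi qi by (subst Bochner_Integration.integral_add) (auto simp: qint)
  finally show ?thesis using L R by simp
qed

lemma set_integral_tendsto_continuous:
  fixes f :: "nat \<Rightarrow> real \<Rightarrow> real"
  assumes "\<And>k. continuous_on {a..b} (f k)" "continuous_on {a..b} g"
    and B: "\<And>k t. t \<in> {a..b} \<Longrightarrow> \<bar>f k t\<bar> \<le> B"
    and lim: "\<And>t. a < t \<Longrightarrow> t < b \<Longrightarrow> (\<lambda>k. f k t) \<longlonglongrightarrow> g t"
  shows "(\<lambda>k. LINT t:{a..b}|lborel. f k t) \<longlonglongrightarrow> (LINT t:{a..b}|lborel. g t)"
  unfolding set_lebesgue_integral_def
proof (rule integral_dominated_convergence)
  show "integrable lborel (\<lambda>t. indicator {a..b} t *\<^sub>R B)"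
    using set_integrable_continuous[of a b "\<lambda>_. B"] by (simp add: set_integrable_def)
  show "(\<lambda>t. indicat_real {a..b} t *\<^sub>R g t) \<in> borel_measurable lborel"
    using set_integrable_continuous[OF assms(2)] unfolding set_integrable_def by (rule borel_measurable_integrable)
  show "(\<lambda>t. indicat_real {a..b} t *\<^sub>R f k t) \<in> borel_measurable lborel" for k
    using set_integrable_continuous[OF assms(1)] unfolding set_integrable_def by (rule borel_measurable_integrable)
  show "AE t in lborel. norm (indicat_real {a..b} t *\<^sub>R f k t) \<le> indicator {a..b} t *\<^sub>R B" for k
    using B by (intro AE_I2) (auto simp: indicator_def)
  show "AE t in lborel. (\<lambda>k. indicat_real {a..b} t *\<^sub>R f k t) \<longlonglongrightarrow> indicat_real {a..b} t *\<^sub>R g t"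
    using AE_lborel_singleton[of a] AE_lborel_singleton[of b]
  proof eventually_elim
    case (elim t)
    then show ?case using lim[of t] by (cases "t \<in> {a..b}") auto
  qed
qed

text \<open>Choosing \<open>\<zeta> = w\<close> in the hypothesis would give \<open>2 c X \<le> G / 2 + c X / 2\<close> for the integral \<open>X\<close> to be
  estimated.  This \<open>\<zeta>\<close> is approximated by polynomials close to \<open>w\<close>, multiplied by bumps.\<close>

lemma quadratic_duality:
  fixes w m :: "real \<Rightarrow> real"
  assumes wc: "continuous_on {a..b} w" and mc: "continuous_on {a..b} m"
    and m: "\<And>t. t \<in> {a..b} \<Longrightarrow> 0 \<le> m t" and c: "0 < c"
    and H: "\<And>\<zeta>. smooth \<zeta> \<Longrightarrow> (\<And>t. t \<le> a \<or> t \<ge> b \<Longrightarrow> \<zeta> t = 0) \<Longrightarrow>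
      2 * c * \<bar>LINT t:{a..b}|lborel. m t * \<zeta> t * w t\<bar> \<le> G / 2 + c / 2 * (LINT t:{a..b}|lborel. m t * (\<zeta> t)\<^sup>2)"
  shows "(LINT t:{a..b}|lborel. m t * (w t)\<^sup>2) \<le> G / (3 * c)"
proof -
  have "\<exists>q. real_polynomial_function q \<and> (\<forall>t\<in>{a..b}. \<bar>w t - q t\<bar> < inverse (real (Suc k)))" for k
  proof -
    obtain q where "real_polynomial_function q" "\<And>t. t \<in> {a..b} \<Longrightarrow> \<bar>w t - q t\<bar> < inverse (real (Suc k))"
      by (rule Stone_Weierstrass_real_polynomial_function[of "{a..b}" w "inverse (real (Suc k))"]) (use wc in auto)
    then show ?thesis by blast
  qed
  then obtain q where q: "\<And>k. real_polynomial_function (q k)"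
    "\<And>k t. t \<in> {a..b} \<Longrightarrow> \<bar>w t - q k t\<bar> < inverse (real (Suc k))" by metis
  define \<zeta> where "\<zeta> k t = bump a b (real (Suc k)) t * q k t" for k t
  have s: "smooth (\<zeta> k)" for k
    unfolding \<zeta>_def by (intro smooth_mult smooth_bump smooth_real_polynomial_function q)
  have z: "\<zeta> k t = 0" if "t \<le> a \<or> t \<ge> b" for k t
    using that bump_eq_0[of "real (Suc k)" t a b] by (simp add: \<zeta>_def)
  have \<zeta>c: "continuous_on {a..b} (\<zeta> k)" for k by (rule smooth_continuous[OF s])
  have "compact (w ` {a..b})" "compact (m ` {a..b})" using wc mc by (auto intro: compact_continuous_image)
  then obtain M0 M1 where M0: "\<And>t. t \<in> {a..b} \<Longrightarrow> \<bar>w t\<bar> \<le> M0" and M1: "\<And>t. t \<in> {a..b} \<Longrightarrow> \<bar>m t\<bar> \<le> M1"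
    using compact_imp_bounded bounded_iff by (metis imageI real_norm_def)
  have \<zeta>b: "\<bar>\<zeta> k t\<bar> \<le> M0 + 1" if t: "t \<in> {a..b}" for k t
  proof -
    have "inverse (real (Suc k)) \<le> 1" by (simp add: field_simps)
    then have "\<bar>q k t\<bar> \<le> M0 + 1" using q(2)[OF t, of k] M0[OF t] by linarith
    moreover have "\<bar>\<zeta> k t\<bar> \<le> \<bar>q k t\<bar>"
      using bump_nonneg[of a b "real (Suc k)" t] bump_le_1[of a b "real (Suc k)" t]
      by (simp add: \<zeta>_def abs_mult mult_left_le_one_le)
    ultimately show ?thesis by linarith
  qed
  have \<zeta>l: "(\<lambda>k. \<zeta> k t) \<longlonglongrightarrow> w t" if "a < t" "t < b" for t
  proof -
    have "(\<lambda>k. w t - q k t) \<longlonglongrightarrow> 0"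
    proof (rule Lim_null_comparison)
      show "\<forall>\<^sub>F k in sequentially. norm (w t - q k t) \<le> inverse (real (Suc k))"
        using q(2)[of t] that by (intro always_eventually) (auto intro: less_imp_le)
      show "(\<lambda>k. inverse (real (Suc k))) \<longlonglongrightarrow> 0" by (rule LIMSEQ_inverse_real_of_nat)
    qed
    from tendsto_diff[OF tendsto_const this, of "w t"] have "(\<lambda>k. q k t) \<longlonglongrightarrow> w t" by simp
    from tendsto_mult[OF bump_tendsto[of a b t] this] show ?thesis using that by (simp add: \<zeta>_def)
  qed
  define X where "X = (LINT t:{a..b}|lborel. m t * (w t)\<^sup>2)"
  have "(\<lambda>k. LINT t:{a..b}|lborel. m t * \<zeta> k t * w t) \<longlonglongrightarrow> X"
    unfolding X_def
  proof (rule set_integral_tendsto_continuous)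
    show "\<bar>m t * \<zeta> k t * w t\<bar> \<le> M1 * (M0 + 1) * M0" if "t \<in> {a..b}" for k t
      unfolding abs_mult using M0[OF that] M1[OF that] \<zeta>b[OF that]
      by (intro mult_mono) (auto intro: order_trans[OF abs_ge_zero])
    show "(\<lambda>k. m t * \<zeta> k t * w t) \<longlonglongrightarrow> m t * (w t)\<^sup>2" if "a < t" "t < b" for t
      unfolding power2_eq_square mult.assoc[symmetric] by (intro tendsto_intros \<zeta>l that)
  qed (intro continuous_intros wc mc \<zeta>c)+
  then have l1: "(\<lambda>k. 2 * c * \<bar>LINT t:{a..b}|lborel. m t * \<zeta> k t * w t\<bar>) \<longlonglongrightarrow> 2 * c * \<bar>X\<bar>"
    by (intro tendsto_intros)
  have "(\<lambda>k. LINT t:{a..b}|lborel. m t * (\<zeta> k t)\<^sup>2) \<longlonglongrightarrow> X"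
    unfolding X_def
  proof (rule set_integral_tendsto_continuous)
    show "\<bar>m t * (\<zeta> k t)\<^sup>2\<bar> \<le> M1 * ((M0 + 1) * (M0 + 1))" if "t \<in> {a..b}" for k t
      unfolding abs_mult power2_eq_square using M1[OF that] \<zeta>b[OF that]
      by (intro mult_mono) (auto intro: order_trans[OF abs_ge_zero])
    show "(\<lambda>k. m t * (\<zeta> k t)\<^sup>2) \<longlonglongrightarrow> m t * (w t)\<^sup>2" if "a < t" "t < b" for t
      by (intro tendsto_intros \<zeta>l that)
  qed (intro continuous_intros wc mc \<zeta>c)+
  then have l2: "(\<lambda>k. G / 2 + c / 2 * (LINT t:{a..b}|lborel. m t * (\<zeta> k t)\<^sup>2)) \<longlonglongrightarrow> G / 2 + c / 2 * X"
    by (intro tendsto_intros)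
  have "2 * c * \<bar>X\<bar> \<le> G / 2 + c / 2 * X"
    by (rule LIMSEQ_le[OF l1 l2]) (use H[OF s z] in auto)
  moreover have "c * X \<le> c * \<bar>X\<bar>" using c by simp
  ultimately have "3 * c * X \<le> G" by linarith
  then show ?thesis unfolding X_def using c by (simp add: field_simps)
qed

text \<open>Over the whole half-line these integrals are multiples of \<open>\<parallel>\<nabla>\<phi>\<parallel>\<^sup>2\<close> and \<open>\<parallel>\<phi>\<parallel>\<^sup>2\<close>.  The weak gradient is
  not compared with the classical one pointwise: the duality lemma only needs its pairing with radial fields.\<close>

lemma radial_energy_bounds:
  fixes \<phi> :: "real^'n::finite \<Rightarrow> complex"
  assumes \<phi>: "\<phi> \<in> H1"
    and W: "W \<in> borel_measurable borel" and eq: "AE x in lebesgue. \<phi> x = W (x \<bullet> x)"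
    and W': "\<And>t. t > 0 \<Longrightarrow> (W has_vector_derivative W' t) (at t)" "continuous_on {0<..} W'"
  defines "\<nu> \<equiv> real CARD('n) / 2"
  shows "\<exists>K. \<forall>a b. 0 < a \<longrightarrow> a < b \<longrightarrow> integral {a..b} (\<lambda>t. t powr \<nu> * (cmod (W' t))\<^sup>2) \<le> K \<and>
    integral {a..b} (\<lambda>t. t powr (\<nu> - 1) * (cmod (W t))\<^sup>2) \<le> K"
proof -
  define c where "c = rad_const CARD('n)"
  have c: "c > 0" unfolding c_def by (rule rad_const_pos) simp
  have Wc: "continuous_on {0<..} W"
    by (intro continuous_at_imp_continuous_on ballI has_vector_derivative_continuous[OF W'(1)]) auto
  obtain g where g: "\<And>i. g i \<in> L2" "\<And>i. weak_pdiff i \<phi> (g i)"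
    using \<phi> unfolding H1_def by (auto, metis)
  define G where "G = (\<Sum>i\<in>UNIV. LINT x|lebesgue. (cmod (g i x))\<^sup>2)"
  have E1: "integral {a..b} (\<lambda>t. t powr \<nu> * (cmod (W' t))\<^sup>2) \<le> 2 * (G / (3 * c))" if ab: "0 < a" "a < b" for a b
  proof -
    have W'c: "continuous_on {a..b} W'" by (rule continuous_on_subset[OF W'(2)]) (use ab in auto)
    have mc: "continuous_on {a..b} (\<lambda>t. t powr \<nu>)" using ab by (intro continuous_intros) auto
    have pair: "2 * c * cmod (LINT t:{a..b}|lborel. (t powr \<nu> * \<zeta> t) *\<^sub>R W' t)
      \<le> G / 2 + c / 2 * (LINT t:{a..b}|lborel. t powr \<nu> * (\<zeta> t)\<^sup>2)"
      if "smooth \<zeta>" "\<And>t. t \<le> a \<or> t \<ge> b \<Longrightarrow> \<zeta> t = 0" for \<zeta>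
      unfolding G_def c_def \<nu>_def by (rule radial_gradient_pairing[OF g W eq W' that(1) ab that(2)])
    have i: "integrable lborel (\<lambda>t. indicator {a..b} t *\<^sub>R ((t powr \<nu> * \<zeta> t) *\<^sub>R W' t))" if "smooth \<zeta>" for \<zeta>
      unfolding set_integrable_def[symmetric]
      by (intro set_integrable_continuous continuous_on_scaleR continuous_on_mult mc W'c smooth_continuous that)
    have part: "(LINT t:{a..b}|lborel. t powr \<nu> * (l (W' t))\<^sup>2) \<le> G / (3 * c)"
      if l: "bounded_linear l" "\<And>z. \<bar>l z\<bar> \<le> cmod z" for l :: "complex \<Rightarrow> real"
    proof (rule quadratic_duality[OF _ mc _ c])
      interpret l: bounded_linear l by fact
      show "continuous_on {a..b} (\<lambda>t. l (W' t))" by (rule l.continuous_on[OF W'c])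
      fix \<zeta> assume \<zeta>: "smooth \<zeta>" "\<And>t. t \<le> a \<or> t \<ge> b \<Longrightarrow> \<zeta> t = 0"
      have "(LINT t:{a..b}|lborel. t powr \<nu> * \<zeta> t * l (W' t)) = l (LINT t:{a..b}|lborel. (t powr \<nu> * \<zeta> t) *\<^sub>R W' t)"
        unfolding set_lebesgue_integral_def integral_bounded_linear[OF l(1) i[OF \<zeta>(1)], symmetric]
        by (simp add: l.scaleR mult.assoc)
      then have "2 * c * \<bar>LINT t:{a..b}|lborel. t powr \<nu> * \<zeta> t * l (W' t)\<bar>
        \<le> 2 * c * cmod (LINT t:{a..b}|lborel. (t powr \<nu> * \<zeta> t) *\<^sub>R W' t)"
        using c l(2) by simp
      then show "2 * c * \<bar>LINT t:{a..b}|lborel. t powr \<nu> * \<zeta> t * l (W' t)\<bar>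
        \<le> G / 2 + c / 2 * (LINT t:{a..b}|lborel. t powr \<nu> * (\<zeta> t)\<^sup>2)"
        using pair[OF \<zeta>] by linarith
    qed simp
    have "integral {a..b} (\<lambda>t. t powr \<nu> * (cmod (W' t))\<^sup>2) = (LINT t:{a..b}|lborel. t powr \<nu> * (cmod (W' t))\<^sup>2)"
      by (intro set_borel_integral_eq_integral(2)[symmetric] set_integrable_continuous continuous_on_mult mc
          continuous_on_power continuous_on_norm W'c)
    also have "\<dots> = (LINT t:{a..b}|lborel. t powr \<nu> * (Re (W' t))\<^sup>2 + t powr \<nu> * (Im (W' t))\<^sup>2)"
      by (simp only: cmod_power2 distrib_left)
    also have "\<dots> = (LINT t:{a..b}|lborel. t powr \<nu> * (Re (W' t))\<^sup>2) + (LINT t:{a..b}|lborel. t powr \<nu> * (Im (W' t))\<^sup>2)"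
      by (rule set_integral_add(2); intro set_integrable_continuous continuous_on_mult mc continuous_on_power
          continuous_on_Re continuous_on_Im W'c)
    finally show ?thesis
      using part[OF bounded_linear_Re abs_Re_le_cmod] part[OF bounded_linear_Im abs_Im_le_cmod] by simp
  qed
  have m2: "(\<lambda>t. (cmod (W t))\<^sup>2) \<in> borel_measurable borel" using W by measurable
  have ae: "AE x in lebesgue. (cmod (\<phi> x))\<^sup>2 = (cmod (W (x \<bullet> x)))\<^sup>2" using eq by eventually_elim simp
  have \<phi>2: "integrable lebesgue (\<lambda>x. (cmod (\<phi> x))\<^sup>2)" using \<phi> by (auto simp: H1_def L2_def)
  have "integrable lebesgue (\<lambda>x::real^'n. (cmod (W (x \<bullet> x)))\<^sup>2)"
    using \<phi>2 integrable_cong_AE[OF borel_measurable_integrable[OF \<phi>2] radial_measurable[OF m2] ae] by simp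
  then have i2: "integrable lborel (\<lambda>t. rad_weight CARD('n) t *\<^sub>R (cmod (W t))\<^sup>2)"
    by (subst (asm) integrable_sqnorm[OF m2])
  define K2 where "K2 = (LINT t|lborel. rad_weight CARD('n) t *\<^sub>R (cmod (W t))\<^sup>2) / c"
  have E2: "integral {a..b} (\<lambda>t. t powr (\<nu> - 1) * (cmod (W t))\<^sup>2) \<le> K2" if ab: "0 < a" "a < b" for a b
  proof -
    have si: "set_integrable lborel {a..b} (\<lambda>t. t powr (\<nu> - 1) * (cmod (W t))\<^sup>2)"
      using ab by (intro set_integrable_continuous continuous_intros continuous_on_subset[OF Wc]) auto
    have "c * integral {a..b} (\<lambda>t. t powr (\<nu> - 1) * (cmod (W t))\<^sup>2) =
      c * (LINT t:{a..b}|lborel. t powr (\<nu> - 1) * (cmod (W t))\<^sup>2)"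
      by (simp only: set_borel_integral_eq_integral(2)[OF si])
    also have "\<dots> = (LINT t|lborel. c * (indicator {a..b} t *\<^sub>R (t powr (\<nu> - 1) * (cmod (W t))\<^sup>2)))"
      unfolding set_lebesgue_integral_def by (rule integral_mult_right_zero[symmetric])
    also have "\<dots> \<le> (LINT t|lborel. rad_weight CARD('n) t *\<^sub>R (cmod (W t))\<^sup>2)"
    proof (rule integral_mono)
      show "integrable lborel (\<lambda>t. c * (indicator {a..b} t *\<^sub>R (t powr (\<nu> - 1) * (cmod (W t))\<^sup>2)))"
        using si unfolding set_integrable_def by (intro integrable_mult_right)
      show "c * (indicator {a..b} t *\<^sub>R (t powr (\<nu> - 1) * (cmod (W t))\<^sup>2)) \<le> rad_weight CARD('n) t *\<^sub>R (cmod (W t))\<^sup>2" for t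
        using c ab by (auto simp: indicator_def rad_weight_eq c_def \<nu>_def)
    qed (rule i2)
    finally show ?thesis unfolding K2_def using c by (simp add: field_simps)
  qed
  show ?thesis
    by (intro exI[of _ "max (2 * (G / (3 * c))) K2"] allI impI conjI max.coboundedI1[OF E1] max.coboundedI2[OF E2])
qed

section \<open>The profile near the origin\<close>

lemma young_weighted: "0 < A \<Longrightarrow> x \<le> (A * x\<^sup>2 + 1 / A) / 2" for x A :: real
proof -
  assume A: "0 < A"
  have "0 \<le> (A * x - 1)\<^sup>2 / A" using A by simp
  also have "\<dots> = A * x\<^sup>2 + 1 / A - 2 * x" using A by (simp add: power2_eq_square field_simps)
  finally show ?thesis by simp
qed

lemma has_integral_powr_interval:
  fixes e :: real
  assumes "0 < a" "a \<le> c" "e \<noteq> 0"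
  shows "((\<lambda>s. s powr (e - 1)) has_integral ((c powr e - a powr e) / e)) {a..c}"
proof -
  have "((\<lambda>s. s powr (e - 1)) has_integral (c powr e / e - a powr e / e)) {a..c}"
  proof (rule fundamental_theorem_of_calculus)
    fix s assume "s \<in> {a..c}"
    then have "((\<lambda>s. s powr e / e) has_real_derivative s powr (e - 1)) (at s)"
      using assms by (auto intro!: derivative_eq_intros)
    then show "((\<lambda>s. s powr e / e) has_vector_derivative s powr (e - 1)) (at s within {a..c})"
      by (simp add: has_real_derivative_iff_has_vector_derivative has_vector_derivative_at_within)
  qed (use assms in simp)
  then show ?thesis by (simp add: diff_divide_distrib)
qed

text \<open>What the remaining analysis uses about the profile: \<open>\<nu>\<close> is half the dimension, \<open>K\<close> bounds the energy, and
  the two bounds on \<open>p\<close> are those of the theorem.  The equation is kept in integrated form because this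
  is what carries the information at \<open>t = 0\<close>.\<close>

locale radial_ode =
  fixes \<nu> b p K :: real and W W' :: "real \<Rightarrow> complex"
  assumes \<nu>: "1 \<le> \<nu>" and b: "0 < b" and p: "1 + 2 * b / (2 * \<nu> - 1) < p"
    and subcritical: "1 < \<nu> \<Longrightarrow> p < (\<nu> + 1 + b) / (\<nu> - 1)"
    and W_deriv: "\<And>t. 0 < t \<Longrightarrow> (W has_vector_derivative W' t) (at t)"
    and rhs_integrable: "\<And>T. (\<lambda>s. s powr (\<nu> - 1) *\<^sub>R (W s - nonlin b p W s)) integrable_on {0..T}"
    and W'_eq: "\<And>t. 0 < t \<Longrightarrow>
      (4 * t powr \<nu>) *\<^sub>R W' t = integral {0..t} (\<lambda>s. s powr (\<nu> - 1) *\<^sub>R (W s - nonlin b p W s))"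
    and energy': "\<And>a c. 0 < a \<Longrightarrow> a < c \<Longrightarrow> integral {a..c} (\<lambda>t. t powr \<nu> * (cmod (W' t))\<^sup>2) \<le> K"
    and energy: "\<And>a c. 0 < a \<Longrightarrow> a < c \<Longrightarrow> integral {a..c} (\<lambda>t. t powr (\<nu> - 1) * (cmod (W t))\<^sup>2) \<le> K"
begin

lemma p_gt_1: "1 < p"
proof -
  have "0 \<le> 2 * b / (2 * \<nu> - 1)" using \<nu> b by (intro divide_nonneg_nonneg) auto
  then show ?thesis using p by linarith
qed

text \<open>With the potential \<open>V\<close> the equation is treated as the linear equation
  \<open>(4 t\<^sup>\<nu> W')' = t\<^bsup>\<nu>-1\<^esup> (1 - V) W\<close>.  It is enough to know that \<open>V\<close> is less singular than \<open>1 / t\<close> at the origin and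
  tends to \<open>0\<close> at infinity.\<close>

definition V :: "real \<Rightarrow> real" where "V t = t powr (b / 2) * cmod (W t) powr (p - 1)"

definition H :: "real \<Rightarrow> complex" where "H t = (1 - V t) *\<^sub>R W t"

text \<open>The second derivative as given by the equation, solved for the highest order term.\<close>

definition W'' :: "real \<Rightarrow> complex" where "W'' t = (1 / (4 * t)) *\<^sub>R (H t - (4 * \<nu>) *\<^sub>R W' t)"

lemma H_eq: "W t - nonlin b p W t = H t"
  by (simp add: H_def V_def nonlin_def scaleR_diff_left)

lemmas H_integrable = rhs_integrable[unfolded H_eq] and W'_eq_H = W'_eq[unfolded H_eq]

lemma V_nonneg: "0 \<le> V t"
  by (simp add: V_def)

lemma W_continuous: "continuous_on {0<..} W"
  by (intro continuous_at_imp_continuous_on ballI has_vector_derivative_continuous[OF W_deriv]) auto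

lemma V_continuous: "continuous_on {0<..} V"
  unfolding V_def using p_gt_1
  by (intro continuous_on_mult continuous_on_powr' continuous_on_norm W_continuous continuous_on_id continuous_on_const) auto

lemma H_continuous: "continuous_on {0<..} H"
  unfolding H_def by (intro continuous_intros V_continuous W_continuous)

lemma W'_deriv:
  assumes t: "0 < t"
  shows "(W' has_vector_derivative W'' t) (at t)"
proof -
  define g where "g s = s powr (\<nu> - 1) *\<^sub>R H s" for s
  have gc: "continuous_on {0<..} g" unfolding g_def by (intro continuous_intros H_continuous) auto
  have "((\<lambda>u. integral {0..u} g) has_vector_derivative g t) (at t within {0..t + 1} - {})"
  proof (rule integral_has_vector_derivative_continuous_at)
    show "g integrable_on {0..t + 1}" unfolding g_def by (rule H_integrable)
    have "isCont g t" using gc t by (simp add: continuous_on_eq_continuous_at)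
    then show "continuous (at t within {0..t + 1} - {}) g" by (rule continuous_at_imp_continuous_at_within)
  qed (use t in auto)
  then have 1: "((\<lambda>u. integral {0..u} g) has_vector_derivative g t) (at t)"
    using t by (simp add: at_within_Icc_at)
  have 2: "((\<lambda>t. t powr (- \<nu>) / 4) has_real_derivative (- \<nu> * t powr (- \<nu> - 1) / 4)) (at t)"
    using t by (auto intro!: derivative_eq_intros)
  have "((\<lambda>t. (t powr (- \<nu>) / 4) *\<^sub>R integral {0..t} g) has_vector_derivative
     (t powr (- \<nu>) / 4) *\<^sub>R g t + (- \<nu> * t powr (- \<nu> - 1) / 4) *\<^sub>R integral {0..t} g) (at t)"
    by (rule has_vector_derivative_scaleR[OF 2 1])
  moreover have "(t powr (- \<nu>) / 4) *\<^sub>R g t + (- \<nu> * t powr (- \<nu> - 1) / 4) *\<^sub>R integral {0..t} g = W'' t"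
  proof -
    have I: "integral {0..t} g = (4 * t powr \<nu>) *\<^sub>R W' t" unfolding g_def by (rule W'_eq_H[OF t, symmetric])
    have "t powr (- \<nu> + (\<nu> - 1)) = 1 / t" "t powr (- \<nu> - 1 + \<nu>) = 1 / t"
      using t by (simp_all add: powr_minus_divide)
    then have e: "t powr (- \<nu>) * t powr (\<nu> - 1) = 1 / t" "t powr (- \<nu> - 1) * t powr \<nu> = 1 / t"
      by (simp_all only: powr_add)
    have "(t powr (- \<nu>) / 4) *\<^sub>R g t + (- \<nu> * t powr (- \<nu> - 1) / 4) *\<^sub>R integral {0..t} g =
      ((t powr (- \<nu>) * t powr (\<nu> - 1)) / 4) *\<^sub>R H t - (\<nu> * (t powr (- \<nu> - 1) * t powr \<nu>)) *\<^sub>R W' t"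
      unfolding I g_def by (simp add: algebra_simps)
    also have "\<dots> = W'' t" unfolding e W''_def by (simp add: algebra_simps)
    finally show ?thesis .
  qed
  ultimately have 3: "((\<lambda>t. (t powr (- \<nu>) / 4) *\<^sub>R integral {0..t} g) has_vector_derivative W'' t) (at t)" by simp
  show ?thesis
  proof (rule has_vector_derivative_transform_within_open[OF 3])
    show "open {0::real<..}" "t \<in> {0<..}" using t by auto
    fix u :: real assume u: "u \<in> {0<..}"
    have "integral {0..u} g = (4 * u powr \<nu>) *\<^sub>R W' u" unfolding g_def using u by (intro W'_eq_H[symmetric]) simp
    then show "(u powr (- \<nu>) / 4) *\<^sub>R integral {0..u} g = W' u" using u by (simp add: powr_minus)
  qed
qed

lemma W'_continuous: "continuous_on {0<..} W'"
  by (intro continuous_at_imp_continuous_on ballI has_vector_derivative_continuous[OF W'_deriv]) auto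

lemma W''_continuous: "continuous_on {0<..} W''"
  unfolding W''_def
  by (intro continuous_on_scaleR continuous_on_diff continuous_on_divide continuous_on_const continuous_on_mult
      continuous_on_id H_continuous W'_continuous) auto

lemma W_diff_bound:
  assumes "0 < a" "a \<le> c" "g integrable_on {a..c}" "\<And>s. a \<le> s \<Longrightarrow> s \<le> c \<Longrightarrow> cmod (W' s) \<le> g s"
  shows "cmod (W c - W a) \<le> integral {a..c} g"
proof -
  have i: "(W' has_integral (W c - W a)) {a..c}"
  proof (rule fundamental_theorem_of_calculus[OF assms(2)])
    show "(W has_vector_derivative W' s) (at s within {a..c})" if "s \<in> {a..c}" for s
      by (rule has_vector_derivative_at_within[OF W_deriv]) (use assms(1) that in simp)
  qed
  have "cmod (integral {a..c} W') \<le> integral {a..c} g"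
    by (rule integral_norm_bound_integral[OF has_integral_integrable[OF i] assms(3)]) (use assms(4) in auto)
  then show ?thesis unfolding integral_unique[OF i] .
qed

text \<open>The radial lemma at the origin: integrate \<open>|W'|\<close> from \<open>t\<close> to \<open>1\<close> and compare with the energy.  In
  dimension two the natural bound is logarithmic; allowing any \<open>\<alpha> > 0\<close> with \<open>\<nu> - 1 \<le> 2 \<alpha>\<close> replaces it by a power
  and treats all dimensions alike.\<close>

lemma initial_bound:
  assumes \<alpha>: "0 < \<alpha>" "\<nu> - 1 \<le> 2 * \<alpha>"
  shows "\<exists>C\<ge>0. \<forall>t. 0 < t \<longrightarrow> t \<le> 1 \<longrightarrow> cmod (W t) \<le> C * t powr (- \<alpha>)"
proof -
  \<comment> \<open>Contributions of the value at \<open>1\<close>, of the energy and of the integral of \<open>s\<^bsup>-2\<alpha>-1\<^esup>\<close>.\<close>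
  define C where "C = \<bar>cmod (W 1) + (K + 1 / (2 * \<alpha>)) / 2\<bar>"
  have "cmod (W t) \<le> C * t powr (- \<alpha>)" if t: "0 < t" "t \<le> 1" for t
  proof (cases "t = 1")
    case True
    have "0 \<le> integral {1..2} (\<lambda>t. t powr \<nu> * (cmod (W' t))\<^sup>2)"
      by (rule integral_nonneg)
        (auto intro!: integrable_continuous_interval continuous_intros continuous_on_subset[OF W'_continuous])
    then have "0 \<le> K" using energy'[of 1 2] by simp
    then show ?thesis using True \<alpha> by (simp add: C_def)
  next
    case False
    then have t1: "t < 1" using t by simp
    define E where "E s = s powr \<nu> * (cmod (W' s))\<^sup>2" for s
    \<comment> \<open>Young inequality with the weight \<open>t\<^bsup>-\<alpha>\<^esup>\<close>, which makes both terms integrate to the order \<open>t\<^bsup>-\<alpha>\<^esup>\<close>.\<close>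
    define g where "g s = (t powr (- \<alpha>) * E s + t powr \<alpha> * s powr (- 2 * \<alpha> - 1)) / 2" for s
    have Ei: "E integrable_on {t..1}" unfolding E_def using t
      by (intro integrable_continuous_interval continuous_intros continuous_on_subset[OF W'_continuous]) auto
    have pi: "((\<lambda>s. s powr (- 2 * \<alpha> - 1)) has_integral ((1 powr (- 2 * \<alpha>) - t powr (- 2 * \<alpha>)) / (- 2 * \<alpha>))) {t..1}"
      using t \<alpha> by (intro has_integral_powr_interval) auto
    have gi: "(g has_integral ((t powr (- \<alpha>) * integral {t..1} E + t powr \<alpha> * ((1 powr (- 2 * \<alpha>) - t powr (- 2 * \<alpha>)) / (- 2 * \<alpha>))) / 2)) {t..1}"
      unfolding g_def by (intro has_integral_divide has_integral_add has_integral_mult_right pi integrable_integral[OF Ei])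
    have "cmod (W 1 - W t) \<le> integral {t..1} g"
    proof (rule W_diff_bound[OF t(1) t(2)])
      show "g integrable_on {t..1}" using gi by (rule has_integral_integrable)
      fix s assume s: "t \<le> s" "s \<le> 1"
      then have s0: "0 < s" using t by simp
      have "cmod (W' s) \<le> ((t powr (- \<alpha>) * s powr \<nu>) * (cmod (W' s))\<^sup>2 + 1 / (t powr (- \<alpha>) * s powr \<nu>)) / 2"
        using t s0 by (intro young_weighted) simp
      also have "1 / (t powr (- \<alpha>) * s powr \<nu>) = t powr \<alpha> * s powr (- \<nu>)"
        using t s0 by (simp add: powr_minus field_simps)
      also have "s powr (- \<nu>) \<le> s powr (- 2 * \<alpha> - 1)"
        using s s0 \<alpha> by (intro powr_mono') auto
      finally show "cmod (W' s) \<le> g s" using t by (simp add: g_def E_def mult.assoc mult_left_mono)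
    qed
    also have "\<dots> = (t powr (- \<alpha>) * integral {t..1} E + t powr \<alpha> * ((1 powr (- 2 * \<alpha>) - t powr (- 2 * \<alpha>)) / (- 2 * \<alpha>))) / 2"
      using gi by (rule integral_unique)
    also have "t powr \<alpha> * ((1 powr (- 2 * \<alpha>) - t powr (- 2 * \<alpha>)) / (- 2 * \<alpha>)) = t powr \<alpha> * ((t powr (- 2 * \<alpha>) - 1) / (2 * \<alpha>))"
      using \<alpha> by (simp add: field_simps)
    also have "\<dots> \<le> t powr \<alpha> * (t powr (- 2 * \<alpha>) / (2 * \<alpha>))"
      using \<alpha> by (intro mult_left_mono divide_right_mono) auto
    also have "\<dots> = t powr (- \<alpha>) * (1 / (2 * \<alpha>))"
      using t by (simp add: powr_add[symmetric])
    also have "t powr (- \<alpha>) * integral {t..1} E \<le> t powr (- \<alpha>) * K"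
      unfolding E_def by (intro mult_left_mono energy' t t1) simp
    finally have 1: "cmod (W 1 - W t) \<le> t powr (- \<alpha>) * ((K + 1 / (2 * \<alpha>)) / 2)" by (simp add: algebra_simps)
    have "1 powr (- \<alpha>) \<le> t powr (- \<alpha>)" using t \<alpha> by (intro powr_mono2') auto
    then have "cmod (W 1) * 1 \<le> cmod (W 1) * t powr (- \<alpha>)" by (intro mult_left_mono) auto
    moreover have "cmod (W t) \<le> cmod (W 1) + cmod (W 1 - W t)"
      using norm_triangle_sub[of "W t" "W 1"] by (simp add: norm_minus_commute)
    ultimately have "cmod (W t) \<le> cmod (W 1) * t powr (- \<alpha>) + t powr (- \<alpha>) * ((K + 1 / (2 * \<alpha>)) / 2)"
      using 1 by linarith
    also have "\<dots> = (cmod (W 1) + (K + 1 / (2 * \<alpha>)) / 2) * t powr (- \<alpha>)"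
      by (simp only: distrib_right mult.commute[of "t powr (- \<alpha>)"])
    also have "\<dots> \<le> C * t powr (- \<alpha>)" unfolding C_def by (intro mult_right_mono) auto
    finally show ?thesis .
  qed
  moreover have "0 \<le> C" by (simp add: C_def)
  ultimately show ?thesis by blast
qed

text \<open>The integrated equation averages \<open>H\<close> with the weight \<open>s\<^bsup>\<nu>-1\<^esup>\<close>, so \<open>4 \<nu> W'\<close> inherits the
  behaviour of \<open>H\<close> at the origin.  It is used with \<open>L = 0\<close> for growth bounds and with the limit of \<open>H\<close> to find
  that of \<open>W'\<close>.\<close>

lemma W'_bound:
  assumes t: "0 < t" and r: "0 < \<nu> + r"
    and Q: "\<And>s. 0 < s \<Longrightarrow> s \<le> t \<Longrightarrow> cmod (H s - L) \<le> Q * s powr r"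
  shows "cmod (W' t - (1 / (4 * \<nu>)) *\<^sub>R L) \<le> Q / (4 * (\<nu> + r)) * t powr r"
proof -
  have \<nu>0: "\<nu> \<noteq> 0" using \<nu> by simp
  have 1: "((\<lambda>s. s powr (\<nu> - 1)) has_integral (t powr \<nu> / \<nu>)) {0..t}"
    using has_integral_powr_from_0[of "\<nu> - 1" t] \<nu> t by simp
  have "((\<lambda>s. s powr (\<nu> + r - 1)) has_integral (t powr (\<nu> + r) / (\<nu> + r))) {0..t}"
    using has_integral_powr_from_0[of "\<nu> + r - 1" t] r t by simp
  then have 2: "((\<lambda>s. Q * s powr (\<nu> + r - 1)) has_integral (Q * (t powr (\<nu> + r) / (\<nu> + r)))) {0..t}"
    by (rule has_integral_mult_right)
  have 3: "((\<lambda>s. s powr (\<nu> - 1) *\<^sub>R H s) has_integral ((4 * t powr \<nu>) *\<^sub>R W' t)) {0..t}"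
    unfolding W'_eq_H[OF t] by (rule integrable_integral[OF H_integrable])
  have 4: "((\<lambda>s. s powr (\<nu> - 1) *\<^sub>R L) has_integral ((t powr \<nu> / \<nu>) *\<^sub>R L)) {0..t}"
    by (rule has_integral_scaleR_left[OF 1])
  have 5: "((\<lambda>s. s powr (\<nu> - 1) *\<^sub>R (H s - L)) has_integral ((4 * t powr \<nu>) *\<^sub>R (W' t - (1 / (4 * \<nu>)) *\<^sub>R L))) {0..t}"
  proof (rule has_integral_eq_rhs[OF has_integral_cong[THEN iffD1, OF _ has_integral_diff[OF 3 4]]])
    show "(4 * t powr \<nu>) *\<^sub>R (W' t - (1 / (4 * \<nu>)) *\<^sub>R L) = (4 * t powr \<nu>) *\<^sub>R W' t - (t powr \<nu> / \<nu>) *\<^sub>R L"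
      using \<nu>0 by (simp add: scaleR_diff_right)
  qed (simp only: scaleR_diff_right)
  have "cmod (integral {0..t} (\<lambda>s. s powr (\<nu> - 1) *\<^sub>R (H s - L))) \<le> integral {0..t} (\<lambda>s. Q * s powr (\<nu> + r - 1))"
  proof (rule integral_norm_bound_integral)
    fix s assume s: "s \<in> {0..t}"
    show "cmod (s powr (\<nu> - 1) *\<^sub>R (H s - L)) \<le> Q * s powr (\<nu> + r - 1)"
    proof (cases "s = 0")
      case False
      then have "s powr (\<nu> - 1) * cmod (H s - L) \<le> s powr (\<nu> - 1) * (Q * s powr r)"
        using s by (intro mult_left_mono Q) auto
      also have "\<dots> = Q * (s powr (\<nu> - 1) * s powr r)" by simp
      also have "s powr (\<nu> - 1) * s powr r = s powr (\<nu> + r - 1)"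
        unfolding powr_add[symmetric] by (simp add: algebra_simps)
      finally show ?thesis by simp
    qed simp
  qed (rule has_integral_integrable[OF 5], rule has_integral_integrable[OF 2])
  then have "4 * t powr \<nu> * cmod (W' t - (1 / (4 * \<nu>)) *\<^sub>R L) \<le> Q * (t powr (\<nu> + r) / (\<nu> + r))"
    unfolding integral_unique[OF 5] integral_unique[OF 2] by simp
  also have "\<dots> = 4 * t powr \<nu> * (Q / (4 * (\<nu> + r)) * t powr r)"
  proof -
    have "Q * (x * y / z) = 4 * x * (Q / (4 * z) * y)" if "z \<noteq> 0" for x y z :: real
      using that by simp
    then show ?thesis using r by (simp only: powr_add)
  qed
  finally have "4 * t powr \<nu> * cmod (W' t - (1 / (4 * \<nu>)) *\<^sub>R L) \<le> 4 * t powr \<nu> * (Q / (4 * (\<nu> + r)) * t powr r)" .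
  moreover have "0 < 4 * t powr \<nu>" using t by simp
  ultimately show ?thesis by (metis mult_le_cancel_left_pos)
qed

lemma W_bound_of_W':
  assumes e: "e \<noteq> 0" and E: "\<And>s. 0 < s \<Longrightarrow> s \<le> 1 \<Longrightarrow> cmod (W' s) \<le> E * s powr (e - 1)"
    and t: "0 < t" "t \<le> 1"
  shows "cmod (W t) \<le> cmod (W 1) + E * ((1 - t powr e) / e)"
proof -
  have i: "((\<lambda>s. E * s powr (e - 1)) has_integral (E * ((1 powr e - t powr e) / e))) {t..1}"
    by (intro has_integral_mult_right has_integral_powr_interval t e)
  have "cmod (W 1 - W t) \<le> integral {t..1} (\<lambda>s. E * s powr (e - 1))"
    using t i by (intro W_diff_bound E) auto
  also have "\<dots> = E * ((1 - t powr e) / e)" using integral_unique[OF i] by simp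
  finally show ?thesis using norm_triangle_sub[of "W t" "W 1"] by (simp add: norm_minus_commute)
qed

text \<open>If \<open>V\<close> is of order \<open>t\<^bsup>\<delta>-1\<^esup>\<close>, a bound for \<open>W\<close> of order \<open>t\<^bsup>-\<beta>\<^esup>\<close> bounds \<open>W'\<close> by order
  \<open>t\<^bsup>\<delta>-\<beta>-1\<^esup>\<close>, and integrating gains the factor \<open>t\<^sup>\<delta>\<close>.  Only a part \<open>\<eta> \<le> \<delta>\<close> of the gain is claimed.\<close>

lemma bootstrap_step:
  assumes \<delta>: "0 < \<delta>" "\<delta> \<le> 1" "\<beta> < \<nu> - 1 + \<delta>" "\<eta> \<le> \<delta>"
    and D: "0 \<le> D" "\<And>s. 0 < s \<Longrightarrow> s \<le> 1 \<Longrightarrow> V s \<le> D * s powr (\<delta> - 1)"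
    and C: "0 \<le> C" "\<And>t. 0 < t \<Longrightarrow> t \<le> 1 \<Longrightarrow> cmod (W t) \<le> C * t powr (- \<beta>)"
  shows "\<exists>E\<ge>0. \<forall>s. 0 < s \<longrightarrow> s \<le> 1 \<longrightarrow> cmod (W' s) \<le> E * s powr (\<eta> - \<beta> - 1)"
proof -
  define Q where "Q = (1 + D) * C"
  have Q0: "0 \<le> Q" using D(1) C(1) by (simp add: Q_def)
  have H: "cmod (H s - 0) \<le> Q * s powr (\<delta> - \<beta> - 1)" if s: "0 < s" "s \<le> 1" for s
  proof -
    have "s powr 0 \<le> s powr (\<delta> - 1)" using s \<delta> by (intro powr_mono') auto
    then have "1 \<le> s powr (\<delta> - 1)" using s by simp
    moreover have "\<bar>1 - V s\<bar> \<le> 1 + V s" using V_nonneg[of s] by linarith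
    ultimately have "\<bar>1 - V s\<bar> \<le> s powr (\<delta> - 1) + D * s powr (\<delta> - 1)"
      using D(2)[OF s] by linarith
    then have "\<bar>1 - V s\<bar> \<le> (1 + D) * s powr (\<delta> - 1)" by (simp only: distrib_right mult_1)
    then have "cmod (H s) \<le> ((1 + D) * s powr (\<delta> - 1)) * (C * s powr (- \<beta>))"
      unfolding H_def norm_scaleR using C(2)[OF s] by (intro mult_mono) auto
    also have "\<dots> = Q * (s powr (\<delta> - 1) * s powr (- \<beta>))" by (simp add: Q_def)
    also have "s powr (\<delta> - 1) * s powr (- \<beta>) = s powr (\<delta> - \<beta> - 1)"
      unfolding powr_add[symmetric] by (simp add: algebra_simps)
    finally show ?thesis by simp
  qed
  have pos: "0 < \<nu> + (\<delta> - \<beta> - 1)" using \<delta> by simp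
  define E where "E = Q / (4 * (\<nu> + (\<delta> - \<beta> - 1)))"
  have E0: "0 \<le> E" using Q0 pos by (simp add: E_def)
  have "cmod (W' s) \<le> E * s powr (\<eta> - \<beta> - 1)" if s: "0 < s" "s \<le> 1" for s
  proof -
    have "cmod (W' s - (1 / (4 * \<nu>)) *\<^sub>R 0) \<le> E * s powr (\<delta> - \<beta> - 1)"
      unfolding E_def by (rule W'_bound[OF s(1) pos]) (use H s in auto)
    also have "\<dots> \<le> E * s powr (\<eta> - \<beta> - 1)"
      using s E0 \<delta>(4) by (intro mult_left_mono powr_mono') auto
    finally show ?thesis by simp
  qed
  then show ?thesis using E0 by blast
qed

lemma bounded_near_0_bootstrap:
  assumes \<alpha>: "0 < \<alpha>" and \<delta>: "0 < \<delta>" "\<delta> \<le> 1" "\<alpha> < \<nu> - 1 + \<delta>"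
    and D: "0 \<le> D" "\<And>s. 0 < s \<Longrightarrow> s \<le> 1 \<Longrightarrow> V s \<le> D * s powr (\<delta> - 1)"
    and C0: "0 \<le> C0" "\<And>t. 0 < t \<Longrightarrow> t \<le> 1 \<Longrightarrow> cmod (W t) \<le> C0 * t powr (- \<alpha>)"
  shows "\<exists>M. \<forall>t. 0 < t \<longrightarrow> t \<le> 1 \<longrightarrow> cmod (W t) \<le> M"
proof -
  obtain m :: nat where m: "\<alpha> / \<delta> \<le> real m" using real_arch_simple by blast
  \<comment> \<open>The half-integer keeps every exponent \<open>\<alpha> - k \<eta>\<close> away from \<open>0\<close>, so that no logarithm arises.\<close>
  define \<eta> where "\<eta> = \<alpha> / (real m + 1 / 2)"
  have \<eta>: "0 < \<eta>" using \<alpha> by (simp add: \<eta>_def)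
  have "\<alpha> \<le> \<delta> * real m" using m \<delta> by (simp add: field_simps)
  also have "\<dots> \<le> \<delta> * (real m + 1 / 2)" using \<delta> by (intro mult_left_mono) auto
  finally have \<eta>\<delta>: "\<eta> \<le> \<delta>" unfolding \<eta>_def by (subst pos_divide_le_eq) auto
  have "real m + 1 / 2 \<noteq> 0" by linarith
  then have \<alpha>m: "\<alpha> = (real m + 1 / 2) * \<eta>"
    unfolding \<eta>_def by simp
  have "\<exists>C\<ge>0. \<forall>t. 0 < t \<longrightarrow> t \<le> 1 \<longrightarrow> cmod (W t) \<le> C * t powr (- (\<alpha> - real k * \<eta>))" if "k \<le> m" for k
    using that
  proof (induction k)
    case 0
    show ?case by (rule exI[of _ C0]) (use C0 in simp)
  next
    case (Suc k)
    then obtain C where C: "0 \<le> C" "\<And>t. 0 < t \<Longrightarrow> t \<le> 1 \<Longrightarrow> cmod (W t) \<le> C * t powr (- (\<alpha> - real k * \<eta>))"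
      by auto
    have "\<alpha> - real k * \<eta> \<le> \<alpha>" using \<eta> by simp
    then have "\<alpha> - real k * \<eta> < \<nu> - 1 + \<delta>" using \<delta>(3) by linarith
    then obtain E where E: "0 \<le> E"
      "\<And>s. 0 < s \<Longrightarrow> s \<le> 1 \<Longrightarrow> cmod (W' s) \<le> E * s powr (\<eta> - (\<alpha> - real k * \<eta>) - 1)"
      using bootstrap_step[OF \<delta>(1,2) _ \<eta>\<delta> D C] by blast
    define \<gamma> where "\<gamma> = \<alpha> - real (Suc k) * \<eta>"
    have "real (Suc k) * \<eta> \<le> real m * \<eta>" using Suc.prems \<eta> by (intro mult_right_mono) auto
    then have \<gamma>: "0 < \<gamma>" using \<eta> unfolding \<gamma>_def \<alpha>m by (simp add: algebra_simps)
    have \<gamma>': "\<eta> - (\<alpha> - real k * \<eta>) = - \<gamma>" by (simp add: \<gamma>_def algebra_simps)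
    have "cmod (W t) \<le> (cmod (W 1) + E / \<gamma>) * t powr (- \<gamma>)" if t: "0 < t" "t \<le> 1" for t
    proof -
      have "cmod (W t) \<le> cmod (W 1) + E * ((1 - t powr (- \<gamma>)) / (- \<gamma>))"
        by (rule W_bound_of_W'[OF _ E(2)[unfolded \<gamma>'] t]) (use \<gamma> in simp)
      also have "(1 - t powr (- \<gamma>)) / (- \<gamma>) \<le> t powr (- \<gamma>) / \<gamma>" using \<gamma> by (simp add: field_simps)
      finally have 1: "cmod (W t) \<le> cmod (W 1) + E * (t powr (- \<gamma>) / \<gamma>)" using E(1) by (simp add: mult_left_mono)
      have "1 powr (- \<gamma>) \<le> t powr (- \<gamma>)" using t \<gamma> by (intro powr_mono2') auto
      then have "cmod (W 1) * 1 \<le> cmod (W 1) * t powr (- \<gamma>)" by (intro mult_left_mono) auto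
      then show ?thesis using 1 by (simp add: algebra_simps)
    qed
    moreover have "0 \<le> cmod (W 1) + E / \<gamma>" using E \<gamma> by simp
    ultimately show ?case unfolding \<gamma>_def by blast
  qed
  then obtain C where C: "0 \<le> C" "\<And>t. 0 < t \<Longrightarrow> t \<le> 1 \<Longrightarrow> cmod (W t) \<le> C * t powr (- (\<alpha> - real m * \<eta>))"
    by blast
  have "\<alpha> - real m * \<eta> \<le> \<alpha>" using \<eta> by simp
  then have "\<alpha> - real m * \<eta> < \<nu> - 1 + \<delta>" using \<delta>(3) by linarith
  then obtain E where E: "0 \<le> E"
    "\<And>s. 0 < s \<Longrightarrow> s \<le> 1 \<Longrightarrow> cmod (W' s) \<le> E * s powr (\<eta> - (\<alpha> - real m * \<eta>) - 1)"
    using bootstrap_step[OF \<delta>(1,2) _ \<eta>\<delta> D C] by blast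
  have e: "\<eta> - (\<alpha> - real m * \<eta>) = \<eta> / 2" unfolding \<alpha>m by (simp add: algebra_simps)
  have "cmod (W t) \<le> cmod (W 1) + E * (1 / (\<eta> / 2))" if t: "0 < t" "t \<le> 1" for t
  proof -
    have "cmod (W t) \<le> cmod (W 1) + E * ((1 - t powr (\<eta> / 2)) / (\<eta> / 2))"
      by (rule W_bound_of_W'[OF _ E(2)[unfolded e] t]) (use \<eta> in simp)
    also have "\<dots> \<le> cmod (W 1) + E * (1 / (\<eta> / 2))"
      using E(1) \<eta> by (intro add_left_mono mult_left_mono divide_right_mono) auto
    finally show ?thesis .
  qed
  then show ?thesis by blast
qed

text \<open>Subcriticality enters here.  For \<open>\<nu> > 1\<close> and \<open>\<alpha> = (\<nu> - 1) / 2\<close> the condition \<open>\<alpha> (p - 1) < 1 + b / 2\<close> is exactly the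
  upper bound on \<open>p\<close>; in dimension two a sufficiently small \<open>\<alpha>\<close> works for every \<open>p\<close>.\<close>

lemma exponent_exists:
  obtains \<alpha> where "0 < \<alpha>" "\<nu> - 1 \<le> 2 * \<alpha>" "\<alpha> * (p - 1) < 1 + b / 2" "\<alpha> < \<nu> - 1 + min 1 (1 + b / 2 - \<alpha> * (p - 1))"
proof (cases "\<nu> = 1")
  case True
  define \<alpha> where "\<alpha> = min (1 / 4) (1 / (2 * (p - 1)))"
  define y where "y = p - 1"
  have y: "0 < y" using p_gt_1 by (simp add: y_def)
  have "\<alpha> * y \<le> 1 / (2 * y) * y"
    using y by (intro mult_right_mono) (auto simp: \<alpha>_def y_def)
  also have "\<dots> = 1 / 2" using y by simp
  finally have "\<alpha> * (p - 1) \<le> 1 / 2" by (simp only: y_def)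
  moreover have "0 < \<alpha>" "\<alpha> \<le> 1 / 4" using p_gt_1 by (auto simp: \<alpha>_def)
  ultimately show ?thesis using that[of \<alpha>] True b by auto
next
  case False
  then have \<nu>1: "1 < \<nu>" using \<nu> by simp
  have "p * (\<nu> - 1) < \<nu> + 1 + b" using subcritical[OF \<nu>1] \<nu>1 by (simp add: field_simps)
  then have 1: "(\<nu> - 1) / 2 * (p - 1) < 1 + b / 2" by (simp add: field_simps)
  define y where "y = min 1 (1 + b / 2 - (\<nu> - 1) / 2 * (p - 1))"
  have y: "0 < y" using 1 by (simp add: y_def)
  show ?thesis
  proof (rule that[OF _ _ 1])
    show "0 < (\<nu> - 1) / 2" "\<nu> - 1 \<le> 2 * ((\<nu> - 1) / 2)" using \<nu>1 by simp_all
    have "(\<nu> - 1) / 2 < \<nu> - 1 + y" using y \<nu>1 by (simp add: field_simps)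
    then show "(\<nu> - 1) / 2 < \<nu> - 1 + min 1 (1 + b / 2 - (\<nu> - 1) / 2 * (p - 1))" by (simp only: y_def)
  qed
qed

lemma bounded_near_0:
  "\<exists>M\<ge>0. \<forall>t. 0 < t \<longrightarrow> t \<le> 1 \<longrightarrow> cmod (W t) \<le> M"
proof -
  obtain \<alpha> where \<alpha>: "0 < \<alpha>" "\<nu> - 1 \<le> 2 * \<alpha>" "\<alpha> * (p - 1) < 1 + b / 2" "\<alpha> < \<nu> - 1 + min 1 (1 + b / 2 - \<alpha> * (p - 1))"
    by (rule exponent_exists)
  define \<delta> where "\<delta> = min 1 (1 + b / 2 - \<alpha> * (p - 1))"
  have \<delta>: "0 < \<delta>" "\<delta> \<le> 1" "\<alpha> < \<nu> - 1 + \<delta>" using \<alpha> by (auto simp: \<delta>_def)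
  obtain C where C: "0 \<le> C" "\<And>t. 0 < t \<Longrightarrow> t \<le> 1 \<Longrightarrow> cmod (W t) \<le> C * t powr (- \<alpha>)"
    using initial_bound[OF \<alpha>(1,2)] by blast
  have Vle: "V s \<le> C powr (p - 1) * s powr (\<delta> - 1)" if s: "0 < s" "s \<le> 1" for s
  proof -
    have "cmod (W s) powr (p - 1) \<le> (C * s powr (- \<alpha>)) powr (p - 1)"
      using C(2)[OF s] p_gt_1 by (intro powr_mono2) auto
    also have "\<dots> = C powr (p - 1) * s powr (- \<alpha> * (p - 1))"
      using C(1) by (simp add: powr_mult powr_powr)
    finally have "V s \<le> s powr (b / 2) * (C powr (p - 1) * s powr (- \<alpha> * (p - 1)))"
      unfolding V_def by (intro mult_left_mono) auto
    also have "\<dots> = C powr (p - 1) * s powr (b / 2 - \<alpha> * (p - 1))"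
      by (simp add: powr_add[symmetric])
    also have "\<dots> \<le> C powr (p - 1) * s powr (\<delta> - 1)"
      using s by (intro mult_left_mono powr_mono') (auto simp: \<delta>_def)
    finally show ?thesis .
  qed
  obtain M where M: "\<And>t. 0 < t \<Longrightarrow> t \<le> 1 \<Longrightarrow> cmod (W t) \<le> M"
    using bounded_near_0_bootstrap[OF \<alpha>(1) \<delta> powr_ge_zero Vle C] by blast
  have "0 \<le> M" using M[of 1] norm_ge_zero[of "W 1"] by linarith
  then show ?thesis using M by blast
qed

lemma V_tendsto_0: "(V \<longlongrightarrow> 0) (at_right 0)"
proof -
  obtain M where M: "0 \<le> M" "\<And>t. 0 < t \<Longrightarrow> t \<le> 1 \<Longrightarrow> cmod (W t) \<le> M" using bounded_near_0 by blast
  have Vb: "V t \<le> t powr (b / 2) * M powr (p - 1)" if "0 < t" "t \<le> 1" for t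
    unfolding V_def using M(2)[OF that] p_gt_1 by (intro mult_left_mono powr_mono2) auto
  show ?thesis
  proof (rule tendsto_sandwich[of "\<lambda>_. 0" _ _ "\<lambda>t. t powr (b / 2) * M powr (p - 1)"])
    show "\<forall>\<^sub>F t in at_right 0. V t \<le> t powr (b / 2) * M powr (p - 1)"
      using eventually_at_right_real[OF zero_less_one] by eventually_elim (simp add: Vb)
    have "((\<lambda>t::real. t powr (b / 2)) \<longlongrightarrow> 0 powr (b / 2)) (at_right 0)"
    proof (rule tendsto_powr'[OF tendsto_ident_at tendsto_const])
      have "\<forall>\<^sub>F t in at_right (0::real). 0 \<le> t" by (simp add: eventually_at_filter)
      then show "(0::real) \<noteq> 0 \<or> 0 < b / 2 \<and> (\<forall>\<^sub>F t in at_right (0::real). 0 \<le> t)"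
        using b by simp
    qed
    then have "((\<lambda>t::real. t powr (b / 2) * M powr (p - 1)) \<longlongrightarrow> 0 powr (b / 2) * M powr (p - 1)) (at_right 0)"
      by (rule tendsto_mult[OF _ tendsto_const])
    then show "((\<lambda>t::real. t powr (b / 2) * M powr (p - 1)) \<longlongrightarrow> 0) (at_right 0)" by simp
  qed (auto simp: V_nonneg)
qed

lemma W'_bounded_near_0:
  "\<exists>B. \<forall>t. 0 < t \<longrightarrow> t \<le> 1 \<longrightarrow> cmod (W' t) \<le> B"
proof -
  obtain M where M: "0 \<le> M" "\<And>t. 0 < t \<Longrightarrow> t \<le> 1 \<Longrightarrow> cmod (W t) \<le> M" using bounded_near_0 by blast
  have Vb: "V t \<le> t powr (b / 2) * M powr (p - 1)" if "0 < t" "t \<le> 1" for t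
    unfolding V_def using M(2)[OF that] p_gt_1 by (intro mult_left_mono powr_mono2) auto
  define Q where "Q = (1 + M powr (p - 1)) * M"
  have HQ: "cmod (H s - 0) \<le> Q * s powr 0" if s: "0 < s" "s \<le> 1" for s
  proof -
    have "s powr (b / 2) \<le> s powr 0" using s b by (intro powr_mono') auto
    then have "s powr (b / 2) * M powr (p - 1) \<le> 1 * M powr (p - 1)" using s by (intro mult_right_mono) auto
    then have "V s \<le> M powr (p - 1)" using Vb[OF s] by linarith
    then have "\<bar>1 - V s\<bar> \<le> 1 + M powr (p - 1)" using V_nonneg[of s] by (simp add: abs_if)
    then have "\<bar>1 - V s\<bar> * cmod (W s) \<le> Q" unfolding Q_def using M(2)[OF s] by (intro mult_mono) auto
    then show ?thesis using s by (simp add: H_def)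
  qed
  define B where "B = Q / (4 * \<nu>)"
  have B: "cmod (W' s) \<le> B" if s: "0 < s" "s \<le> 1" for s
    using W'_bound[of s 0 0 Q] s \<nu> HQ by (simp add: B_def)
  then show ?thesis by blast
qed

lemma W_limit_at_0:
  obtains L where "(W \<longlongrightarrow> L) (at_right 0)"
proof -
  obtain B where B: "\<And>t. 0 < t \<Longrightarrow> t \<le> 1 \<Longrightarrow> cmod (W' t) \<le> B"
    using W'_bounded_near_0 by blast
  have lip: "cmod (W x - W y) \<le> B * \<bar>x - y\<bar>" if "0 < y" "y \<le> x" "x \<le> 1" for x y
  proof -
    have "cmod (W x - W y) \<le> integral {y..x} (\<lambda>_. B)"
      using that by (intro W_diff_bound B) auto
    then show ?thesis using that by (simp add: mult.commute)
  qed
  have "uniformly_continuous_on {0<..1} W"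
    unfolding uniformly_continuous_on_def
  proof (intro allI impI)
    fix e :: real assume e: "0 < e"
    have B0: "0 \<le> B" using B[of 1] norm_ge_zero[of "W' 1"] by linarith
    show "\<exists>d>0. \<forall>x\<in>{0<..1}. \<forall>x'\<in>{0<..1}. dist x' x < d \<longrightarrow> dist (W x') (W x) < e"
    proof (intro exI[of _ "e / (B + 1)"] conjI ballI impI)
      show "0 < e / (B + 1)" using e B0 by simp
      fix x x' :: real assume x: "x \<in> {0<..1}" "x' \<in> {0<..1}" "dist x' x < e / (B + 1)"
      have "cmod (W x' - W x) \<le> B * \<bar>x' - x\<bar>"
      proof (cases "x \<le> x'")
        case True
        then show ?thesis using lip[of x x'] x by simp
      next
        case False
        then show ?thesis using lip[of x' x] x by (simp add: norm_minus_commute abs_minus_commute)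
      qed
      also have "\<dots> \<le> (B + 1) * \<bar>x' - x\<bar>" by (intro mult_right_mono) auto
      also have "\<dots> < e" using x(3) B0 by (simp add: dist_real_def field_simps)
      finally show "dist (W x') (W x) < e" by (simp add: dist_norm)
    qed
  qed
  moreover have "(0::real) \<in> closure {0<..1}" by simp
  ultimately obtain L where "(W \<longlongrightarrow> L) (at 0 within {0<..1})"
    by (rule uniformly_continuous_on_extension_at_closure)
  moreover have "at 0 within {0<..1::real} = at_right 0"
    by (rule at_within_nhd[of _ "{..<1}"]) auto
  ultimately have "(W \<longlongrightarrow> L) (at_right 0)" by simp
  then show ?thesis by (rule that)
qed

text \<open>These are the facts that make \<open>W (x \<bullet> x)\<close> twice continuously differentiable at the origin: \<open>W\<close>
  need not have a second derivative at \<open>t = 0\<close>, but in the Hessian \<open>W''\<close> only occurs with a factor of size \<open>t\<close>.\<close>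

lemma limits_at_0:
  obtains L where "(W \<longlongrightarrow> L) (at_right 0)" "(W' \<longlongrightarrow> (1 / (4 * \<nu>)) *\<^sub>R L) (at_right 0)"
    "((\<lambda>t. t *\<^sub>R W'' t) \<longlongrightarrow> 0) (at_right 0)"
proof -
  obtain L where WL: "(W \<longlongrightarrow> L) (at_right 0)" by (rule W_limit_at_0)
  have "((\<lambda>t. (1 - V t) *\<^sub>R W t) \<longlongrightarrow> (1 - 0) *\<^sub>R L) (at_right 0)" by (intro tendsto_intros V_tendsto_0 WL)
  then have HL: "(H \<longlongrightarrow> L) (at_right 0)" unfolding H_def by simp
  have W'L: "(W' \<longlongrightarrow> (1 / (4 * \<nu>)) *\<^sub>R L) (at_right 0)"
  proof (rule tendstoI)
    fix e :: real assume e: "0 < e"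
    have "\<forall>\<^sub>F s in at_right 0. dist (H s) L < e" using HL e by (rule tendstoD)
    then obtain d where d: "0 < d" "\<And>s. 0 < s \<Longrightarrow> s < d \<Longrightarrow> dist (H s) L < e"
      unfolding eventually_at_right[OF zero_less_one] by auto
    have "dist (W' t) ((1 / (4 * \<nu>)) *\<^sub>R L) < e" if t: "0 < t" "t < d" for t
    proof -
      have "cmod (W' t - (1 / (4 * \<nu>)) *\<^sub>R L) \<le> e / (4 * (\<nu> + 0)) * t powr 0"
        using t d(2) \<nu> by (intro W'_bound) (auto simp: dist_norm intro: less_imp_le)
      also have "\<dots> < e" using e \<nu> t by (simp add: field_simps)
      finally show ?thesis by (simp add: dist_norm)
    qed
    then show "\<forall>\<^sub>F t in at_right 0. dist (W' t) ((1 / (4 * \<nu>)) *\<^sub>R L) < e"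
      unfolding eventually_at_right[OF zero_less_one] using d(1) by auto
  qed
  have "((\<lambda>t. (1 / 4) *\<^sub>R (H t - (4 * \<nu>) *\<^sub>R W' t)) \<longlongrightarrow> (1 / 4) *\<^sub>R (L - (4 * \<nu>) *\<^sub>R ((1 / (4 * \<nu>)) *\<^sub>R L))) (at_right 0)"
    by (intro tendsto_intros HL W'L)
  then have "((\<lambda>t. (1 / 4) *\<^sub>R (H t - (4 * \<nu>) *\<^sub>R W' t)) \<longlongrightarrow> 0) (at_right 0)"
    using \<nu> by simp
  then have "((\<lambda>t. t *\<^sub>R W'' t) \<longlongrightarrow> 0) (at_right 0)"
  proof (rule Lim_transform_eventually)
    show "\<forall>\<^sub>F t in at_right 0. (1 / 4) *\<^sub>R (H t - (4 * \<nu>) *\<^sub>R W' t) = t *\<^sub>R W'' t"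
      by (auto simp: W''_def eventually_at_filter)
  qed
  with WL W'L show ?thesis by (rule that)
qed

end

section \<open>Exponential decay of the profile\<close>

context radial_ode
begin

text \<open>The energy density, whose integrals over compact subintervals of the open half-line are at most \<open>2 K\<close>.\<close>

definition D :: "real \<Rightarrow> real" where
  "D t = t powr \<nu> * (cmod (W' t))\<^sup>2 + t powr (\<nu> - 1) * (cmod (W t))\<^sup>2"

lemma D_nonneg: "0 \<le> D t"
  by (simp add: D_def)

lemma D_has_integral:
  assumes "0 < a" "a < c"
  obtains I where "(D has_integral I) {a..c}" "I \<le> 2 * K"
proof -
  have 1: "(\<lambda>t. t powr \<nu> * (cmod (W' t))\<^sup>2) integrable_on {a..c}"
    by (intro integrable_continuous_interval continuous_on_mult continuous_on_power continuous_on_norm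
        continuous_on_powr continuous_on_id continuous_on_const continuous_on_subset[OF W'_continuous])
      (use assms in auto)
  have 2: "(\<lambda>t. t powr (\<nu> - 1) * (cmod (W t))\<^sup>2) integrable_on {a..c}"
    by (intro integrable_continuous_interval continuous_on_mult continuous_on_power continuous_on_norm
        continuous_on_powr continuous_on_id continuous_on_const continuous_on_subset[OF W_continuous])
      (use assms in auto)
  have "(D has_integral (integral {a..c} (\<lambda>t. t powr \<nu> * (cmod (W' t))\<^sup>2) + integral {a..c} (\<lambda>t. t powr (\<nu> - 1) * (cmod (W t))\<^sup>2))) {a..c}"
    unfolding D_def by (rule has_integral_add[OF integrable_integral[OF 1] integrable_integral[OF 2]])
  moreover have "integral {a..c} (\<lambda>t. t powr \<nu> * (cmod (W' t))\<^sup>2) + integral {a..c} (\<lambda>t. t powr (\<nu> - 1) * (cmod (W t))\<^sup>2) \<le> 2 * K"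
    using energy'[OF assms] energy[OF assms] by simp
  ultimately show ?thesis by (rule that)
qed

lemma inner_has_derivative:
  fixes f g :: "real \<Rightarrow> complex"
  assumes "(f has_vector_derivative f') (at t)" "(g has_vector_derivative g') (at t)"
  shows "((\<lambda>t. f t \<bullet> g t) has_real_derivative (f t \<bullet> g' + f' \<bullet> g t)) (at t)"
  using bounded_bilinear.has_vector_derivative[OF bounded_bilinear_inner assms]
  by (simp add: has_real_derivative_iff_has_vector_derivative)

lemma W_square_deriv: "0 < t \<Longrightarrow> ((\<lambda>t. (cmod (W t))\<^sup>2) has_real_derivative 2 * (W t \<bullet> W' t)) (at t)"
  using inner_has_derivative[OF W_deriv W_deriv, of t] by (simp add: power2_norm_eq_inner inner_commute)

lemma W'_square_deriv: "0 < t \<Longrightarrow> ((\<lambda>t. (cmod (W' t))\<^sup>2) has_real_derivative 2 * (W' t \<bullet> W'' t)) (at t)"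
  using inner_has_derivative[OF W'_deriv W'_deriv, of t] by (simp add: power2_norm_eq_inner inner_commute)

lemma cross_term_le_D:
  assumes "0 < t"
  shows "2 * (t powr (\<nu> - 1 / 2) * (cmod (W t) * cmod (W' t))) \<le> D t"
proof -
  define x where "x = t powr ((\<nu> - 1) / 2) * cmod (W t)"
  define y where "y = t powr (\<nu> / 2) * cmod (W' t)"
  have e: "t powr ((\<nu> - 1) / 2) * t powr (\<nu> / 2) = t powr (\<nu> - 1 / 2)"
    unfolding powr_add[symmetric] by (simp add: field_simps)
  have s: "(t powr ((\<nu> - 1) / 2))\<^sup>2 = t powr (\<nu> - 1)" "(t powr (\<nu> / 2))\<^sup>2 = t powr \<nu>"
    unfolding power2_eq_square powr_add[symmetric] by simp_all
  have "x * y = t powr (\<nu> - 1 / 2) * (cmod (W t) * cmod (W' t))"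
    unfolding x_def y_def e[symmetric] by simp
  moreover have "x\<^sup>2 + y\<^sup>2 = D t"
    by (simp add: x_def y_def D_def power_mult_distrib s)
  ultimately show ?thesis using sum_squares_bound[of x y] by simp
qed

text \<open>The function \<open>t\<^bsup>-1/2\<^esup>\<close> is not integrable at infinity.\<close>

lemma D_not_bounded_below:
  assumes "0 < c" "1 \<le> t0" "\<And>t. t0 \<le> t \<Longrightarrow> c * t powr (- 1 / 2) \<le> D t"
  shows False
proof -
  \<comment> \<open>Up to \<open>T = z\<^sup>2\<close> the lower bound integrates to \<open>2 (|K| + 1)\<close>, more than the energy allows.\<close>
  define z where "z = t0 powr (1 / 2) + (\<bar>K\<bar> + 1) / c"
  have tz: "1 \<le> t0 powr (1 / 2)" using assms by (intro ge_one_powr_ge_zero) auto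
  have d: "0 < (\<bar>K\<bar> + 1) / c" using assms by simp
  have z: "t0 powr (1 / 2) < z" "0 < z" using tz d unfolding z_def by linarith+
  define T where "T = z powr 2"
  have Tz: "T powr (1 / 2) = z" using z by (simp add: T_def powr_powr)
  have "t0 = (t0 powr (1 / 2)) powr 2" using assms by (simp add: powr_powr)
  also have "\<dots> < T" unfolding T_def using z by (intro powr_less_mono2) auto
  finally have T: "t0 < T" .
  obtain I where I: "(D has_integral I) {t0..T}" "I \<le> 2 * K"
    by (rule D_has_integral[of t0 T]) (use assms T in auto)
  have "((\<lambda>t. t powr (1 / 2 - 1)) has_integral ((T powr (1 / 2) - t0 powr (1 / 2)) / (1 / 2))) {t0..T}"
    using assms T by (intro has_integral_powr_interval) auto
  then have "((\<lambda>t. c * t powr (1 / 2 - 1)) has_integral c * ((T powr (1 / 2) - t0 powr (1 / 2)) / (1 / 2))) {t0..T}"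
    by (rule has_integral_mult_right)
  then have "c * ((T powr (1 / 2) - t0 powr (1 / 2)) / (1 / 2)) \<le> I"
    by (rule has_integral_le[OF _ I(1)]) (use assms(3) in auto)
  moreover have "c * ((T powr (1 / 2) - t0 powr (1 / 2)) / (1 / 2)) = 2 * (\<bar>K\<bar> + 1)"
    unfolding Tz z_def using assms(1) by simp
  ultimately have "2 * (\<bar>K\<bar> + 1) \<le> I" by simp
  also note I(2)
  finally have "\<bar>K\<bar> + 1 \<le> K" by simp
  then show False using abs_ge_self[of K] by simp
qed

text \<open>The radial lemma of Strauss: the derivative of \<open>t\<^bsup>\<nu>-1/2\<^esup> |W|\<^sup>2\<close> is at most a multiple of the energy
  density for \<open>t \<ge> 1\<close>.\<close>

lemma strauss_bound:
  "\<exists>C\<ge>0. \<forall>t\<ge>1. (cmod (W t))\<^sup>2 \<le> C * t powr (- (\<nu> - 1 / 2))"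
proof -
  define S where "S t = t powr (\<nu> - 1 / 2) * (cmod (W t))\<^sup>2" for t
  define C where "C = \<bar>S 1\<bar> + (\<nu> + 1 / 2) * (2 * \<bar>K\<bar>)"
  have "S t \<le> C" if t: "1 \<le> t" for t
  proof (cases "t = 1")
    case True
    have "0 \<le> (\<nu> + 1 / 2) * (2 * \<bar>K\<bar>)" using \<nu> by (intro mult_nonneg_nonneg) auto
    then have "S 1 + 0 \<le> C" unfolding C_def by (intro add_mono abs_ge_self)
    then show ?thesis using True by simp
  next
    case False
    then have t1: "1 < t" using t by simp
    define S' where "S' s = ((\<nu> - 1 / 2) * s powr (\<nu> - 1 / 2 - 1)) * (cmod (W s))\<^sup>2 + 2 * (W s \<bullet> W' s) * s powr (\<nu> - 1 / 2)" for s
    have i: "(S' has_integral (S t - S 1)) {1..t}"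
    proof (rule fundamental_theorem_of_calculus[OF t])
      fix s assume s: "s \<in> {1..t}"
      then have s0: "0 < s" by simp
      have "((\<lambda>s. s powr (\<nu> - 1 / 2)) has_real_derivative ((\<nu> - 1 / 2) * s powr (\<nu> - 1 / 2 - 1))) (at s)"
        using s0 by (rule has_real_derivative_powr)
      from DERIV_mult[OF this W_square_deriv[OF s0]]
      have "(S has_real_derivative S' s) (at s)" unfolding S_def S'_def .
      then show "(S has_vector_derivative S' s) (at s within {1..t})"
        unfolding has_real_derivative_iff_has_vector_derivative by (rule has_vector_derivative_at_within)
    qed
    obtain I where I: "(D has_integral I) {1..t}" "I \<le> 2 * K"
      by (rule D_has_integral[of 1 t]) (use t1 in auto)
    have "S t - S 1 \<le> (\<nu> + 1 / 2) * I"
    proof (rule has_integral_le[OF i has_integral_mult_right[OF I(1)]])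
      fix s assume s: "s \<in> {1..t}"
      have "s powr (\<nu> - 1 / 2 - 1) \<le> s powr (\<nu> - 1)" using s by (intro powr_mono) auto
      then have "s powr (\<nu> - 1 / 2 - 1) * (cmod (W s))\<^sup>2 \<le> s powr (\<nu> - 1) * (cmod (W s))\<^sup>2" by (rule mult_right_mono) simp
      also have "\<dots> \<le> D s" by (simp add: D_def)
      finally have 1: "(\<nu> - 1 / 2) * (s powr (\<nu> - 1 / 2 - 1) * (cmod (W s))\<^sup>2) \<le> (\<nu> - 1 / 2) * D s"
        using \<nu> by (intro mult_left_mono) auto
      have "W s \<bullet> W' s \<le> cmod (W s) * cmod (W' s)" by (rule norm_cauchy_schwarz)
      then have "s powr (\<nu> - 1 / 2) * (W s \<bullet> W' s) \<le> s powr (\<nu> - 1 / 2) * (cmod (W s) * cmod (W' s))"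
        by (rule mult_left_mono) simp
      moreover have "2 * (s powr (\<nu> - 1 / 2) * (cmod (W s) * cmod (W' s))) \<le> D s"
        using s by (intro cross_term_le_D) simp
      ultimately have 2: "2 * (s powr (\<nu> - 1 / 2) * (W s \<bullet> W' s)) \<le> D s" by linarith
      have "S' s = (\<nu> - 1 / 2) * (s powr (\<nu> - 1 / 2 - 1) * (cmod (W s))\<^sup>2) + 2 * (s powr (\<nu> - 1 / 2) * (W s \<bullet> W' s))"
        by (simp add: S'_def)
      also have "\<dots> \<le> (\<nu> - 1 / 2) * D s + D s" using 1 2 by linarith
      also have "\<dots> = (\<nu> + 1 / 2) * D s" by (simp add: algebra_simps)
      finally show "S' s \<le> (\<nu> + 1 / 2) * D s" .
    qed
    also have "\<dots> \<le> (\<nu> + 1 / 2) * (2 * \<bar>K\<bar>)" using I(2) \<nu> by (intro mult_left_mono) auto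
    finally show ?thesis by (simp add: C_def)
  qed
  then have "(cmod (W t))\<^sup>2 \<le> C * t powr (- (\<nu> - 1 / 2))" if "1 \<le> t" for t
    using that[THEN \<open>\<And>t. 1 \<le> t \<Longrightarrow> S t \<le> C\<close>] that
    unfolding S_def powr_minus by (simp add: field_simps)
  moreover have "0 \<le> C" using \<nu> by (simp add: C_def)
  ultimately show ?thesis by blast
qed

text \<open>The lower bound on \<open>p\<close> is what makes the exponent \<open>b / 2 - (\<nu> - 1 / 2) (p - 1) / 2\<close> negative.\<close>

lemma V_tendsto_0_at_top: "(V \<longlongrightarrow> 0) at_top"
proof -
  obtain C where C: "0 \<le> C" "\<And>t. 1 \<le> t \<Longrightarrow> (cmod (W t))\<^sup>2 \<le> C * t powr (- (\<nu> - 1 / 2))"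
    using strauss_bound by blast
  define a where "a = - (\<nu> - 1 / 2) / 2"
  define e where "e = b / 2 + a * (p - 1)"
  have "2 * b < (p - 1) * (2 * \<nu> - 1)" using p \<nu> by (simp add: field_simps)
  moreover have "e = (2 * b - (p - 1) * (2 * \<nu> - 1)) / 4" by (simp add: e_def a_def field_simps)
  ultimately have e: "e < 0" by simp
  have Vle: "V t \<le> sqrt C powr (p - 1) * t powr e" if t: "1 \<le> t" for t
  proof -
    have "(sqrt C * t powr a)\<^sup>2 = C * (t powr a * t powr a)"
      by (simp only: power_mult_distrib real_sqrt_pow2[OF C(1)] power2_eq_square[of "t powr a"])
    also have "t powr a * t powr a = t powr (- (\<nu> - 1 / 2))"
      unfolding powr_add[symmetric] by (simp add: a_def)
    finally have "(cmod (W t))\<^sup>2 \<le> (sqrt C * t powr a)\<^sup>2" using C(2)[OF t] by simp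
    then have "cmod (W t) \<le> sqrt C * t powr a"
      by (rule power2_le_imp_le) (use C(1) in simp)
    then have "cmod (W t) powr (p - 1) \<le> (sqrt C * t powr a) powr (p - 1)"
      by (intro powr_mono2) (use p_gt_1 in auto)
    also have "\<dots> = sqrt C powr (p - 1) * t powr (a * (p - 1))"
      using C(1) by (simp add: powr_mult powr_powr)
    finally have "V t \<le> t powr (b / 2) * (sqrt C powr (p - 1) * t powr (a * (p - 1)))"
      unfolding V_def by (rule mult_left_mono) simp
    also have "\<dots> = sqrt C powr (p - 1) * (t powr (b / 2) * t powr (a * (p - 1)))" by simp
    also have "t powr (b / 2) * t powr (a * (p - 1)) = t powr e"
      unfolding powr_add[symmetric] e_def ..
    finally show ?thesis .
  qed
  show ?thesis
  proof (rule tendsto_sandwich[of "\<lambda>_. 0" _ _ "\<lambda>t. sqrt C powr (p - 1) * t powr e"])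
    show "\<forall>\<^sub>F t in at_top. V t \<le> sqrt C powr (p - 1) * t powr e"
      using eventually_ge_at_top[of 1] by eventually_elim (rule Vle)
    have "((\<lambda>t. t powr e) \<longlongrightarrow> 0) at_top"
      by (rule tendsto_neg_powr[OF e filterlim_ident])
    from tendsto_mult[OF tendsto_const this, of "sqrt C powr (p - 1)"]
    show "((\<lambda>t. sqrt C powr (p - 1) * t powr e) \<longlongrightarrow> 0) at_top" by simp
  qed (auto simp: V_nonneg)
qed

text \<open>Up to a factor, the boundary term that appears when the equation is multiplied by the conjugate of \<open>W\<close>
  and integrated from \<open>t\<close> to infinity.\<close>

definition q :: "real \<Rightarrow> real" where "q t = - (t powr \<nu> * (W t \<bullet> W' t))"

lemma inner_W'':
  assumes "0 < t"
  shows "t * (x \<bullet> W'' t) = (1 - V t) / 4 * (x \<bullet> W t) - \<nu> * (x \<bullet> W' t)"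
proof -
  have "t *\<^sub>R W'' t = ((1 - V t) / 4) *\<^sub>R W t - \<nu> *\<^sub>R W' t"
    using assms by (simp add: W''_def H_def scaleR_diff_right)
  then have "x \<bullet> (t *\<^sub>R W'' t) = x \<bullet> (((1 - V t) / 4) *\<^sub>R W t - \<nu> *\<^sub>R W' t)" by (rule arg_cong)
  then show ?thesis by (simp only: inner_scaleR_right inner_diff_right)
qed

lemma q_deriv:
  assumes t: "0 < t"
  shows "(q has_real_derivative - (t powr \<nu> * (cmod (W' t))\<^sup>2 + t powr (\<nu> - 1) * ((1 - V t) / 4 * (cmod (W t))\<^sup>2))) (at t)"
proof -
  have 1: "((\<lambda>t. t powr \<nu>) has_real_derivative \<nu> * t powr (\<nu> - 1)) (at t)"
    using t by (rule has_real_derivative_powr)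
  have 2: "((\<lambda>t. W t \<bullet> W' t) has_real_derivative (W t \<bullet> W'' t + W' t \<bullet> W' t)) (at t)"
    by (rule inner_has_derivative[OF W_deriv[OF t] W'_deriv[OF t]])
  have "(q has_real_derivative - (\<nu> * t powr (\<nu> - 1) * (W t \<bullet> W' t) + (W t \<bullet> W'' t + W' t \<bullet> W' t) * t powr \<nu>)) (at t)"
    unfolding q_def by (rule DERIV_minus[OF DERIV_mult[OF 1 2]])
  moreover have "\<nu> * t powr (\<nu> - 1) * (W t \<bullet> W' t) + (W t \<bullet> W'' t + W' t \<bullet> W' t) * t powr \<nu> =
     t powr \<nu> * (cmod (W' t))\<^sup>2 + t powr (\<nu> - 1) * ((1 - V t) / 4 * (cmod (W t))\<^sup>2)"
  proof -
    have tn: "t powr \<nu> = t * t powr (\<nu> - 1)" using t by (simp add: powr_diff)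
    have W'': "t * (W t \<bullet> W'' t) = (1 - V t) / 4 * (cmod (W t))\<^sup>2 - \<nu> * (W t \<bullet> W' t)"
      unfolding inner_W''[OF t] power2_norm_eq_inner ..
    have "(W t \<bullet> W'' t) * t powr \<nu> = t powr (\<nu> - 1) * (t * (W t \<bullet> W'' t))" unfolding tn by simp
    then have "(W t \<bullet> W'' t) * t powr \<nu> = t powr (\<nu> - 1) * ((1 - V t) / 4 * (cmod (W t))\<^sup>2) - \<nu> * t powr (\<nu> - 1) * (W t \<bullet> W' t)"
      unfolding W'' by (simp add: right_diff_distrib)
    then show ?thesis by (simp add: distrib_right power2_norm_eq_inner)
  qed
  ultimately show ?thesis by simp
qed

lemma q_abs_le:
  assumes t: "0 < t"
  shows "\<bar>q t\<bar> \<le> t powr (1 / 2) * D t"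
proof -
  have "\<bar>q t\<bar> \<le> t powr \<nu> * (cmod (W t) * cmod (W' t))"
    unfolding q_def abs_minus_cancel abs_mult using Cauchy_Schwarz_ineq2[of "W t" "W' t"] by (simp add: mult_left_mono)
  also have "t powr \<nu> = t powr (1 / 2) * t powr (\<nu> - 1 / 2)"
    unfolding powr_add[symmetric] by simp
  also have "t powr (1 / 2) * t powr (\<nu> - 1 / 2) * (cmod (W t) * cmod (W' t)) =
    t powr (1 / 2) * (t powr (\<nu> - 1 / 2) * (cmod (W t) * cmod (W' t)))" by simp
  also have "\<dots> \<le> t powr (1 / 2) * D t"
  proof (rule mult_left_mono)
    have "0 \<le> t powr (\<nu> - 1 / 2) * (cmod (W t) * cmod (W' t))" by simp
    then show "t powr (\<nu> - 1 / 2) * (cmod (W t) * cmod (W' t)) \<le> D t"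
      using cross_term_le_D[OF t] by linarith
  qed simp
  finally show ?thesis .
qed

text \<open>Once \<open>V \<le> 1 / 2\<close>, the energy identity gives \<open>q' \<le> - D / 8\<close>, while \<open>|q| \<le> t\<^bsup>1/2\<^esup> D\<close>.  A negative
  value of \<open>q\<close> would persist and keep \<open>t\<^bsup>1/2\<^esup> D\<close> away from \<open>0\<close>, against the finite energy; so \<open>q \<ge> 0\<close>, and
  then \<open>q' \<le> - q / (8 t\<^bsup>1/2\<^esup>)\<close> forces \<open>q\<close> to decay like \<open>exp (- (sqrt t / 4))\<close>.  Finally \<open>z = t |W'|\<^sup>2 + |W|\<^sup>2\<close>
  changes at a rate of at most a multiple of \<open>D\<close>, so \<open>z - B q\<close> increases for large \<open>B\<close>; a positive value
  would again contradict the finite energy, whence \<open>z \<le> B q\<close>.\<close>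

lemma exponential_decay:
  "\<exists>A\<ge>0. \<exists>R\<ge>1. \<forall>t\<ge>R. t * (cmod (W' t))\<^sup>2 + (cmod (W t))\<^sup>2 \<le> A * exp (- (sqrt t / 4))"
proof -
  have "\<forall>\<^sub>F t in at_top. V t < 1 / 2"
    using V_tendsto_0_at_top by (rule order_tendstoD) simp
  then obtain R0 where R0: "\<And>t. R0 \<le> t \<Longrightarrow> V t < 1 / 2" by (auto simp: eventually_at_top_linorder)
  define R where "R = max 1 R0"
  have R: "1 \<le> R" and VR: "\<And>t. R \<le> t \<Longrightarrow> V t < 1 / 2" using R0 by (auto simp: R_def)
  define q' where "q' t = - (t powr \<nu> * (cmod (W' t))\<^sup>2 + t powr (\<nu> - 1) * ((1 - V t) / 4 * (cmod (W t))\<^sup>2))" for t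
  have qd: "(q has_real_derivative q' t) (at t)" if "R \<le> t" for t
    unfolding q'_def using that R by (intro q_deriv) simp
  have q'D: "q' t \<le> - D t / 8" if "R \<le> t" for t
  proof -
    have "t powr (\<nu> - 1) * (cmod (W t))\<^sup>2 * (1 / 8) \<le> t powr (\<nu> - 1) * (cmod (W t))\<^sup>2 * ((1 - V t) / 4)"
      using VR[OF that] by (intro mult_left_mono) auto
    moreover have "t powr (\<nu> - 1) * ((1 - V t) / 4 * (cmod (W t))\<^sup>2) = t powr (\<nu> - 1) * (cmod (W t))\<^sup>2 * ((1 - V t) / 4)"
      by simp
    moreover have "0 \<le> t powr \<nu> * (cmod (W' t))\<^sup>2" by simp
    moreover have "0 \<le> X \<Longrightarrow> Y * (1 / 8) \<le> P \<Longrightarrow> - (X + P) \<le> - (X + Y) / 8" for X Y P :: real by simp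
    ultimately show ?thesis unfolding q'_def D_def by presburger
  qed
  have q_dec: "q t \<le> q s" if "R \<le> s" "s \<le> t" for s t
  proof (rule DERIV_nonpos_imp_nonincreasing[OF that(2)])
    fix x assume "s \<le> x" "x \<le> t"
    then have x: "R \<le> x" using that by simp
    show "\<exists>y. (q has_real_derivative y) (at x) \<and> y \<le> 0"
      using qd[OF x] q'D[OF x] D_nonneg[of x] by (intro exI[of _ "q' x"]) auto
  qed
  have q_nonneg: "0 \<le> q t" if t: "R \<le> t" for t
  proof (rule ccontr)
    assume "\<not> 0 \<le> q t"
    then have c: "0 < - q t" by simp
    show False
    proof (rule D_not_bounded_below[OF c, of t])
      show "1 \<le> t" using R t by simp
      fix s assume s: "t \<le> s"
      then have s0: "0 < s" using R t by simp
      have "- q t \<le> \<bar>q s\<bar>" using q_dec[OF t s] by linarith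
      also have "\<dots> \<le> s powr (1 / 2) * D s" by (rule q_abs_le[OF s0])
      finally have "- q t * s powr (- 1 / 2) \<le> (s powr (1 / 2) * D s) * s powr (- 1 / 2)"
        by (rule mult_right_mono) simp
      also have "\<dots> = (s powr (1 / 2) * s powr (- 1 / 2)) * D s" by simp
      also have "s powr (1 / 2) * s powr (- 1 / 2) = 1" unfolding powr_add[symmetric] using s0 by simp
      finally show "- q t * s powr (- 1 / 2) \<le> D s" by simp
    qed
  qed
  have q_exp: "q t * exp (sqrt t / 4) \<le> q R * exp (sqrt R / 4)" if t: "R \<le> t" for t
  proof (rule DERIV_nonpos_imp_nonincreasing[OF t])
    fix x assume "R \<le> x"
    then have x: "R \<le> x" "0 < x" using R by auto
    have "((\<lambda>x. exp (sqrt x / 4)) has_real_derivative exp (sqrt x / 4) * (inverse (sqrt x) / 8)) (at x)"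
      using x(2) by (auto intro!: derivative_eq_intros)
    from DERIV_mult[OF qd[OF x(1)] this]
    have d: "((\<lambda>t. q t * exp (sqrt t / 4)) has_real_derivative
       (q' x * exp (sqrt x / 4) + exp (sqrt x / 4) * (inverse (sqrt x) / 8) * q x)) (at x)" .
    have "q x \<le> x powr (1 / 2) * D x" using q_abs_le[OF x(2)] by linarith
    also have "x powr (1 / 2) = sqrt x" using x(2) by (simp add: powr_half_sqrt)
    finally have "inverse (sqrt x) * q x \<le> inverse (sqrt x) * (sqrt x * D x)"
      using x(2) by (intro mult_left_mono) auto
    also have "\<dots> = D x" using x(2) by simp
    finally have "q' x + inverse (sqrt x) / 8 * q x \<le> 0" using q'D[OF x(1)] by simp
    then have "exp (sqrt x / 4) * (q' x + inverse (sqrt x) / 8 * q x) \<le> 0"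
      by (intro mult_nonneg_nonpos) auto
    then have "q' x * exp (sqrt x / 4) + exp (sqrt x / 4) * (inverse (sqrt x) / 8) * q x \<le> 0"
      by (simp only: distrib_left mult.commute mult.left_commute)
    with d show "\<exists>y. ((\<lambda>t. q t * exp (sqrt t / 4)) has_real_derivative y) (at x) \<and> y \<le> 0" by blast
  qed
  define z where "z t = t * (cmod (W' t))\<^sup>2 + (cmod (W t))\<^sup>2" for t
  \<comment> \<open>The rate \<open>2 \<nu> + 3\<close> comes from estimating \<open>z'\<close> by the energy density, the factor \<open>8\<close> from \<open>q' \<le> - D / 8\<close>.\<close>
  define B where "B = 8 * (2 * \<nu> + 3)"
  have zd: "\<exists>y. (z has_real_derivative y) (at t) \<and> \<bar>y\<bar> \<le> (2 * \<nu> + 3) * D t" if t: "R \<le> t" for t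
  proof -
    have t1: "1 \<le> t" "0 < t" using R t by auto
    define w w' where "w = cmod (W t)" and "w' = cmod (W' t)"
    let ?y = "(1 * (cmod (W' t))\<^sup>2 + 2 * (W' t \<bullet> W'' t) * t) + 2 * (W t \<bullet> W' t)"
    have "(z has_real_derivative ?y) (at t)"
      unfolding z_def by (intro DERIV_add DERIV_mult DERIV_ident W_square_deriv W'_square_deriv t1)
    moreover have "\<bar>?y\<bar> \<le> (2 * \<nu> + 3) * D t"
    proof -
      have "t * (W' t \<bullet> W'' t) = (1 - V t) / 4 * (W' t \<bullet> W t) - \<nu> * w'\<^sup>2"
        unfolding inner_W''[OF t1(2)] power2_norm_eq_inner w'_def ..
      moreover have c: "\<bar>W' t \<bullet> W t\<bar> \<le> w' * w" "\<bar>W t \<bullet> W' t\<bar> \<le> w' * w"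
        unfolding w_def w'_def using Cauchy_Schwarz_ineq2[of "W' t" "W t"] by (simp_all add: inner_commute)
      have "\<bar>(1 - V t) / 4 * (W' t \<bullet> W t)\<bar> \<le> 1 * (w' * w)"
        unfolding abs_mult using c(1) VR[OF t] V_nonneg[of t] by (intro mult_mono) auto
      moreover have "0 \<le> \<nu> * w'\<^sup>2" using \<nu> by simp
      moreover have "a = P - N \<Longrightarrow> \<bar>P\<bar> \<le> 1 * X \<Longrightarrow> 0 \<le> N \<Longrightarrow> \<bar>a\<bar> \<le> X + N" for a P N X :: real
        by simp
      ultimately have "\<bar>t * (W' t \<bullet> W'' t)\<bar> \<le> w' * w + \<nu> * w'\<^sup>2" by presburger
      moreover have "\<bar>?y\<bar> \<le> w'\<^sup>2 + 2 * \<bar>t * (W' t \<bullet> W'' t)\<bar> + 2 * \<bar>W t \<bullet> W' t\<bar>"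
      proof -
        have "\<bar>1 * x + 2 * y * t + 2 * z\<bar> \<le> x + 2 * \<bar>t * y\<bar> + 2 * \<bar>z\<bar>" if "0 \<le> x" for x y z :: real
        proof -
          have "2 * y * t = 2 * (t * y)" by simp
          then show ?thesis using that by linarith
        qed
        from this[OF zero_le_power2] show ?thesis unfolding w'_def .
      qed
      ultimately have y: "\<bar>?y\<bar> \<le> (2 * \<nu> + 1) * w'\<^sup>2 + 4 * (w' * w)"
      proof -
        have "Y \<le> w'\<^sup>2 + 2 * S + 2 * T \<Longrightarrow> S \<le> w' * w + \<nu> * w'\<^sup>2 \<Longrightarrow> T \<le> w' * w \<Longrightarrow>
          Y \<le> (2 * \<nu> + 1) * w'\<^sup>2 + 4 * (w' * w)" for Y S T :: real
          by (simp add: algebra_simps)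
        then show "\<bar>?y\<bar> \<le> w'\<^sup>2 + 2 * \<bar>t * (W' t \<bullet> W'' t)\<bar> + 2 * \<bar>W t \<bullet> W' t\<bar> \<Longrightarrow>
          \<bar>t * (W' t \<bullet> W'' t)\<bar> \<le> w' * w + \<nu> * w'\<^sup>2 \<Longrightarrow> ?thesis" using c(2) by blast
      qed
      have "2 * (w' * w) \<le> w'\<^sup>2 + w\<^sup>2" using sum_squares_bound[of w' w] by simp
      moreover have "0 \<le> \<nu> * w\<^sup>2" using \<nu> by simp
      ultimately have "\<bar>?y\<bar> \<le> (2 * \<nu> + 3) * (w'\<^sup>2 + w\<^sup>2)"
      proof -
        have "Y \<le> (2 * \<nu> + 1) * X + 4 * P \<Longrightarrow> 2 * P \<le> X + Z \<Longrightarrow> 0 \<le> \<nu> * Z \<Longrightarrow> 0 \<le> Z \<Longrightarrow> Y \<le> (2 * \<nu> + 3) * (X + Z)"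
          for X Y Z P :: real by (simp add: algebra_simps)
        then show "2 * (w' * w) \<le> w'\<^sup>2 + w\<^sup>2 \<Longrightarrow> 0 \<le> \<nu> * w\<^sup>2 \<Longrightarrow> ?thesis" using y zero_le_power2[of w] by blast
      qed
      also have "\<dots> \<le> (2 * \<nu> + 3) * D t"
      proof (rule mult_left_mono)
        have "1 \<le> t powr \<nu>" "1 \<le> t powr (\<nu> - 1)" using t1 \<nu> by (auto intro!: ge_one_powr_ge_zero)
        then have "1 * w'\<^sup>2 \<le> t powr \<nu> * w'\<^sup>2" "1 * w\<^sup>2 \<le> t powr (\<nu> - 1) * w\<^sup>2"
          by (simp_all only: mult_right_mono zero_le_power2)
        then show "w'\<^sup>2 + w\<^sup>2 \<le> D t" by (simp add: D_def w_def w'_def)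
      qed (use \<nu> in simp)
      finally show ?thesis .
    qed
    ultimately show ?thesis by blast
  qed
  have inc: "z s - B * q s \<le> z t - B * q t" if "R \<le> s" "s \<le> t" for s t
  proof (rule DERIV_nonneg_imp_nondecreasing[OF that(2)])
    fix x assume "s \<le> x" "x \<le> t"
    then have x: "R \<le> x" using that by simp
    obtain y where y: "(z has_real_derivative y) (at x)" "\<bar>y\<bar> \<le> (2 * \<nu> + 3) * D x" using zd[OF x] by blast
    have "B * q' x \<le> B * (- D x / 8)" using q'D[OF x] \<nu> by (intro mult_left_mono) (auto simp: B_def)
    also have "B * (- D x / 8) = - ((2 * \<nu> + 3) * D x)" by (simp add: B_def)
    finally have "B * q' x \<le> - ((2 * \<nu> + 3) * D x)" .
    moreover have "a \<le> - X \<Longrightarrow> \<bar>y\<bar> \<le> X \<Longrightarrow> 0 \<le> y - a" for a X :: real by linarith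
    ultimately have "0 \<le> y - B * q' x" using y(2) by blast
    moreover have "((\<lambda>t. z t - B * q t) has_real_derivative (y - B * q' x)) (at x)"
      by (intro DERIV_diff DERIV_cmult y(1) qd x)
    ultimately show "\<exists>y. ((\<lambda>t. z t - B * q t) has_real_derivative y) (at x) \<and> 0 \<le> y" by blast
  qed
  have B0: "0 \<le> B" using \<nu> by (simp add: B_def)
  have zq: "z t \<le> B * q t" if t: "R \<le> t" for t
  proof (rule ccontr)
    assume "\<not> z t \<le> B * q t"
    then have c: "0 < z t - B * q t" by simp
    show False
    proof (rule D_not_bounded_below[OF c, of t])
      show "1 \<le> t" using R t by simp
      fix s assume s: "t \<le> s"
      then have s1: "1 \<le> s" "0 < s" "R \<le> s" using R t by auto
      have "s powr (- 1 / 2) \<le> s powr 0" using s1 by (intro powr_mono) auto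
      then have "(z t - B * q t) * s powr (- 1 / 2) \<le> (z t - B * q t) * 1"
        using c s1 by (intro mult_left_mono) auto
      also have "\<dots> \<le> z s"
        using inc[OF t s] mult_nonneg_nonneg[OF B0 q_nonneg[OF s1(3)]] by simp
      also have "\<dots> \<le> D s"
      proof -
        have e: "s powr (\<nu> - 1) * s = s powr \<nu>" using s1 by (simp add: powr_diff)
        have "1 \<le> s powr (\<nu> - 1)" using s1 \<nu> by (auto intro!: ge_one_powr_ge_zero)
        then have "1 * z s \<le> s powr (\<nu> - 1) * z s" by (rule mult_right_mono) (use s1 in \<open>simp add: z_def\<close>)
        also have "\<dots> = (s powr (\<nu> - 1) * s) * (cmod (W' s))\<^sup>2 + s powr (\<nu> - 1) * (cmod (W s))\<^sup>2"
          by (simp add: z_def distrib_left)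
        also have "\<dots> = D s" unfolding e D_def ..
        finally show ?thesis by simp
      qed
      finally show "(z t - B * q t) * s powr (- 1 / 2) \<le> D s" .
    qed
  qed
  define A where "A = B * (q R * exp (sqrt R / 4))"
  have "z t \<le> A * exp (- (sqrt t / 4))" if t: "R \<le> t" for t
  proof -
    have "q t = (q t * exp (sqrt t / 4)) * exp (- (sqrt t / 4))" by (simp add: exp_minus)
    also have "\<dots> \<le> (q R * exp (sqrt R / 4)) * exp (- (sqrt t / 4))"
      using q_exp[OF t] by (rule mult_right_mono) simp
    finally have "B * q t \<le> B * ((q R * exp (sqrt R / 4)) * exp (- (sqrt t / 4)))"
      using B0 by (rule mult_left_mono)
    then show ?thesis using zq[OF t] by (simp add: A_def mult.assoc)
  qed
  moreover have "0 \<le> A" using B0 q_nonneg[of R] by (simp add: A_def)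
  ultimately show ?thesis using R unfolding z_def by blast
qed

end

section \<open>The profile across the origin and its limits at infinity\<close>

context radial_ode
begin

text \<open>Only \<open>t \<ge> 0\<close> matters for \<open>W (x \<bullet> x)\<close>.  Continuing \<open>W\<close> affinely to negative \<open>t\<close> makes it continuously
  differentiable on the whole line, so that the chain rule applies at the origin as well.\<close>

lemma profile_extension:
  "\<exists>f f'. (\<forall>t>0. f t = W t \<and> f' t = W' t) \<and> (\<forall>t. (f has_vector_derivative f' t) (at t)) \<and> continuous_on UNIV f'"
proof -
  obtain L where L: "(W \<longlongrightarrow> L) (at_right 0)" "(W' \<longlongrightarrow> (1 / (4 * \<nu>)) *\<^sub>R L) (at_right 0)"
    using limits_at_0 by blast
  define L1 where "L1 = (1 / (4 * \<nu>)) *\<^sub>R L"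
  define f where "f t = (if 0 < t then W t else L + t *\<^sub>R L1)" for t
  define f' where "f' t = (if 0 < t then W' t else L1)" for t
  have pos: "(f has_vector_derivative f' t) (at t)" if t: "0 < t" for t
  proof (rule has_vector_derivative_transform_within_open[of W])
    show "(W has_vector_derivative f' t) (at t)" using W_deriv[OF t] t by (simp add: f'_def)
    show "open {0::real<..}" "t \<in> {0<..}" using t by auto
  qed (simp add: f_def)
  have neg: "(f has_vector_derivative f' t) (at t)" if t: "t < 0" for t
  proof (rule has_vector_derivative_transform_within_open[of "\<lambda>t. L + t *\<^sub>R L1"])
    show "((\<lambda>t. L + t *\<^sub>R L1) has_vector_derivative f' t) (at t)"
      using t by (auto simp: f'_def intro!: derivative_eq_intros)
    show "open {..<0::real}" "t \<in> {..<0}" using t by auto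
  qed (simp add: f_def)
  have zero: "(f has_vector_derivative f' 0) (at 0)"
    unfolding has_vector_derivative_def has_derivative_at_alt
  proof (intro conjI allI impI)
    show "bounded_linear (\<lambda>h. h *\<^sub>R f' 0)" by (rule bounded_linear_scaleR_left)
    fix e :: real assume e: "0 < e"
    have "\<forall>\<^sub>F s in at_right 0. dist (W' s) L1 < e" unfolding L1_def using L(2) e by (rule tendstoD)
    then obtain d where d: "0 < d" "\<And>s. 0 < s \<Longrightarrow> s < d \<Longrightarrow> dist (W' s) L1 < e"
      unfolding eventually_at_right[OF zero_less_one] by auto
    have main: "cmod (W y - L - y *\<^sub>R L1) \<le> e * y" if y: "0 < y" "y < d" for y
    proof (rule tendsto_upperbound)
      show "((\<lambda>s. cmod (W y - W s - (y - s) *\<^sub>R L1)) \<longlongrightarrow> cmod (W y - L - y *\<^sub>R L1)) (at_right 0)"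
      proof (rule tendsto_norm)
        have "((\<lambda>s. W y - W s - (y - s) *\<^sub>R L1) \<longlongrightarrow> W y - L - (y - 0) *\<^sub>R L1) (at_right 0)"
          by (intro tendsto_diff tendsto_const L tendsto_scaleR tendsto_ident_at)
        then show "((\<lambda>s. W y - W s - (y - s) *\<^sub>R L1) \<longlongrightarrow> W y - L - y *\<^sub>R L1) (at_right 0)" by simp
      qed
      have "cmod (W y - W s - (y - s) *\<^sub>R L1) \<le> e * y" if s: "0 < s" "s < y" for s
      proof -
        have 1: "(W' has_integral (W y - W s)) {s..y}"
        proof (rule fundamental_theorem_of_calculus)
          show "(W has_vector_derivative W' r) (at r within {s..y})" if "r \<in> {s..y}" for r
            by (rule has_vector_derivative_at_within[OF W_deriv]) (use s that in simp)
        qed (use s in simp)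
        have 2: "((\<lambda>r. W' r - L1) has_integral (W y - W s - (y - s) *\<^sub>R L1)) {s..y}"
          using has_integral_diff[OF 1 has_integral_const_real[of L1 s y]] s by simp
        have "cmod (integral {s..y} (\<lambda>r. W' r - L1)) \<le> integral {s..y} (\<lambda>r. e)"
          by (rule integral_norm_bound_integral[OF has_integral_integrable[OF 2] integrable_const_ivl])
            (use d(2) s y in \<open>force simp: dist_norm intro: less_imp_le\<close>)
        then have "cmod (W y - W s - (y - s) *\<^sub>R L1) \<le> e * (y - s)"
          unfolding integral_unique[OF 2] using s by (simp add: mult.commute)
        also have "\<dots> \<le> e * y" using e s by simp
        finally show ?thesis .
      qed
      then show "\<forall>\<^sub>F s in at_right 0. cmod (W y - W s - (y - s) *\<^sub>R L1) \<le> e * y"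
        using eventually_at_right_real[OF y(1)] by (auto elim!: eventually_mono)
    qed simp
    have bnd: "cmod (f y - f 0 - (y - 0) *\<^sub>R f' 0) \<le> e * norm (y - 0)" if y: "norm (y - 0) < d" for y
    proof (cases "0 < y")
      case True
      then show ?thesis using main[of y] y by (simp add: f_def f'_def)
    next
      case False
      then have "f y - f 0 - (y - 0) *\<^sub>R f' 0 = 0" by (simp add: f_def f'_def)
      moreover have "0 \<le> e * norm (y - 0)" using e by (intro mult_nonneg_nonneg) auto
      ultimately show ?thesis by (simp only: norm_zero)
    qed
    show "\<exists>d>0. \<forall>y. norm (y - 0) < d \<longrightarrow> cmod (f y - f 0 - (y - 0) *\<^sub>R f' 0) \<le> e * norm (y - 0)"
      using d(1) bnd by blast
  qed
  have "(f has_vector_derivative f' t) (at t)" for t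
    using pos neg zero by (cases t "0::real" rule: linorder_cases) auto
  moreover have "continuous_on UNIV f'"
  proof -
    have "isCont f' t" for t
    proof -
      consider "0 < t" | "t < 0" | "t = 0" by linarith
      then show ?thesis
      proof cases
        case 1
        have "isCont W' t" using W'_continuous 1 by (simp add: continuous_on_eq_continuous_at)
        moreover have "\<forall>\<^sub>F s in nhds t. W' s = f' s"
          using eventually_nhds_in_open[of "{0<..}" t] 1 by (auto elim!: eventually_mono simp: f'_def)
        ultimately show ?thesis using isCont_cong by blast
      next
        case 2
        have "\<forall>\<^sub>F s in nhds t. L1 = f' s"
          using eventually_nhds_in_open[of "{..<0}" t] 2 by (auto elim!: eventually_mono simp: f'_def)
        then show ?thesis using isCont_cong[of "\<lambda>_. L1" f' t] by simp
      next
        case 3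
        have "(f' \<longlongrightarrow> L1) (at_right 0)"
        proof (rule Lim_transform_eventually)
          show "(W' \<longlongrightarrow> L1) (at_right 0)" using L(2) by (simp add: L1_def)
          show "\<forall>\<^sub>F s in at_right 0. W' s = f' s" by (simp add: f'_def eventually_at_filter)
        qed
        moreover have "(f' \<longlongrightarrow> L1) (at_left 0)"
        proof (rule Lim_transform_eventually)
          show "((\<lambda>_. L1) \<longlongrightarrow> L1) (at_left 0)" by simp
          show "\<forall>\<^sub>F s in at_left 0. L1 = f' s" by (simp add: f'_def eventually_at_filter)
        qed
        ultimately show ?thesis unfolding 3 isCont_def by (simp add: filterlim_split_at f'_def)
      qed
    qed
    then show ?thesis by (simp add: continuous_on_eq_continuous_at)
  qed
  moreover have "\<forall>t>0. f t = W t \<and> f' t = W' t" by (simp add: f_def f'_def)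
  ultimately show ?thesis by blast
qed

text \<open>The first three limits are the exponential decay; the last one follows from the equation and \<open>V \<longlonglongrightarrow> 0\<close>.\<close>

lemma limits_at_top:
  "((\<lambda>t. cmod (W t)) \<longlongrightarrow> 0) at_top"
  "((\<lambda>t. sqrt t * cmod (W' t)) \<longlongrightarrow> 0) at_top"
  "((\<lambda>t. cmod (W' t)) \<longlongrightarrow> 0) at_top"
  "((\<lambda>t. t * cmod (W'' t)) \<longlongrightarrow> 0) at_top"
proof -
  obtain A R where AR: "0 \<le> A" "1 \<le> R"
    "\<And>t. R \<le> t \<Longrightarrow> t * (cmod (W' t))\<^sup>2 + (cmod (W t))\<^sup>2 \<le> A * exp (- (sqrt t / 4))"
    using exponential_decay by blast
  define g where "g t = sqrt (A * exp (- (sqrt t / 4)))" for t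
  have g: "(g \<longlongrightarrow> 0) at_top"
  proof -
    have "filterlim (\<lambda>t::real. sqrt t * (1 / 4)) at_top at_top"
      by (intro filterlim_at_top_mult_tendsto_pos[OF tendsto_const _ sqrt_at_top]) simp
    then have "((\<lambda>t::real. exp (- (sqrt t * (1 / 4)))) \<longlongrightarrow> 0) at_top"
      by (intro filterlim_compose[OF exp_at_bot] filterlim_compose[OF filterlim_uminus_at_bot_at_top])
    then have "((\<lambda>t::real. sqrt (A * exp (- (sqrt t * (1 / 4))))) \<longlongrightarrow> sqrt (A * 0)) at_top"
      by (intro tendsto_intros)
    then show ?thesis by (simp add: g_def[abs_def])
  qed
  have W: "cmod (W t) \<le> g t" and W': "sqrt t * cmod (W' t) \<le> g t" and W'2: "cmod (W' t) \<le> g t" if t: "R \<le> t" for t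
  proof -
    have t0: "1 \<le> t" using t AR by simp
    have "(cmod (W t))\<^sup>2 \<le> A * exp (- (sqrt t / 4))" "(sqrt t * cmod (W' t))\<^sup>2 \<le> A * exp (- (sqrt t / 4))"
      by (rule order_trans[OF _ AR(3)[OF t]], use t0 in \<open>simp add: power_mult_distrib\<close>)+
    then show 1: "cmod (W t) \<le> g t" "sqrt t * cmod (W' t) \<le> g t" by (auto simp: g_def intro!: real_le_rsqrt)
    have "1 * cmod (W' t) \<le> sqrt t * cmod (W' t)" using t0 by (intro mult_right_mono) auto
    then show "cmod (W' t) \<le> g t" using 1 by simp
  qed
  show l1: "((\<lambda>t. cmod (W t)) \<longlongrightarrow> 0) at_top"
  proof (rule tendsto_sandwich[OF _ _ tendsto_const g])
    show "\<forall>\<^sub>F t in at_top. cmod (W t) \<le> g t"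
      using eventually_ge_at_top[of R] by eventually_elim (rule W)
  qed simp
  show "((\<lambda>t. sqrt t * cmod (W' t)) \<longlongrightarrow> 0) at_top"
  proof (rule tendsto_sandwich[OF _ _ tendsto_const g])
    show "\<forall>\<^sub>F t in at_top. 0 \<le> sqrt t * cmod (W' t)"
      using eventually_ge_at_top[of 0] by eventually_elim simp
    show "\<forall>\<^sub>F t in at_top. sqrt t * cmod (W' t) \<le> g t"
      using eventually_ge_at_top[of R] by eventually_elim (rule W')
  qed
  show l3: "((\<lambda>t. cmod (W' t)) \<longlongrightarrow> 0) at_top"
  proof (rule tendsto_sandwich[OF _ _ tendsto_const g])
    show "\<forall>\<^sub>F t in at_top. cmod (W' t) \<le> g t"
      using eventually_ge_at_top[of R] by eventually_elim (rule W'2)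
  qed simp
  have WW: "(W \<longlongrightarrow> 0) at_top" "(W' \<longlongrightarrow> 0) at_top"
    using l1 l3 by (simp_all add: tendsto_norm_zero_iff)
  have "((\<lambda>t. cmod ((1 / 4) *\<^sub>R ((1 - V t) *\<^sub>R W t - (4 * \<nu>) *\<^sub>R W' t))) \<longlongrightarrow> cmod ((1 / 4) *\<^sub>R ((1 - 0) *\<^sub>R 0 - (4 * \<nu>) *\<^sub>R 0))) at_top"
    by (intro tendsto_norm tendsto_scaleR tendsto_diff tendsto_const V_tendsto_0_at_top WW)
  then have "((\<lambda>t. cmod ((1 / 4) *\<^sub>R ((1 - V t) *\<^sub>R W t - (4 * \<nu>) *\<^sub>R W' t))) \<longlongrightarrow> 0) at_top" by simp
  then show "((\<lambda>t. t * cmod (W'' t)) \<longlongrightarrow> 0) at_top"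
  proof (rule Lim_transform_eventually)
    show "\<forall>\<^sub>F t in at_top. cmod ((1 / 4) *\<^sub>R ((1 - V t) *\<^sub>R W t - (4 * \<nu>) *\<^sub>R W' t)) = t * cmod (W'' t)"
      using eventually_gt_at_top[of 0] by eventually_elim (simp add: W''_def H_def)
  qed
qed

end

section \<open>Regularity and decay of the radial function\<close>

text \<open>A coordinate times a function that is merely continuous at \<open>0\<close> is differentiable there, since the increment
  of the continuous factor is multiplied by something of first order.  This gives the Hessian at the
  origin although the second factor, \<open>f' (x \<bullet> x)\<close>, comes without a derivative there.\<close>

lemma has_derivative_coord_mult_0:
  fixes k :: "real^'n::finite \<Rightarrow> complex"
  assumes "isCont k 0"
  shows "((\<lambda>x. of_real (2 * x $ i) * k x) has_derivative (\<lambda>h. of_real (2 * h $ i) * k 0)) (at 0)"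
  unfolding has_derivative_at_alt
proof (intro conjI allI impI)
  have "bounded_linear (\<lambda>h::real^'n. (2 * h $ i) *\<^sub>R k 0)"
    by (intro bounded_linear_scaleR_const bounded_linear_const_mult bounded_linear_vec_nth)
  then show "bounded_linear (\<lambda>h::real^'n. complex_of_real (2 * h $ i) * k 0)"
    by (simp only: scaleR_conv_of_real)
  fix e :: real assume e: "0 < e"
  then obtain d where d: "0 < d" "\<And>x. dist x 0 < d \<Longrightarrow> dist (k x) (k 0) < e / 2"
    using assms unfolding continuous_at_eps_delta by (meson half_gt_zero)
  have "norm (of_real (2 * y $ i) * k y - of_real (2 * (0::real^'n) $ i) * k 0 - of_real (2 * (y - 0) $ i) * k 0) \<le> e * norm (y - 0)"
    if y: "norm (y - 0) < d" for y :: "real^'n"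
  proof -
    have "norm (of_real (2 * y $ i) * k y - of_real (2 * (0::real^'n) $ i) * k 0 - of_real (2 * (y - 0) $ i) * k 0) =
      2 * \<bar>y $ i\<bar> * norm (k y - k 0)"
      by (simp add: right_diff_distrib[symmetric] norm_mult)
    also have "\<dots> \<le> 2 * norm y * (e / 2)"
      using d(2)[of y] y component_le_norm_cart[of y i] by (intro mult_mono) (auto simp: dist_norm)
    finally show ?thesis by (simp add: mult.commute)
  qed
  then show "\<exists>d>0. \<forall>y. norm (y - 0) < d \<longrightarrow> norm (of_real (2 * y $ i) * k y - of_real (2 * (0::real^'n) $ i) * k 0 - of_real (2 * (y - 0) $ i) * k 0) \<le> e * norm (y - 0)"
    using d(1) by blast
qed

lemma isCont_sqnorm:
  fixes x :: "real^'n::finite"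
  shows "isCont g (x \<bullet> x) \<Longrightarrow> isCont (\<lambda>x. g (x \<bullet> x)) x"
  by (rule isCont_o2) (auto intro!: continuous_intros)

lemma filterlim_sqnorm_at_infinity: "filterlim (\<lambda>x::real^'n::finite. x \<bullet> x) at_top at_infinity"
proof -
  have "filterlim (\<lambda>x::real^'n. norm x * norm x) at_top at_infinity"
    by (intro filterlim_at_top_mult_at_top filterlim_norm_at_top)
  then show ?thesis by (simp add: dot_square_norm power2_eq_square)
qed

lemma filterlim_sqnorm_at_0: "filterlim (\<lambda>x::real^'n::finite. x \<bullet> x) (at_right 0) (at 0)"
  unfolding filterlim_at
proof
  have "((\<lambda>x::real^'n. x \<bullet> x) \<longlongrightarrow> 0 \<bullet> (0::real^'n)) (at 0)" by (intro tendsto_inner tendsto_ident_at)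
  then show "((\<lambda>x::real^'n. x \<bullet> x) \<longlongrightarrow> 0) (at 0)" by simp
qed (simp add: eventually_at_filter)

lemma abs_coord_le_sqrt: "\<bar>x $ i\<bar> \<le> sqrt (x \<bullet> x)" for x :: "real^'n::finite"
  using component_le_norm_cart[of x i] by (simp add: norm_eq_sqrt_inner)

context
  fixes f f' f'' :: "real \<Rightarrow> complex" and u :: "real^'n::finite \<Rightarrow> complex"
  assumes f: "\<And>t. (f has_vector_derivative f' t) (at t)" "continuous_on UNIV f'"
    and f': "\<And>t. 0 < t \<Longrightarrow> (f' has_vector_derivative f'' t) (at t)"
    and f'': "continuous_on {0<..} f''" "((\<lambda>t. t *\<^sub>R f'' t) \<longlongrightarrow> 0) (at_right 0)"
    and u: "u = (\<lambda>x. f (x \<bullet> x))"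
begin

lemma pdiff_radial: "pdiff i u = (\<lambda>x. of_real (2 * x $ i) * f' (x \<bullet> x))"
  unfolding u by (rule ext, rule pdiff_sqnorm[OF f(1)])

lemma radial_differentiable: "u differentiable at x"
  unfolding u differentiable_def using has_derivative_sqnorm[OF f(1)] by blast

text \<open>At \<open>x = 0\<close> the term with \<open>f''\<close> carries the factor \<open>x $ i\<close> and vanishes, so the arbitrary value \<open>f'' 0\<close> does no harm
  and one formula serves for all \<open>x\<close>.\<close>

lemma pdiff_radial_has_derivative:
  fixes x :: "real^'n"
  shows "((\<lambda>x. of_real (2 * x $ i) * f' (x \<bullet> x)) has_derivative
     (\<lambda>h. of_real (2 * h $ i) * f' (x \<bullet> x) + of_real (4 * x $ i * (x \<bullet> h)) * f'' (x \<bullet> x))) (at x)"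
proof (cases "x = 0")
  case True
  have "isCont f' (0 \<bullet> (0::real^'n))" using f(2) by (simp add: continuous_on_eq_continuous_at)
  then have "isCont (\<lambda>x::real^'n. f' (x \<bullet> x)) 0" by (rule isCont_sqnorm)
  from has_derivative_coord_mult_0[OF this, of i] show ?thesis using True by simp
next
  case False
  then have "0 < x \<bullet> x" by simp
  then have "((\<lambda>x. f' (x \<bullet> x)) has_derivative (\<lambda>h. (2 * (x \<bullet> h)) *\<^sub>R f'' (x \<bullet> x))) (at x)"
    by (intro has_derivative_sqnorm f')
  moreover have "((\<lambda>x::real^'n. complex_of_real (2 * x $ i)) has_derivative (\<lambda>h. complex_of_real (2 * h $ i))) (at x)"
    by (intro bounded_linear_imp_has_derivative bounded_linear_compose[OF bounded_linear_of_real]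
       bounded_linear_compose[OF bounded_linear_mult_right] bounded_linear_vec_nth)
  ultimately have "((\<lambda>x. of_real (2 * x $ i) * f' (x \<bullet> x)) has_derivative
     (\<lambda>h. of_real (2 * x $ i) * ((2 * (x \<bullet> h)) *\<^sub>R f'' (x \<bullet> x)) + of_real (2 * h $ i) * f' (x \<bullet> x))) (at x)"
    by (intro has_derivative_mult)
  moreover have "(\<lambda>h. of_real (2 * x $ i) * ((2 * (x \<bullet> h)) *\<^sub>R f'' (x \<bullet> x)) + of_real (2 * h $ i) * f' (x \<bullet> x)) =
    (\<lambda>h. of_real (2 * h $ i) * f' (x \<bullet> x) + of_real (4 * x $ i * (x \<bullet> h)) * f'' (x \<bullet> x))"
    by (auto simp: fun_eq_iff scaleR_conv_of_real)
  ultimately show ?thesis by simp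
qed

lemma pdiff_pdiff_radial:
  "pdiff j (pdiff i u) = (\<lambda>x. of_real (if i = j then 2 else 0) * f' (x \<bullet> x) + of_real (4 * x $ i * x $ j) * f'' (x \<bullet> x))"
proof
  fix x :: "real^'n"
  have e: "(axis j 1 :: real^'n) $ i = (if i = j then 1 else 0)" "x \<bullet> axis j 1 = x $ j"
    by (simp add: axis_def) (simp add: inner_axis)
  show "pdiff j (pdiff i u) x = of_real (if i = j then 2 else 0) * f' (x \<bullet> x) + of_real (4 * x $ i * x $ j) * f'' (x \<bullet> x)"
    unfolding pdiff_radial pdiff_has_derivative[OF pdiff_radial_has_derivative] e by simp
qed

lemma Ck_2_radial: "Ck 2 u"
proof -
  have f'c: "isCont (\<lambda>x::real^'n. f' (x \<bullet> x)) x" for x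
    using f(2) by (intro isCont_sqnorm) (simp add: continuous_on_eq_continuous_at)
  have 0: "isCont (\<lambda>x::real^'n. of_real (4 * x $ i * x $ j) * f'' (x \<bullet> x)) x" for i j x
  proof (cases "x = 0")
    case True
    have "((\<lambda>x::real^'n. 4 * norm ((x \<bullet> x) *\<^sub>R f'' (x \<bullet> x))) \<longlongrightarrow> 4 * norm (0::complex)) (at 0)"
      by (intro tendsto_mult tendsto_const tendsto_norm filterlim_compose[OF f''(2) filterlim_sqnorm_at_0])
    then have lim: "((\<lambda>x::real^'n. 4 * norm ((x \<bullet> x) *\<^sub>R f'' (x \<bullet> x))) \<longlongrightarrow> 0) (at 0)" by simp
    have "((\<lambda>x::real^'n. of_real (4 * x $ i * x $ j) * f'' (x \<bullet> x)) \<longlongrightarrow> 0) (at 0)"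
    proof (rule Lim_null_comparison[OF always_eventually lim], rule allI)
      fix x :: "real^'n"
      have "\<bar>x $ i\<bar> * \<bar>x $ j\<bar> \<le> sqrt (x \<bullet> x) * sqrt (x \<bullet> x)"
        by (intro mult_mono abs_coord_le_sqrt) auto
      then have "\<bar>x $ i\<bar> * \<bar>x $ j\<bar> * norm (f'' (x \<bullet> x)) \<le> (x \<bullet> x) * norm (f'' (x \<bullet> x))"
        by (intro mult_right_mono) auto
      then show "norm (of_real (4 * x $ i * x $ j) * f'' (x \<bullet> x)) \<le> 4 * norm ((x \<bullet> x) *\<^sub>R f'' (x \<bullet> x))"
        by (simp add: norm_mult abs_mult)
    qed
    then show ?thesis unfolding True isCont_def by simp
  next
    case False
    then have "isCont f'' (x \<bullet> x)" using f''(1) by (simp add: continuous_on_eq_continuous_at)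
    then have "isCont (\<lambda>x::real^'n. f'' (x \<bullet> x)) x" by (rule isCont_sqnorm)
    then show ?thesis by (intro continuous_intros)
  qed
  have "continuous_on UNIV (pdiff j (pdiff i u))" for i j
    unfolding pdiff_pdiff_radial continuous_on_eq_continuous_at[OF open_UNIV]
    by (intro ballI continuous_add continuous_mult continuous_const f'c 0)
  moreover have "pdiff i u differentiable at x" for i x
    unfolding pdiff_radial differentiable_def using pdiff_radial_has_derivative by blast
  ultimately show ?thesis
    using radial_differentiable by (simp add: numeral_2_eq_2)
qed

lemma norm_grad_radial_le: "norm (grad u x) \<le> 2 * real CARD('n) * (sqrt (x \<bullet> x) * cmod (f' (x \<bullet> x)))"
proof -
  have "norm (grad u x) \<le> (\<Sum>i\<in>UNIV. norm (grad u x $ i))"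
    unfolding norm_vec_def by (rule L2_set_le_sum) simp
  also have "\<dots> \<le> (\<Sum>i\<in>(UNIV::'n set). 2 * (sqrt (x \<bullet> x) * cmod (f' (x \<bullet> x))))"
  proof (rule sum_mono)
    fix i
    have "\<bar>x $ i\<bar> * cmod (f' (x \<bullet> x)) \<le> sqrt (x \<bullet> x) * cmod (f' (x \<bullet> x))"
      by (intro mult_right_mono abs_coord_le_sqrt) simp
    then show "norm (grad u x $ i) \<le> 2 * (sqrt (x \<bullet> x) * cmod (f' (x \<bullet> x)))"
      by (simp add: grad_def pdiff_radial norm_mult abs_mult)
  qed
  finally show ?thesis by simp
qed

lemma radial_derivatives_vanish:
  assumes lim: "((\<lambda>t. cmod (f t)) \<longlongrightarrow> 0) at_top" "((\<lambda>t. sqrt t * cmod (f' t)) \<longlongrightarrow> 0) at_top"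
    "((\<lambda>t. cmod (f' t)) \<longlongrightarrow> 0) at_top" "((\<lambda>t. t * cmod (f'' t)) \<longlongrightarrow> 0) at_top"
    and ds: "length ds \<le> 2"
  shows "((\<lambda>x. cmod (pdiffs ds u x)) \<longlongrightarrow> 0) at_infinity"
proof -
  note comp = filterlim_compose[OF _ filterlim_sqnorm_at_infinity[where 'n = 'n]]
  consider "ds = []" | i where "ds = [i]" | j i where "ds = [j, i]"
    using ds by (cases ds; cases "tl ds") auto
  then show ?thesis
  proof cases
    case 1
    then show ?thesis using comp[OF lim(1)] by (simp add: pdiffs_def u)
  next
    case (2 i)
    have "((\<lambda>x::real^'n. 2 * (sqrt (x \<bullet> x) * cmod (f' (x \<bullet> x)))) \<longlongrightarrow> 2 * 0) at_infinity"
      by (intro tendsto_mult tendsto_const comp[OF lim(2)])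
    then have l: "((\<lambda>x::real^'n. 2 * (sqrt (x \<bullet> x) * cmod (f' (x \<bullet> x)))) \<longlongrightarrow> 0) at_infinity" by simp
    show ?thesis
    proof (rule Lim_null_comparison[OF always_eventually l], rule allI)
      fix x :: "real^'n"
      have "\<bar>x $ i\<bar> * cmod (f' (x \<bullet> x)) \<le> sqrt (x \<bullet> x) * cmod (f' (x \<bullet> x))"
        by (intro mult_right_mono abs_coord_le_sqrt) simp
      then show "norm (cmod (pdiffs ds u x)) \<le> 2 * (sqrt (x \<bullet> x) * cmod (f' (x \<bullet> x)))"
        by (simp add: 2 pdiffs_def pdiff_radial norm_mult abs_mult)
    qed
  next
    case (3 j i)
    have "((\<lambda>x::real^'n. 2 * cmod (f' (x \<bullet> x)) + 4 * ((x \<bullet> x) * cmod (f'' (x \<bullet> x)))) \<longlongrightarrow> 2 * 0 + 4 * 0) at_infinity"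
      by (intro tendsto_add tendsto_mult[OF tendsto_const] comp[OF lim(3)] comp[OF lim(4)])
    then have l: "((\<lambda>x::real^'n. 2 * cmod (f' (x \<bullet> x)) + 4 * ((x \<bullet> x) * cmod (f'' (x \<bullet> x)))) \<longlongrightarrow> 0) at_infinity" by simp
    show ?thesis
    proof (rule Lim_null_comparison[OF always_eventually l], rule allI)
      fix x :: "real^'n"
      have "\<bar>x $ i\<bar> * \<bar>x $ j\<bar> \<le> sqrt (x \<bullet> x) * sqrt (x \<bullet> x)"
        by (intro mult_mono abs_coord_le_sqrt) auto
      then have "\<bar>x $ i\<bar> * \<bar>x $ j\<bar> * cmod (f'' (x \<bullet> x)) \<le> (x \<bullet> x) * cmod (f'' (x \<bullet> x))"
        by (intro mult_right_mono) auto
      then have "cmod (of_real (4 * x $ i * x $ j) * f'' (x \<bullet> x)) \<le> 4 * ((x \<bullet> x) * cmod (f'' (x \<bullet> x)))"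
        by (simp add: norm_mult abs_mult)
      moreover have "cmod (of_real (if i = j then 2 else 0) * f' (x \<bullet> x)) \<le> 2 * cmod (f' (x \<bullet> x))"
        by (simp add: norm_mult)
      moreover have "pdiffs ds u x = of_real (if i = j then 2 else 0) * f' (x \<bullet> x) + of_real (4 * x $ i * x $ j) * f'' (x \<bullet> x)"
        unfolding 3 pdiffs_def by (simp only: foldr.simps o_apply id_apply pdiff_pdiff_radial)
      ultimately have "cmod (pdiffs ds u x) \<le> 2 * cmod (f' (x \<bullet> x)) + 4 * ((x \<bullet> x) * cmod (f'' (x \<bullet> x)))"
        by (metis norm_triangle_le add_mono)
      then show "norm (cmod (pdiffs ds u x)) \<le> 2 * cmod (f' (x \<bullet> x)) + 4 * ((x \<bullet> x) * cmod (f'' (x \<bullet> x)))"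
        by simp
    qed
  qed
qed

text \<open>Outside a ball the decay rate \<open>exp (- (sqrt t / 4))\<close> of the squares gives \<open>exp (- (norm x / 8))\<close> for
  \<open>u\<close> and its gradient; inside, the function is continuous on a compact set.\<close>

lemma radial_exponential_bound:
  assumes decay: "0 \<le> A" "1 \<le> R" "\<And>t. R \<le> t \<Longrightarrow> t * (cmod (f' t))\<^sup>2 + (cmod (f t))\<^sup>2 \<le> A * exp (- (sqrt t / 4))"
  shows "(\<lambda>x. exp (1 / 8 * norm x) * (cmod (u x) + norm (grad u x))) \<in> L_infinity"
proof -
  let ?F = "\<lambda>x. exp (1 / 8 * norm x) * (cmod (u x) + norm (grad u x))"
  have uc: "continuous_on UNIV u"
    using radial_differentiable
    by (intro differentiable_imp_continuous_on) (simp add: differentiable_on_def)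
  have pc: "continuous_on UNIV (pdiff i u)" for i
    using Ck_2_radial by (simp add: numeral_2_eq_2 Ck_pred[of 0, simplified])
  have Fc: "continuous_on UNIV ?F"
    unfolding grad_def
    by (intro continuous_on_mult continuous_on_exp continuous_on_add continuous_on_norm continuous_on_const
        continuous_on_id uc continuous_on_vec_lambda pc)
  have "?F \<in> borel_measurable lborel"
    using borel_measurable_continuous_onI[OF Fc] by simp
  then have Fm: "?F \<in> borel_measurable lebesgue" by (rule measurable_completion)
  have "compact (?F ` cball 0 (sqrt R))"
    by (intro compact_continuous_image continuous_on_subset[OF Fc]) auto
  then obtain M1 where M1: "\<And>x. x \<in> cball 0 (sqrt R) \<Longrightarrow> \<bar>?F x\<bar> \<le> M1"
    using compact_imp_bounded bounded_iff by (metis (no_types, lifting) imageI real_norm_def)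
  define M2 where "M2 = (1 + 2 * real CARD('n)) * sqrt A"
  have M2: "\<bar>?F x\<bar> \<le> M2" if x: "x \<notin> cball 0 (sqrt R)" for x
  proof -
    define t where "t = x \<bullet> x"
    have "sqrt R < sqrt t" using x by (simp add: t_def norm_eq_sqrt_inner not_le)
    then have tR: "R \<le> t" by simp
    then have t1: "0 \<le> t" using decay(2) by simp
    have n: "norm x = sqrt t" by (simp add: t_def norm_eq_sqrt_inner)
    have e2: "(exp (- (sqrt t / 8)))\<^sup>2 = exp (- (sqrt t / 4))"
      by (simp add: power2_eq_square exp_add[symmetric])
    define g where "g = sqrt A * exp (- (sqrt t / 8))"
    have g0: "0 \<le> g" using decay(1) by (simp add: g_def)
    have g2: "g\<^sup>2 = A * exp (- (sqrt t / 4))" using decay(1) by (simp add: g_def power_mult_distrib e2)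
    have "(cmod (f t))\<^sup>2 \<le> g\<^sup>2" "(sqrt t * cmod (f' t))\<^sup>2 \<le> g\<^sup>2"
      unfolding g2 by (rule order_trans[OF _ decay(3)[OF tR]], use t1 in \<open>simp add: power_mult_distrib\<close>)+
    then have 1: "cmod (f t) \<le> g" "sqrt t * cmod (f' t) \<le> g" using g0 by (auto intro: power2_le_imp_le)
    have "norm (grad u x) \<le> 2 * real CARD('n) * (sqrt t * cmod (f' t))"
      using norm_grad_radial_le[of x] by (simp add: t_def)
    also have "\<dots> \<le> 2 * real CARD('n) * g" using 1(2) by (intro mult_left_mono) auto
    finally have "cmod (u x) + norm (grad u x) \<le> g + 2 * real CARD('n) * g"
      using 1(1) by (simp add: u t_def)
    then have "?F x \<le> exp (sqrt t / 8) * (g + 2 * real CARD('n) * g)"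
      unfolding n by (simp add: mult_left_mono)
    also have "\<dots> = (1 + 2 * real CARD('n)) * sqrt A * (exp (sqrt t / 8) * exp (- (sqrt t / 8)))"
      unfolding g_def by (simp add: algebra_simps)
    also have "\<dots> = M2" by (simp add: M2_def exp_minus)
    finally show ?thesis by simp
  qed
  have "AE x in lebesgue. \<bar>?F x\<bar> \<le> max M1 M2"
    using M1 M2 by (intro AE_I2) (metis max.coboundedI1 max.coboundedI2)
  then show ?thesis unfolding L_infinity_def using Fm by blast
qed

end

lemma mi_list_length:
  assumes "mi_list \<beta> ds"
  shows "length ds = mi_order \<beta>"
proof -
  have "length ds = (\<Sum>i\<in>set ds. count_list ds i)" by (simp add: sum_count_set)
  also have "\<dots> = (\<Sum>i\<in>UNIV. count_list ds i)"
    by (rule sum.mono_neutral_left) auto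
  finally show ?thesis using assms by (simp add: mi_list_def mi_order_def)
qed

theorem proposition2p2:
  fixes b p :: real and \<phi> :: "real ^ 'n \<Rightarrow> complex"
  assumes "CARD('n) \<ge> 2"
    and "b > 0"
    and "p > 1 + 2 * b / (real CARD('n) - 1)"
    and "CARD('n) \<ge> 3 \<Longrightarrow> p < (real CARD('n) + 2 + 2 * b) / (real CARD('n) - 2)"
    and "\<phi> \<in> H1_rad"
    and "\<not> (AE x in lebesgue. \<phi> x = 0)"
    and "solves b p \<phi>"
  shows "\<exists>u. (AE x in lebesgue. u x = \<phi> x) \<and>
           (Ck 2 u \<and>
            (\<forall>\<beta> ds. mi_order \<beta> \<le> 2 \<and> mi_list \<beta> ds \<longrightarrow>
               ((\<lambda>x. cmod (pdiffs ds u x)) \<longlongrightarrow> 0) at_infinity)) \<and>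
           (\<exists>C>0. (\<lambda>x. exp (C * norm x) * (cmod (u x) + norm (grad u x))) \<in> L_infinity)"
proof -
  define \<nu> where "\<nu> = real CARD('n) / 2"
  have n: "real CARD('n) = 2 * \<nu>" by (simp add: \<nu>_def)
  obtain h where H1: "\<phi> \<in> H1" and h: "AE x in lebesgue. \<phi> x = h (norm x)"
    using assms(5) by (auto simp: H1_rad_def)
  have "\<phi> \<in> borel_measurable lebesgue" using H1 by (auto simp: H1_def L2_def)
  from radial_borel_profile[OF this h] obtain W0 where
    W0: "W0 \<in> borel_measurable borel" "AE x in lebesgue. \<phi> x = W0 (x \<bullet> x)" by blast
  obtain W W' where W: "W \<in> borel_measurable borel" "AE x in lebesgue. \<phi> x = W (x \<bullet> x)"
    "\<And>t. t > 0 \<Longrightarrow> (W has_vector_derivative W' t) (at t)"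
    "\<And>T. set_integrable lborel {0..T} (\<lambda>t. t powr (\<nu> - 1) *\<^sub>R (W t - nonlin b p W t))"
    "\<And>t. t > 0 \<Longrightarrow> (4 * t powr \<nu>) *\<^sub>R W' t = (LINT s:{0..t}|lborel. s powr (\<nu> - 1) *\<^sub>R (W s - nonlin b p W s))"
    using radial_profile_ODE[OF assms(7) W0, folded \<nu>_def] by blast
  have W'c: "continuous_on {0<..} W'"
  proof (rule continuous_on_eq)
    define \<Gamma> where "\<Gamma> t = (LINT s:{0..t}|lborel. s powr (\<nu> - 1) *\<^sub>R (W s - nonlin b p W s))" for t
    have "continuous_on {0..T} \<Gamma>" for T unfolding \<Gamma>_def by (rule continuous_on_set_integral[OF W(4)])
    then have "isCont \<Gamma> t" if "t > 0" for t
      using continuous_on_interior[of "{0..t + 1}" \<Gamma> t] that by (simp add: interior_atLeastAtMost_real)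
    then have "continuous_on {0<..} \<Gamma>" by (simp add: continuous_on_eq_continuous_at)
    then show "continuous_on {0<..} (\<lambda>t. (1 / (4 * t powr \<nu>)) *\<^sub>R \<Gamma> t)"
      by (intro continuous_intros) auto
    show "(1 / (4 * t powr \<nu>)) *\<^sub>R \<Gamma> t = W' t" if "t \<in> {0<..}" for t
      unfolding \<Gamma>_def using that W(5)[symmetric] by simp
  qed
  obtain K where K: "\<And>a b. 0 < a \<Longrightarrow> a < b \<Longrightarrow> integral {a..b} (\<lambda>t. t powr \<nu> * (cmod (W' t))\<^sup>2) \<le> K"
    "\<And>a b. 0 < a \<Longrightarrow> a < b \<Longrightarrow> integral {a..b} (\<lambda>t. t powr (\<nu> - 1) * (cmod (W t))\<^sup>2) \<le> K"
    using radial_energy_bounds[OF H1 W(1,2,3) W'c, folded \<nu>_def] by blast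
  interpret radial_ode \<nu> b p K W W'
  proof
    show "1 \<le> \<nu>" using assms(1) by (simp add: \<nu>_def)
    show "0 < b" by fact
    show "1 + 2 * b / (2 * \<nu> - 1) < p" using assms(3) by (simp add: n)
    show "p < (\<nu> + 1 + b) / (\<nu> - 1)" if "1 < \<nu>"
    proof -
      have "2 < real CARD('n)" using that by (simp add: \<nu>_def)
      then have "CARD('n) \<ge> 3" by simp
      from assms(4)[OF this] have "p < (2 * (\<nu> + 1 + b)) / (2 * (\<nu> - 1))" by (simp add: n algebra_simps)
      then show ?thesis by (simp only: mult_divide_mult_cancel_left[of 2] zero_neq_numeral not_False_eq_True)
    qed
    show "(\<lambda>s. s powr (\<nu> - 1) *\<^sub>R (W s - nonlin b p W s)) integrable_on {0..T}" for T
      by (rule set_borel_integral_eq_integral(1)[OF W(4)])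
    show "(4 * t powr \<nu>) *\<^sub>R W' t = integral {0..t} (\<lambda>s. s powr (\<nu> - 1) *\<^sub>R (W s - nonlin b p W s))" if "0 < t" for t
      unfolding W(5)[OF that] by (rule set_borel_integral_eq_integral(2)[OF W(4)])
  qed (fact W(3) K)+
  obtain f f' where ff: "\<And>t. 0 < t \<Longrightarrow> f t = W t" "\<And>t. 0 < t \<Longrightarrow> f' t = W' t"
    "\<And>t. (f has_vector_derivative f' t) (at t)" "continuous_on UNIV f'"
    using profile_extension by blast
  have f'': "(f' has_vector_derivative W'' t) (at t)" if t: "0 < t" for t
    by (rule has_vector_derivative_transform_within_open[OF W'_deriv[OF t], of "{0<..}"]) (use t ff(2) in auto)
  have W''0: "((\<lambda>t. t *\<^sub>R W'' t) \<longlongrightarrow> 0) (at_right 0)"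
    using limits_at_0 by blast
  define u where "u = (\<lambda>x::real^'n. f (x \<bullet> x))"
  note rad = ff(3,4) f'' W''_continuous W''0 u_def
  have ev: "\<forall>\<^sub>F t in at_top. W t = f t" "\<forall>\<^sub>F t in at_top. W' t = f' t"
    using eventually_gt_at_top[of 0] by (eventually_elim, simp add: ff)+
  have lim: "((\<lambda>t. cmod (f t)) \<longlongrightarrow> 0) at_top" "((\<lambda>t. sqrt t * cmod (f' t)) \<longlongrightarrow> 0) at_top"
    "((\<lambda>t. cmod (f' t)) \<longlongrightarrow> 0) at_top" "((\<lambda>t. t * cmod (W'' t)) \<longlongrightarrow> 0) at_top"
  proof -
    show "((\<lambda>t. cmod (f t)) \<longlongrightarrow> 0) at_top"
      by (rule Lim_transform_eventually[OF limits_at_top(1)]) (use ev(1) in \<open>eventually_elim, simp\<close>)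
    show "((\<lambda>t. sqrt t * cmod (f' t)) \<longlongrightarrow> 0) at_top"
      by (rule Lim_transform_eventually[OF limits_at_top(2)]) (use ev(2) in \<open>eventually_elim, simp\<close>)
    show "((\<lambda>t. cmod (f' t)) \<longlongrightarrow> 0) at_top"
      by (rule Lim_transform_eventually[OF limits_at_top(3)]) (use ev(2) in \<open>eventually_elim, simp\<close>)
  qed (rule limits_at_top(4))
  obtain A R where AR: "0 \<le> A" "1 \<le> R"
    "\<And>t. R \<le> t \<Longrightarrow> t * (cmod (W' t))\<^sup>2 + (cmod (W t))\<^sup>2 \<le> A * exp (- (sqrt t / 4))"
    using exponential_decay by blast
  have "AE t in lborel. t > 0 \<longrightarrow> f t = W t" by (intro AE_I2) (simp add: ff)
  then have "AE x::real^'n in lebesgue. f (x \<bullet> x) = W (x \<bullet> x)" by (rule AE_sqnorm)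
  with W(2) have "AE x in lebesgue. u x = \<phi> x" by eventually_elim (simp add: u_def)
  moreover have "Ck 2 u" by (rule Ck_2_radial[OF rad])
  moreover have "((\<lambda>x. cmod (pdiffs ds u x)) \<longlongrightarrow> 0) at_infinity" if "mi_order \<beta> \<le> 2" "mi_list \<beta> ds" for \<beta> ds
  proof -
    have "length ds \<le> 2" using mi_list_length[OF that(2)] that(1) by simp
    then show ?thesis by (intro radial_derivatives_vanish[OF rad lim])
  qed
  moreover have "(\<lambda>x. exp (1 / 8 * norm x) * (cmod (u x) + norm (grad u x))) \<in> L_infinity"
  proof (rule radial_exponential_bound[OF rad AR(1,2)])
    fix t assume t: "R \<le> t"
    then have "0 < t" using AR(2) by simp
    then show "t * (cmod (f' t))\<^sup>2 + (cmod (f t))\<^sup>2 \<le> A * exp (- (sqrt t / 4))"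
      using AR(3)[OF t] by (simp add: ff)
  qed
  then have "\<exists>C>0. (\<lambda>x. exp (C * norm x) * (cmod (u x) + norm (grad u x))) \<in> L_infinity"
    by (intro exI[of _ "1 / 8"]) simp
  ultimately show ?thesis by blast
qed

end
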